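(* Let $\Omega$, $\mathcal A$, $u_0$, $\tau=\mathcal A u_0$ and $f$ be as in the context. Then the problems $$(\mathcal P)\quad \inf\Big\{\mathcal F[u]:=\int_\Omega f(x,u(x))\,dx \;:\; u\in L^1(\Omega;\mathbb R^N),\ \mathcal A u=\tau\Big\}$$ and $$(\mathcal P^* )\quad \sup\Big\{\mathcal R[w^*]:=\int_\Omega w^*\cdot\tau\,dx-\int_\Omega f^*(x,\mathcal A^*w^*(x))\,dx \;:\; w^*\in D(\mathcal A^* )\Big\}$$ are dual to each other (that is, $(\mathcal P^* )$ is the dual problem of $(\mathcal P)$ with respect to the perturbation $\Phi$ described in the context), and $$\inf_{u\in L^1(\Omega;\mathbb R^N),\ \mathcal A u=\tau}\mathcal F[u]=\sup_{w^*\in D(\mathcal A^* )}\mathcal R[w^*].$$ Moreover, the supremum on the right-hand side is attained, i.e. $(\mathcal P^* )$ has at least one solution.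
   Context: $\Omega\subset\mathbb R^d$ is an open set with $\mathcal L^d(\partial\Omega)=0$, where $\mathcal L^d$ is Lebesgue measure. Measures: $\mathcal M(\Omega;\mathbb R^N)$ is the space of finite $\mathbb R^N$-valued Radon measures on $\Omega$; $\mu_j\overset{*}{\rightharpoonup}\mu$ means $\int\varphi\cdot d\mu_j\to\int\varphi\cdot d\mu$ for all $\varphi\in C_b(\Omega;\mathbb R^N)$. With $\mu=\frac{d\mu}{d\mathcal L^d}\mathcal L^d+\mu^s$ the Lebesgue decomposition, the area functional is $\langle\mu\rangle(A)=\int_A\sqrt{1+|\frac{d\mu}{d\mathcal L^d}|^2}\,dx+|\mu^s|(A)$. $\mu_j\to\mu$ area-strictly means $\mu_j\overset{*}{\rightharpoonup}\mu$ and $\langle\mu_j\rangle(\Omega)\to\langle\mu\rangle(\Omega)$. A function $u\in L^1$ is identified with $u\mathcal L^d$. Operator: $\mathcal A$ is a linear partial differential operator of arbitrary order on $\Omega$, taking $\mathbb R^N$-valued fields to $\mathbb R^n$-valued ones, with coefficients such that $\mathcal A\mu$ is defined in the sense of distributions for $\mu\in\mathcal M(\Omega;\mathbb R^N)$. Put $W^{\mathcal A,1}(\Omega)=\{u\in L^1(\Omega;\mathbb R^N):\mathcal A u\in L^1(\Omega;\mathbb R^n)\}$, and regard $\mathcal A$ as a (possibly unbounded) operator from $L^1(\Omega;\mathbb R^N)$ to $L^1(\Omega;\mathbb R^n)$ with domain $W^{\mathcal A,1}(\Omega)$ and kernel $\ker\mathcal A\subset L^1(\Omega;\mathbb R^N)$.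 Assumptions: (H1) $\operatorname{Im}\mathcal A=\{\mathcal A u:u\in W^{\mathcal A,1}(\Omega)\}$ is strongly closed in $L^1(\Omega;\mathbb R^n)$; (H2) for every $\mu\in\mathcal M(\Omega;\mathbb R^N)$ with $\mathcal A\mu=0$ in the sense of distributions there is a sequence $(u_j)\subset L^1(\Omega;\mathbb R^N)\cap\ker\mathcal A$ with $u_j\to\mu$ area-strictly. Fix $u_0\in W^{\mathcal A,1}(\Omega)$ and $\tau=\mathcal A u_0\in L^1(\Omega;\mathbb R^n)$. Adjoint: $D(\mathcal A^* )=\{w^*\in L^\infty(\Omega;\mathbb R^n):\exists c>0,\ |\int_\Omega w^*\cdot\mathcal A u\,dx|\le c\|u\|_{L^1}\ \forall u\in W^{\mathcal A,1}(\Omega)\}$, and for $w^*\in D(\mathcal A^* )$, $\mathcal A^*w^*\in L^\infty(\Omega;\mathbb R^N)$ is determined by $\int\mathcal A^*w^*\cdot u\,dx=\int w^*\cdot\mathcal A u\,dx$ for all $u\in W^{\mathcal A,1}(\Omega)$. Integrand: $f:\Omega\times\mathbb R^N\to[0,\infty)$ is continuous, $f(x,\cdot)$ is convex for every $x\in\Omega$, and there is $M>0$ with $\frac1M(|z|-1)\le|f(x,z)|\le M(1+|z|)$ for all $(x,z)\in\Omega\times\mathbb R^N$. Its Fenchel conjugate in $z$ is $f^*(x,z^* )=\sup_{z\in\mathbb R^N}\{z^*\cdot z-f(x,z)\}$. Dual problem: define $\Phi:L^1(\Omega;\mathbb R^N)\times L^1(\Omega;\mathbb R^n)\to\mathbb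 R\cup\{+\infty\}$ by $\Phi(u,p)=\int_\Omega f(x,u(x))\,dx$ if $u\in W^{\mathcal A,1}(\Omega)$ and $\mathcal A u-p=\tau$, and $\Phi(u,p)=+\infty$ otherwise, so that $(\mathcal P)$ is the minimization of $\Phi(\cdot,0)$ over $L^1(\Omega;\mathbb R^N)$. Let $\Phi^*(u^*,w^* )=\sup_{u,p}\{\int u^*\cdot u\,dx+\int w^*\cdot p\,dx-\Phi(u,p)\}$ for $(u^*,w^* )\in L^\infty(\Omega;\mathbb R^N)\times L^\infty(\Omega;\mathbb R^n)$. The dual problem of $(\mathcal P)$ with respect to $\Phi$ is the maximization of $w^*\mapsto-\Phi^*(0,w^* )$ over $L^\infty(\Omega;\mathbb R^n)$, where $\mathcal R[w^*]$ is understood as $-\infty$ for $w^*\notin D(\mathcal A^* )$.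
   Formalization: Adds that F[u] is finite for some u in L^1 (automatic if Ω has finite measure; without it the claim fails, e.g. Ω=R^d, A=0, f=|z-e|, |e|=1); the coefficients of A of order m are taken to be of class C^m. *)

theory Defs
  imports "HOL-Analysis.Analysis"
begin

section \<open>Lebesgue spaces on an open set\<close>

text \<open>
  Elements of Lebesgue spaces are represented by functions on the whole space of which only the
  values on \<open>\<Omega>\<close> matter; equality of elements is equality almost everywhere with respect to
  \<^term>\<open>lebesgue_on \<Omega>\<close>.
\<close>

definition L1 :: "(real^'d) set \<Rightarrow> (real^'d \<Rightarrow> real^'m) set" where
  "L1 \<Omega> = {u. integrable (lebesgue_on \<Omega>) u}"

definition Linf :: "(real^'d) set \<Rightarrow> (real^'d \<Rightarrow> real^'m) set" where
  "Linf \<Omega> = {w. w \<in> borel_measurable (lebesgue_on \<Omega>) \<and>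
                (\<exists>C. AE x in lebesgue_on \<Omega>. norm (w x) \<le> C)}"

definition L1_norm :: "(real^'d) set \<Rightarrow> (real^'d \<Rightarrow> real^'m) \<Rightarrow> real" where
  "L1_norm \<Omega> u = (LINT x|lebesgue_on \<Omega>. norm (u x))"

definition pairing :: "(real^'d) set \<Rightarrow> (real^'d \<Rightarrow> real^'m) \<Rightarrow> (real^'d \<Rightarrow> real^'m) \<Rightarrow> real" where
  "pairing \<Omega> v u = (LINT x|lebesgue_on \<Omega>. v x \<bullet> u x)"


section \<open>Partial derivatives and test functions\<close>

definition partial_deriv ::
    "'d::finite \<Rightarrow> (real^'d \<Rightarrow> 'b::real_normed_vector) \<Rightarrow> real^'d \<Rightarrow> 'b" where
  "partial_deriv i g x = vector_derivative (\<lambda>t. g (x + t *\<^sub>R axis i 1)) (at 0)"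

text \<open>
  Derivatives of order \<open>m\<close> are indexed by lists \<open>[i\<^sub>1, \<dots>, i\<^sub>m]\<close> of coordinate directions rather than
  by multi-indices. Every operator written with multi-indices can be written in this form
  (put each coefficient on one ordering of its directions), and conversely.
\<close>

fun partial_derivs ::
    "'d::finite list \<Rightarrow> (real^'d \<Rightarrow> 'b::real_normed_vector) \<Rightarrow> real^'d \<Rightarrow> 'b" where
  "partial_derivs [] g = g"
| "partial_derivs (i # s) g = partial_deriv i (partial_derivs s g)"

text \<open>
  \<^const>\<open>vector_derivative\<close> is a total function, so the existence of the derivatives has to be
  required separately from their continuity.
\<close>

definition Ck_on ::
    "nat \<Rightarrow> (real^'d::finite) set \<Rightarrow> (real^'d \<Rightarrow> 'b::real_normed_vector) \<Rightarrow> bool" where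
  "Ck_on k \<Omega> g \<longleftrightarrow>
     (\<forall>s. length s < k \<longrightarrow> (\<forall>x\<in>\<Omega>. partial_derivs s g differentiable (at x))) \<and>
     (\<forall>s. length s \<le> k \<longrightarrow> continuous_on \<Omega> (partial_derivs s g))"

definition test_functions :: "(real^'d::finite) set \<Rightarrow> (real^'d \<Rightarrow> real^'m) set" where
  "test_functions \<Omega> = {\<phi>. (\<forall>k. Ck_on k UNIV \<phi>) \<and>
                          (\<exists>K. compact K \<and> K \<subseteq> \<Omega> \<and> (\<forall>x. x \<notin> K \<longrightarrow> \<phi> x = 0))}"


section \<open>Finite vector-valued Radon measures\<close>

definition Borel_in :: "(real^'d) set \<Rightarrow> (real^'d) set set" where
  "Borel_in \<Omega> = {B \<in> sets borel. B \<subseteq> \<Omega>}"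

text \<open>
  A finite \<open>\<real>\<^sup>N\<close>-valued Radon measure on \<open>\<Omega>\<close> is a countably additive \<open>\<real>\<^sup>N\<close>-valued function on the
  Borel subsets of \<open>\<Omega>\<close>: finiteness of the total variation and regularity are then automatic.
\<close>

definition vector_measures :: "(real^'d) set \<Rightarrow> ((real^'d) set \<Rightarrow> real^'m) set" where
  "vector_measures \<Omega> = {\<mu>. \<forall>B::nat \<Rightarrow> (real^'d) set.
      range B \<subseteq> Borel_in \<Omega> \<and> disjoint_family B \<longrightarrow> (\<lambda>i. \<mu> (B i)) sums \<mu> (\<Union>i. B i)}"

definition total_variation :: "((real^'d) set \<Rightarrow> real^'m) \<Rightarrow> (real^'d) set \<Rightarrow> ennreal" where
  "total_variation \<mu> B =
     (SUP P\<in>{P. finite P \<and> P \<subseteq> sets borel \<and> partition_on B P}. \<Sum>C\<in>P. ennreal (norm (\<mu> C)))"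

text \<open>
  Positive part of the Jordan decomposition of a real-valued measure. Since \<open>\<nu> {} = 0\<close>, the
  truncation of negative values by \<^const>\<open>ennreal\<close> does not change the supremum.
\<close>

definition positive_part :: "(real^'d) set \<Rightarrow> ((real^'d) set \<Rightarrow> real) \<Rightarrow> (real^'d) measure" where
  "positive_part \<Omega> \<nu> =
     measure_of \<Omega> (Borel_in \<Omega>) (\<lambda>B. SUP C\<in>{C \<in> sets borel. C \<subseteq> B}. ennreal (\<nu> C))"

definition vector_measure_integral ::
    "(real^'d) set \<Rightarrow> (real^'d \<Rightarrow> real^'m::finite) \<Rightarrow> ((real^'d) set \<Rightarrow> real^'m) \<Rightarrow> real" where
  "vector_measure_integral \<Omega> \<phi> \<mu> =
     (\<Sum>i\<in>UNIV. (LINT x|positive_part \<Omega> (\<lambda>B. \<mu> B $ i). \<phi> x $ i)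
             - (LINT x|positive_part \<Omega> (\<lambda>B. - \<mu> B $ i). \<phi> x $ i))"

definition abs_cont_measure ::
    "(real^'d \<Rightarrow> real^'m) \<Rightarrow> (real^'d) set \<Rightarrow> real^'m" where
  "abs_cont_measure u B = (LINT x|lebesgue_on B. u x)"

definition Lebesgue_decomposition ::
    "(real^'d) set \<Rightarrow> ((real^'d) set \<Rightarrow> real^'m) \<Rightarrow> (real^'d \<Rightarrow> real^'m)
       \<Rightarrow> ((real^'d) set \<Rightarrow> real^'m) \<Rightarrow> bool" where
  "Lebesgue_decomposition \<Omega> \<mu> g \<sigma> \<longleftrightarrow>
     g \<in> L1 \<Omega> \<and> \<sigma> \<in> vector_measures \<Omega> \<and>
     (\<exists>Z\<in>null_sets lborel. \<forall>B\<in>Borel_in \<Omega>. \<sigma> B = \<sigma> (B \<inter> Z)) \<and>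
     (\<forall>B\<in>Borel_in \<Omega>. \<mu> B = abs_cont_measure g B + \<sigma> B)"

definition Lebesgue_density ::
    "(real^'d) set \<Rightarrow> ((real^'d) set \<Rightarrow> real^'m) \<Rightarrow> real^'d \<Rightarrow> real^'m" where
  "Lebesgue_density \<Omega> \<mu> = (SOME g. \<exists>\<sigma>. Lebesgue_decomposition \<Omega> \<mu> g \<sigma>)"

definition singular_part ::
    "(real^'d) set \<Rightarrow> ((real^'d) set \<Rightarrow> real^'m) \<Rightarrow> (real^'d) set \<Rightarrow> real^'m" where
  "singular_part \<Omega> \<mu> B = \<mu> B - abs_cont_measure (Lebesgue_density \<Omega> \<mu>) B"

definition area_functional ::
    "(real^'d) set \<Rightarrow> ((real^'d) set \<Rightarrow> real^'m) \<Rightarrow> (real^'d) set \<Rightarrow> ennreal" where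
  "area_functional \<Omega> \<mu> B =
     (\<integral>\<^sup>+ x. ennreal (sqrt (1 + (norm (Lebesgue_density \<Omega> \<mu> x))\<^sup>2)) \<partial>lebesgue_on B)
     + total_variation (singular_part \<Omega> \<mu>) B"

definition weakly_star_converges ::
    "(real^'d) set \<Rightarrow> (nat \<Rightarrow> (real^'d) set \<Rightarrow> real^'m::finite) \<Rightarrow> ((real^'d) set \<Rightarrow> real^'m) \<Rightarrow> bool"
  where
  "weakly_star_converges \<Omega> \<mu>s \<mu> \<longleftrightarrow>
     (\<forall>\<phi>. continuous_on \<Omega> \<phi> \<and> bounded (\<phi> ` \<Omega>) \<longrightarrow>
        (\<lambda>j. vector_measure_integral \<Omega> \<phi> (\<mu>s j)) \<longlonglongrightarrow> vector_measure_integral \<Omega> \<phi> \<mu>)"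

definition area_strictly_converges ::
    "(real^'d) set \<Rightarrow> (nat \<Rightarrow> (real^'d) set \<Rightarrow> real^'m::finite) \<Rightarrow> ((real^'d) set \<Rightarrow> real^'m) \<Rightarrow> bool"
  where
  "area_strictly_converges \<Omega> \<mu>s \<mu> \<longleftrightarrow>
     weakly_star_converges \<Omega> \<mu>s \<mu> \<and>
     (\<lambda>j. area_functional \<Omega> (\<mu>s j) \<Omega>) \<longlonglongrightarrow> area_functional \<Omega> \<mu> \<Omega>"


section \<open>Linear partial differential operators\<close>

text \<open>
  An operator of order at most \<open>k\<close> is \<open>\<A> u = \<Sum>\<^bsub>|s| \<le> k\<^esub> A\<^sub>s \<partial>\<^sub>s u\<close> with matrix-valued coefficients
  \<open>A\<^sub>s\<close>. Applying it to a measure in the sense of distributions means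
  \<open>\<langle>\<A> \<mu>, \<phi>\<rangle> = \<Sum>\<^sub>s (-1)\<^bsup>|s|\<^esup> \<integral> \<partial>\<^sub>s (A\<^sub>s\<^sup>T \<phi>) \<cdot> d\<mu>\<close>, which makes sense for all finite measures when
  \<open>A\<^sub>s\<close> is of class \<open>C\<^bsup>|s|\<^esup>\<close> on \<open>\<Omega>\<close>.
\<close>

type_synonym ('d, 'N, 'n) coefficients = "'d list \<Rightarrow> real^'d \<Rightarrow> real^'N^'n"

definition admissible_coefficients ::
    "(real^'d::finite) set \<Rightarrow> nat \<Rightarrow> ('d, 'N::finite, 'n::finite) coefficients \<Rightarrow> bool" where
  "admissible_coefficients \<Omega> k A \<longleftrightarrow> (\<forall>s. length s \<le> k \<longrightarrow> Ck_on (length s) \<Omega> (A s))"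

definition formal_adjoint ::
    "nat \<Rightarrow> ('d::finite, 'N::finite, 'n::finite) coefficients
       \<Rightarrow> (real^'d \<Rightarrow> real^'n) \<Rightarrow> real^'d \<Rightarrow> real^'N" where
  "formal_adjoint k A \<phi> x =
     (\<Sum>s\<in>{s. length s \<le> k}.
        (-1) ^ length s *\<^sub>R partial_derivs s (\<lambda>y. transpose (A s y) *v \<phi> y) x)"

definition annihilated_measure ::
    "(real^'d::finite) set \<Rightarrow> nat \<Rightarrow> ('d, 'N::finite, 'n::finite) coefficients
       \<Rightarrow> ((real^'d) set \<Rightarrow> real^'N) \<Rightarrow> bool" where
  "annihilated_measure \<Omega> k A \<mu> \<longleftrightarrow>
     (\<forall>\<phi>\<in>test_functions \<Omega>. vector_measure_integral \<Omega> (formal_adjoint k A \<phi>) \<mu> = 0)"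

definition has_distributional_image ::
    "(real^'d::finite) set \<Rightarrow> nat \<Rightarrow> ('d, 'N::finite, 'n::finite) coefficients
       \<Rightarrow> (real^'d \<Rightarrow> real^'N) \<Rightarrow> (real^'d \<Rightarrow> real^'n) \<Rightarrow> bool" where
  "has_distributional_image \<Omega> k A u p \<longleftrightarrow>
     (\<forall>\<phi>\<in>test_functions \<Omega>. pairing \<Omega> (formal_adjoint k A \<phi>) u = pairing \<Omega> \<phi> p)"

definition WA1 ::
    "(real^'d::finite) set \<Rightarrow> nat \<Rightarrow> ('d, 'N::finite, 'n::finite) coefficients
       \<Rightarrow> (real^'d \<Rightarrow> real^'N) set" where
  "WA1 \<Omega> k A = {u \<in> L1 \<Omega>. \<exists>p\<in>L1 \<Omega>. has_distributional_image \<Omega> k A u p}"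

text \<open>A representative of \<open>\<A> u \<in> L\<^sup>1\<close>, which is unique up to null sets.\<close>

definition apply_op ::
    "(real^'d::finite) set \<Rightarrow> nat \<Rightarrow> ('d, 'N::finite, 'n::finite) coefficients
       \<Rightarrow> (real^'d \<Rightarrow> real^'N) \<Rightarrow> real^'d \<Rightarrow> real^'n" where
  "apply_op \<Omega> k A u = (SOME p. p \<in> L1 \<Omega> \<and> has_distributional_image \<Omega> k A u p)"

definition op_kernel ::
    "(real^'d::finite) set \<Rightarrow> nat \<Rightarrow> ('d, 'N::finite, 'n::finite) coefficients
       \<Rightarrow> (real^'d \<Rightarrow> real^'N) set" where
  "op_kernel \<Omega> k A = {u \<in> WA1 \<Omega> k A. AE x in lebesgue_on \<Omega>. apply_op \<Omega> k A u x = 0}"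

definition op_image ::
    "(real^'d::finite) set \<Rightarrow> nat \<Rightarrow> ('d, 'N::finite, 'n::finite) coefficients
       \<Rightarrow> (real^'d \<Rightarrow> real^'n) set" where
  "op_image \<Omega> k A =
     {p \<in> L1 \<Omega>. \<exists>u\<in>WA1 \<Omega> k A. AE x in lebesgue_on \<Omega>. apply_op \<Omega> k A u x = p x}"

definition strongly_closed :: "(real^'d) set \<Rightarrow> (real^'d \<Rightarrow> real^'m) set \<Rightarrow> bool" where
  "strongly_closed \<Omega> S \<longleftrightarrow>
     (\<forall>ps. \<forall>p\<in>L1 \<Omega>. (\<forall>j::nat. ps j \<in> S) \<and> (\<lambda>j. L1_norm \<Omega> (\<lambda>x. ps j x - p x)) \<longlonglongrightarrow> 0
        \<longrightarrow> p \<in> S)"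

definition adjoint_domain ::
    "(real^'d::finite) set \<Rightarrow> nat \<Rightarrow> ('d, 'N::finite, 'n::finite) coefficients
       \<Rightarrow> (real^'d \<Rightarrow> real^'n) set" where
  "adjoint_domain \<Omega> k A =
     {w \<in> Linf \<Omega>. \<exists>c>0. \<forall>u\<in>WA1 \<Omega> k A. \<bar>pairing \<Omega> w (apply_op \<Omega> k A u)\<bar> \<le> c * L1_norm \<Omega> u}"

text \<open>A representative of \<open>\<A>\<^sup>* w \<in> L\<^sup>\<infinity>\<close>, which is unique up to null sets.\<close>

definition adjoint_op ::
    "(real^'d::finite) set \<Rightarrow> nat \<Rightarrow> ('d, 'N::finite, 'n::finite) coefficients
       \<Rightarrow> (real^'d \<Rightarrow> real^'n) \<Rightarrow> real^'d \<Rightarrow> real^'N" where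
  "adjoint_op \<Omega> k A w =
     (SOME v. v \<in> Linf \<Omega> \<and> (\<forall>u\<in>WA1 \<Omega> k A. pairing \<Omega> v u = pairing \<Omega> w (apply_op \<Omega> k A u)))"


section \<open>The primal and the dual problem\<close>

definition fenchel_conjugate ::
    "(real^'d \<Rightarrow> real^'N \<Rightarrow> real) \<Rightarrow> real^'d \<Rightarrow> real^'N \<Rightarrow> ereal" where
  "fenchel_conjugate f x zs = (SUP z. ereal (zs \<bullet> z - f x z))"

text \<open>The integral of an extended real-valued function, as positive minus negative part
  (\<^const>\<open>e2ennreal\<close> sends negative numbers to \<open>0\<close>).\<close>

definition ereal_integral :: "'a measure \<Rightarrow> ('a \<Rightarrow> ereal) \<Rightarrow> ereal" where
  "ereal_integral M g =
     enn2ereal (\<integral>\<^sup>+ x. e2ennreal (g x) \<partial>M) - enn2ereal (\<integral>\<^sup>+ x. e2ennreal (- g x) \<partial>M)"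

definition primal_functional ::
    "(real^'d) set \<Rightarrow> (real^'d \<Rightarrow> real^'N \<Rightarrow> real) \<Rightarrow> (real^'d \<Rightarrow> real^'N) \<Rightarrow> ereal" where
  "primal_functional \<Omega> f u = enn2ereal (\<integral>\<^sup>+ x. ennreal (f x (u x)) \<partial>lebesgue_on \<Omega>)"

definition primal_feasible ::
    "(real^'d::finite) set \<Rightarrow> nat \<Rightarrow> ('d, 'N::finite, 'n::finite) coefficients
       \<Rightarrow> (real^'d \<Rightarrow> real^'n) \<Rightarrow> (real^'d \<Rightarrow> real^'N) set" where
  "primal_feasible \<Omega> k A \<tau> =
     {u \<in> WA1 \<Omega> k A. AE x in lebesgue_on \<Omega>. apply_op \<Omega> k A u x = \<tau> x}"

definition dual_functional ::
    "(real^'d::finite) set \<Rightarrow> nat \<Rightarrow> ('d, 'N::finite, 'n::finite) coefficients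
       \<Rightarrow> (real^'d \<Rightarrow> real^'N \<Rightarrow> real) \<Rightarrow> (real^'d \<Rightarrow> real^'n) \<Rightarrow> (real^'d \<Rightarrow> real^'n) \<Rightarrow> ereal" where
  "dual_functional \<Omega> k A f \<tau> w =
     ereal (pairing \<Omega> w \<tau>)
     - ereal_integral (lebesgue_on \<Omega>) (\<lambda>x. fenchel_conjugate f x (adjoint_op \<Omega> k A w x))"

definition perturbation ::
    "(real^'d::finite) set \<Rightarrow> nat \<Rightarrow> ('d, 'N::finite, 'n::finite) coefficients
       \<Rightarrow> (real^'d \<Rightarrow> real^'N \<Rightarrow> real) \<Rightarrow> (real^'d \<Rightarrow> real^'n)
       \<Rightarrow> (real^'d \<Rightarrow> real^'N) \<Rightarrow> (real^'d \<Rightarrow> real^'n) \<Rightarrow> ereal" where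
  "perturbation \<Omega> k A f \<tau> u p =
     (if u \<in> WA1 \<Omega> k A \<and> (AE x in lebesgue_on \<Omega>. apply_op \<Omega> k A u x - p x = \<tau> x)
      then primal_functional \<Omega> f u else \<infinity>)"

definition perturbation_conjugate ::
    "(real^'d::finite) set \<Rightarrow> nat \<Rightarrow> ('d, 'N::finite, 'n::finite) coefficients
       \<Rightarrow> (real^'d \<Rightarrow> real^'N \<Rightarrow> real) \<Rightarrow> (real^'d \<Rightarrow> real^'n)
       \<Rightarrow> (real^'d \<Rightarrow> real^'N) \<Rightarrow> (real^'d \<Rightarrow> real^'n) \<Rightarrow> ereal" where
  "perturbation_conjugate \<Omega> k A f \<tau> us ws =
     (SUP (u, p)\<in>L1 \<Omega> \<times> L1 \<Omega>.
        ereal (pairing \<Omega> us u + pairing \<Omega> ws p) - perturbation \<Omega> k A f \<tau> u p)"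

text \<open>
  If \<open>\<Omega>\<close> has finite measure, linear growth makes the primal functional finite on all of \<open>L\<^sup>1\<close>. On sets
  of infinite measure it may be infinite everywhere: for \<open>f x z = norm (z - e)\<close> with a unit vector
  \<open>e\<close> and \<open>\<A> = 0\<close>, the primal value is \<open>\<infinity>\<close> whereas the dual functional vanishes identically.
\<close>

lemma primal_functional_finite:
  fixes \<Omega> :: "(real^'d) set" and u :: "real^'d \<Rightarrow> real^'N"
  assumes "\<Omega> \<in> sets lebesgue" "emeasure lebesgue \<Omega> < \<infinity>" "u \<in> L1 \<Omega>"
    and "\<And>x z. x \<in> \<Omega> \<Longrightarrow> f x z \<le> M * (1 + norm z)"
  shows "primal_functional \<Omega> f u < \<infinity>"
proof -
  have fin: "finite_measure (lebesgue_on \<Omega>)"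
    using assms(1,2) by (intro finite_measureI) (simp add: emeasure_restrict_space)
  have "integrable (lebesgue_on \<Omega>) (\<lambda>x. M * (1 + norm (u x)))"
    using assms(3)
    by (intro integrable_mult_right Bochner_Integration.integrable_add integrable_norm
          finite_measure.integrable_const[OF fin]) (simp add: L1_def)
  then have "(\<integral>\<^sup>+ x. ennreal (norm (M * (1 + norm (u x)))) \<partial>lebesgue_on \<Omega>) < \<infinity>"
    unfolding integrable_iff_bounded by blast
  moreover have "(\<integral>\<^sup>+ x. ennreal (f x (u x)) \<partial>lebesgue_on \<Omega>)
      \<le> (\<integral>\<^sup>+ x. ennreal (norm (M * (1 + norm (u x)))) \<partial>lebesgue_on \<Omega>)"
  proof (intro nn_integral_mono ennreal_leI)
    fix x assume "x \<in> space (lebesgue_on \<Omega>)"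
    then have "f x (u x) \<le> M * (1 + norm (u x))"
      using assms(4) by simp
    then show "f x (u x) \<le> norm (M * (1 + norm (u x)))"
      by (metis abs_ge_self order_trans real_norm_def)
  qed
  ultimately have "(\<integral>\<^sup>+ x. ennreal (f x (u x)) \<partial>lebesgue_on \<Omega>) < \<infinity>"
    by (rule le_less_trans[rotated])
  then show ?thesis
    by (simp add: primal_functional_def less_top enn2ereal_eq_top_iff)
qed

end

theory Submission
  imports Defs "HOL-Library.Function_Algebras" "HOL-Computational_Algebra.Polynomial"
begin

text \<open>
  Write \<open>G\<close> for the graph of \<open>\<A>\<close>. It is closed in \<open>L\<^sup>1 \<times> L\<^sup>1\<close>, so by (H1) and the open mapping theorem
  every \<open>q\<close> in the image has a preimage of norm at most \<open>C \<parallel>q\<parallel>\<close>. Since \<open>\<F>\<close> is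
  \<open>M\<close>-Lipschitz on \<open>L\<^sup>1\<close>, the primal value \<open>m\<close> satisfies \<open>m \<le> \<F>[u] + M C \<parallel>r - \<tau>\<parallel>\<close> for all \<open>(u, r) \<in> G\<close>.
  As \<open>\<F>\<close> is convex, a Hahn-Banach argument turns this into \<open>m \<le> \<F>[u] - \<langle>w, r - \<tau>\<rangle>\<close> on \<open>G\<close> with a functional \<open>w\<close>, which lies in
  \<open>L\<^sup>\<infinity>\<close> because that is the dual of \<open>L\<^sup>1\<close>; this \<open>w\<close> solves the dual problem.

  That \<open>-\<Phi>\<^sup>*(0, w)\<close> equals \<open>\<R>[w]\<close> rests on two facts: test functions are dense in \<open>L\<^sup>1\<close> and belong to
  \<open>W\<^bsup>\<A>,1\<^esup>\<close>, so that a supremum over \<open>W\<^bsup>\<A>,1\<^esup>\<close> is one over \<open>L\<^sup>1\<close>, and the latter may be taken pointwise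
  under the integral.
\<close>

section \<open>Sublinear functionals and the open mapping argument\<close>

text \<open>The value function p |-> inf {F[u] : A u = \<tau> + p} is infinite off the image of A,
  which may be a proper closed subspace, so continuity at 0 in L^1, the usual condition for an
  attained dual, cannot be expected. (H1) enters instead as a lower bound m - K ||p|| on this
  function. Hahn-Banach is applied to the infimal convolution of a cone, generated by the shifted
  epigraph, with K times the norm; this is finite on all of L^1 and yields a functional there at
  once. The same lemma, fed with the graph of a linear functional, extends u |-> <w, A u> from the
  domain of A to L^1 and so constructs the adjoint. The Lipschitz constant M is asymptotic: slopes
  of a convex function grow along rays and are bounded by its growth at infinity. Elements of L^1
  are functions, not classes, so the norm is only a seminorm on a subspace of the function type. The
  operator is handled through its graph, an honest subspace, whereas \<open>apply_op\<close> chooses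
  representatives and is linear only almost everywhere.\<close>

definition sublinear :: "('v::real_vector \<Rightarrow> real) \<Rightarrow> bool" where
  "sublinear q \<longleftrightarrow> (\<forall>x y. q (x + y) \<le> q x + q y) \<and> (\<forall>c x. c > 0 \<longrightarrow> q (c *\<^sub>R x) = c * q x)"

lemma sublinear_0:
  assumes "sublinear q" shows "q 0 = 0"
proof -
  have "q (2 *\<^sub>R 0) = 2 * q 0" using assms unfolding sublinear_def by (metis zero_less_numeral)
  then show ?thesis by simp
qed

lemma sublinear_neg_le:
  assumes "sublinear q" shows "- q (- x) \<le> q x"
proof -
  have "q (x + - x) \<le> q x + q (- x)" using assms unfolding sublinear_def by blast
  then show ?thesis using sublinear_0[OF assms] by simp
qed

text \<open>By subadditivity \<open>p (x + t *\<^sub>R y) - t * p y\<close> never falls below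
  \<open>- p (- x)\<close>, so the infimum along the ray is finite. The parameter t = 0 gives the
  first bound and t = 1 the second; when \<open>p\<close> is minimal and hence equal to
  \<open>r\<close>, the second bound becomes superadditivity.\<close>

lemma sublinear_directional_inf:
  fixes p :: "'v::real_vector \<Rightarrow> real" and y :: 'v
  assumes p: "sublinear p"
  defines "r \<equiv> \<lambda>x. INF t\<in>{0..}. p (x + t *\<^sub>R y) - t * p y"
  shows "sublinear r" "\<And>x. r x \<le> p x" "\<And>x. r x \<le> p (x + y) - p y"
proof -
  have hom0: "p (t *\<^sub>R y) = t * p y" if "t \<ge> 0" for t
    using that p sublinear_0[OF p] unfolding sublinear_def by (cases "t = 0") auto
  have low: "- p (- x) \<le> p (x + t *\<^sub>R y) - t * p y" if "t \<ge> 0" for x t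
  proof -
    have "p ((x + t *\<^sub>R y) + - x) \<le> p (x + t *\<^sub>R y) + p (- x)"
      using p unfolding sublinear_def by blast
    then show ?thesis using hom0[OF that] by simp
  qed
  have bdd: "bdd_below ((\<lambda>t. p (x + t *\<^sub>R y) - t * p y) ` {0..})" for x
    using low by (intro bdd_belowI2[where m="- p (- x)"]) auto
  have le: "r x \<le> p (x + t *\<^sub>R y) - t * p y" if "t \<ge> 0" for x t
    unfolding r_def using that by (intro cINF_lower bdd) auto
  have ge: "a \<le> r x" if "\<And>t. t \<ge> 0 \<Longrightarrow> a \<le> p (x + t *\<^sub>R y) - t * p y" for a x
    unfolding r_def using that by (intro cINF_greatest) auto
  show "r x \<le> p x" for x using le[of 0 x] by simp
  show "r x \<le> p (x + y) - p y" for x using le[of 1 x] by simp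
  have add: "r (a + b) \<le> r a + r b" for a b
  proof -
    \<comment> \<open>The two infima on the right are reached one after the other: with t fixed
      \<open>ge\<close> runs over s, and then over t. The parameter s + t serves for a + b.\<close>
    have "r (a + b) - (p (b + t *\<^sub>R y) - t * p y) \<le> r a" if t: "t \<ge> 0" for t
    proof (rule ge)
      fix s :: real assume s: "s \<ge> 0"
      have "r (a + b) \<le> p ((a + b) + (s + t) *\<^sub>R y) - (s + t) * p y" using s t by (intro le) auto
      also have "p ((a + b) + (s + t) *\<^sub>R y) = p ((a + s *\<^sub>R y) + (b + t *\<^sub>R y))"
        by (simp add: algebra_simps)
      also have "\<dots> \<le> p (a + s *\<^sub>R y) + p (b + t *\<^sub>R y)" using p unfolding sublinear_def by blast
      finally show "r (a + b) - (p (b + t *\<^sub>R y) - t * p y) \<le> p (a + s *\<^sub>R y) - s * p y"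
        by (simp add: algebra_simps)
    qed
    then have "r (a + b) - r a \<le> r b" by (intro ge) (simp add: algebra_simps)
    then show ?thesis by simp
  qed
  have hom1: "c * r x \<le> r (c *\<^sub>R x)" if c: "c > 0" for c x
  proof (rule ge)
    fix t :: real assume t: "t \<ge> 0"
    have "c * r x \<le> c * (p (x + (t / c) *\<^sub>R y) - (t / c) * p y)"
      using c t by (intro mult_left_mono le) auto
    also have "\<dots> = c * p (x + (t / c) *\<^sub>R y) - t * p y" using c by (simp add: right_diff_distrib)
    also have "c * p (x + (t / c) *\<^sub>R y) = p (c *\<^sub>R (x + (t / c) *\<^sub>R y))"
      using p c unfolding sublinear_def by simp
    also have "c *\<^sub>R (x + (t / c) *\<^sub>R y) = c *\<^sub>R x + t *\<^sub>R y" using c by (simp add: scaleR_add_right)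
    finally show "c * r x \<le> p (c *\<^sub>R x + t *\<^sub>R y) - t * p y" .
  qed
  have "r (c *\<^sub>R x) = c * r x" if c: "c > 0" for c x
  proof (rule antisym)
    have "inverse c * r (c *\<^sub>R x) \<le> r (inverse c *\<^sub>R (c *\<^sub>R x))" using c by (intro hom1) auto
    then show "r (c *\<^sub>R x) \<le> c * r x" using c by (simp add: field_simps)
  qed (rule hom1[OF c])
  with add show "sublinear r" unfolding sublinear_def by blast
qed

text \<open>Zorn's lemma gives a minimal sublinear functional below \<open>q\<close>, and a minimal one equals its own
  \<open>sublinear_directional_inf\<close> in every direction, which makes it additive.\<close>

theorem sublinear_dominates_linear:
  fixes q :: "'v::real_vector \<Rightarrow> real"
  assumes q: "sublinear q"
  obtains l where "linear l" "\<And>x. l x \<le> q x"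
proof -
  define S where "S = {p :: 'v \<Rightarrow> real. sublinear p \<and> (\<forall>x. p x \<le> q x)}"
  \<comment> \<open>The order is reversed, so that a maximal element in Zorn's lemma is a minimal
    functional.\<close>
  define P where "P p p' \<longleftrightarrow> (\<forall>x. p' x \<le> p x)" for p p' :: "'v \<Rightarrow> real"
  have "\<exists>m\<in>S. \<forall>a\<in>S. P m a \<longrightarrow> a = m"
  proof (rule predicate_Zorn)
    show "partial_order_on S (relation_of P S)"
      by (rule partial_order_on_relation_ofI) (auto simp: P_def fun_eq_iff intro: order_trans order.antisym)
  next
    fix C assume "C \<in> Chains (relation_of P S)"
    then have CS: "\<And>p. p \<in> C \<Longrightarrow> p \<in> S" and ch: "\<And>p p'. p \<in> C \<Longrightarrow> p' \<in> C \<Longrightarrow> P p p' \<or> P p' p"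
      unfolding Chains_def relation_of_def by auto
    show "\<exists>u\<in>S. \<forall>a\<in>C. P a u"
    proof (cases "C = {}")
      case True
      then show ?thesis using q by (intro bexI[of _ q]) (auto simp: S_def)
    next
      case False
      define u where "u x = (INF p\<in>C. p x)" for x
      \<comment> \<open>All members of \<open>S\<close> share this lower bound, so pointwise infima
        of chains stay finite.\<close>
      have low: "- q (- x) \<le> p x" if "p \<in> C" for p x
      proof -
        have "sublinear p" "p (- x) \<le> q (- x)" using CS[OF that] unfolding S_def by auto
        then show ?thesis using sublinear_neg_le[of p x] by linarith
      qed
      have bdd: "bdd_below ((\<lambda>p. p x) ` C)" for x
        using low by (intro bdd_belowI2[where m="- q (- x)"]) auto
      have le: "u x \<le> p x" if "p \<in> C" for p x
        unfolding u_def using that by (intro cINF_lower bdd)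
      have ge: "a \<le> u x" if "\<And>p. p \<in> C \<Longrightarrow> a \<le> p x" for a x
        unfolding u_def using that False by (intro cINF_greatest) auto
      have sl: "sublinear p" if "p \<in> C" for p using CS[OF that] unfolding S_def by blast
      have "u (a + b) \<le> u a + u b" for a b
      proof -
        have "u (a + b) - p' b \<le> u a" if p': "p' \<in> C" for p'
        proof (rule ge)
          fix p assume p: "p \<in> C"
          \<comment> \<open>Comparability in the chain makes the infimum subadditive: the smaller of
            \<open>p\<close> and \<open>p'\<close> can be used for both summands.\<close>
          obtain p0 where p0: "p0 \<in> C" "\<And>x. p0 x \<le> p x" "\<And>x. p0 x \<le> p' x"
            using ch[OF p p'] p p' unfolding P_def by auto
          have "u (a + b) \<le> p0 (a + b)" by (rule le[OF p0(1)])
          also have "\<dots> \<le> p0 a + p0 b" using sl[OF p0(1)] unfolding sublinear_def by blast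
          also have "\<dots> \<le> p a + p' b" by (intro add_mono p0)
          finally show "u (a + b) - p' b \<le> p a" by simp
        qed
        then have "u (a + b) - u a \<le> u b" by (intro ge) (simp add: algebra_simps)
        then show ?thesis by simp
      qed
      moreover have hom1: "c * u x \<le> u (c *\<^sub>R x)" if c: "c > 0" for c x
      proof (rule ge)
        fix p assume p: "p \<in> C"
        have "c * u x \<le> c * p x" using c le[OF p] by (intro mult_left_mono) auto
        also have "\<dots> = p (c *\<^sub>R x)" using sl[OF p] c unfolding sublinear_def by simp
        finally show "c * u x \<le> p (c *\<^sub>R x)" .
      qed
      have "u (c *\<^sub>R x) = c * u x" if c: "c > 0" for c x
      proof (rule antisym)
        have "inverse c * u (c *\<^sub>R x) \<le> u (inverse c *\<^sub>R (c *\<^sub>R x))" using c by (intro hom1) auto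
        then show "u (c *\<^sub>R x) \<le> c * u x" using c by (simp add: field_simps)
      qed (rule hom1[OF c])
      ultimately have "sublinear u" unfolding sublinear_def by blast
      moreover have "u x \<le> q x" for x
        using False le CS unfolding S_def by (metis (mono_tags, lifting) equals0I mem_Collect_eq order_trans)
      ultimately show ?thesis
        using le by (intro bexI[of _ u]) (auto simp: S_def P_def)
    qed
  qed
  then obtain l where l: "l \<in> S" "\<And>a. a \<in> S \<Longrightarrow> P l a \<Longrightarrow> a = l" by blast
  then have sl: "sublinear l" and lq: "\<And>x. l x \<le> q x" by (auto simp: S_def)
  have additive: "l (x + y) = l x + l y" for x y
  proof -
    define r where "r = (\<lambda>x. INF t\<in>{0..}. l (x + t *\<^sub>R y) - t * l y)"
    have r: "sublinear r" "\<And>x. r x \<le> l x" "\<And>x. r x \<le> l (x + y) - l y"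
      unfolding r_def using sublinear_directional_inf[where y=y, OF sl] by blast+
    have "r = l" using r(1,2) lq by (intro l(2)) (auto simp: S_def P_def intro: order_trans)
    with r(3)[of x] have "l x + l y \<le> l (x + y)" by simp
    moreover have "l (x + y) \<le> l x + l y" using sl unfolding sublinear_def by blast
    ultimately show ?thesis by simp
  qed
  have neg: "l (- x) = - l x" for x
    using additive[of x "- x"] sublinear_0[OF sl] by simp
  have pos: "l (c *\<^sub>R x) = c * l x" if "c > 0" for c x
    using sl that unfolding sublinear_def by blast
  have "l (c *\<^sub>R x) = c * l x" for c x
  proof (cases c "0::real" rule: linorder_cases)
    case less
    then have "l ((- c) *\<^sub>R (- x)) = (- c) * l (- x)" by (intro pos) auto
    then show ?thesis using neg by simp
  qed (use pos sublinear_0[OF sl] in auto)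
  then have "linear l" using additive by (intro linearI) auto
  with lq show ?thesis using that by blast
qed

section \<open>Seminorms on subspaces, Hahn-Banach and open mapping\<close>

definition seminorm_on :: "'v::real_vector set \<Rightarrow> ('v \<Rightarrow> real) \<Rightarrow> bool" where
  "seminorm_on V N \<longleftrightarrow> subspace V \<and> (\<forall>x\<in>V. 0 \<le> N x) \<and>
     (\<forall>x\<in>V. \<forall>y\<in>V. N (x + y) \<le> N x + N y) \<and> (\<forall>c. \<forall>x\<in>V. N (c *\<^sub>R x) = \<bar>c\<bar> * N x)"

lemma seminorm_onD:
  assumes "seminorm_on V N"
  shows "subspace V" "x \<in> V \<Longrightarrow> 0 \<le> N x" "x \<in> V \<Longrightarrow> y \<in> V \<Longrightarrow> N (x + y) \<le> N x + N y"
    "x \<in> V \<Longrightarrow> N (c *\<^sub>R x) = \<bar>c\<bar> * N x" "N 0 = 0" "x \<in> V \<Longrightarrow> N (- x) = N x"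
    "x \<in> V \<Longrightarrow> y \<in> V \<Longrightarrow> N (x - y) \<le> N x + N y"
    "x \<in> V \<Longrightarrow> y \<in> V \<Longrightarrow> N (x - y) = N (y - x)"
proof -
  show sub: "subspace V" and "x \<in> V \<Longrightarrow> 0 \<le> N x"
    and add: "x \<in> V \<Longrightarrow> y \<in> V \<Longrightarrow> N (x + y) \<le> N x + N y" for x y
    using assms unfolding seminorm_on_def by auto
  show hom: "x \<in> V \<Longrightarrow> N (c *\<^sub>R x) = \<bar>c\<bar> * N x" for x c
    using assms unfolding seminorm_on_def by blast
  show "N 0 = 0" using hom[of 0 0] subspace_0[OF sub] by simp
  show neg: "x \<in> V \<Longrightarrow> N (- x) = N x" for x using hom[of x "-1"] by simp
  show "x \<in> V \<Longrightarrow> y \<in> V \<Longrightarrow> N (x - y) \<le> N x + N y"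
    using add[of x "- y"] neg[of y] subspace_neg[OF sub, of y] by simp
  show "x \<in> V \<Longrightarrow> y \<in> V \<Longrightarrow> N (x - y) = N (y - x)"
    using neg[of "x - y"] subspace_diff[OF sub, of x y] by simp
qed

text \<open>Every pair (x, a) in \<open>D\<close> is a demand l x \<le> a, and the last hypothesis
  is its compatibility with l \<ge> - N. The functional \<open>q\<close> is the infimal convolution
  of these demands with \<open>N\<close>: it is sublinear because \<open>D\<close> is a convex cone,
  and a linear functional below it meets both kinds of bounds. For the graph of a linear functional
  this is the extension theorem, for an epigraph cone a sandwich theorem.\<close>

theorem Hahn_Banach_cone:
  fixes N :: "'v::real_vector \<Rightarrow> real" and D :: "('v \<times> real) set"
  assumes N: "seminorm_on X N"
    and D0: "(0, 0) \<in> D" and DX: "\<And>x a. (x, a) \<in> D \<Longrightarrow> x \<in> X"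
    and Dadd: "\<And>x a y b. (x, a) \<in> D \<Longrightarrow> (y, b) \<in> D \<Longrightarrow> (x + y, a + b) \<in> D"
    and Dscale: "\<And>x a c. (x, a) \<in> D \<Longrightarrow> c > 0 \<Longrightarrow> (c *\<^sub>R x, c * a) \<in> D"
    and Dge: "\<And>x a. (x, a) \<in> D \<Longrightarrow> 0 \<le> a + N x"
  obtains l where "linear l" "\<And>x. x \<in> X \<Longrightarrow> l x \<le> N x" "\<And>x a. (x, a) \<in> D \<Longrightarrow> l x \<le> a"
proof -
  note sub = seminorm_onD(1)[OF N]
  \<comment> \<open>\<open>sublinear_dominates_linear\<close> works on the whole type while
    \<open>N\<close> is a seminorm on \<open>X\<close> only; a linear projection \<open>pr\<close>
    onto \<open>X\<close> carries the problem over.\<close>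
  have "linear (\<lambda>x::'v. x)" by (intro linearI) auto
  then obtain pr :: "'v \<Rightarrow> 'v" where pr: "pr ` UNIV \<subseteq> X" "linear pr" "\<And>v. v \<in> X \<Longrightarrow> pr v = v"
    using linear_exists_left_inverse_on[of "\<lambda>x::'v. x" X] sub by auto
  have prX: "pr x \<in> X" for x using pr(1) by auto
  define q where "q x = (INF d\<in>D. snd d + N (pr x - fst d))" for x
  have low: "- N (pr x) \<le> a + N (pr x - y)" if "(y, a) \<in> D" for x y a
  proof -
    have "N y = N (pr x - (pr x - y))" by simp
    also have "\<dots> \<le> N (pr x) + N (pr x - y)"
      using N prX DX[OF that] by (intro seminorm_onD(7)[OF N] subspace_diff[OF sub]) auto
    finally show ?thesis using Dge[OF that] by simp
  qed
  have bdd: "bdd_below ((\<lambda>d. snd d + N (pr x - fst d)) ` D)" for x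
    using low by (intro bdd_belowI2[where m="- N (pr x)"]) auto
  have le: "q x \<le> a + N (pr x - y)" if "(y, a) \<in> D" for x y a
    unfolding q_def using that by (intro cINF_lower2[OF bdd that]) auto
  have ge: "b \<le> q x" if "\<And>y a. (y, a) \<in> D \<Longrightarrow> b \<le> a + N (pr x - y)" for b x
    unfolding q_def using that D0 by (intro cINF_greatest) auto
  have add: "q (x + y) \<le> q x + q y" for x y
  proof -
    have "q (x + y) - (b + N (pr y - y')) \<le> q x" if b: "(y', b) \<in> D" for y' b
    proof (rule ge)
      fix x' a assume a: "(x', a) \<in> D"
      have "q (x + y) \<le> (a + b) + N (pr (x + y) - (x' + y'))" by (rule le[OF Dadd[OF a b]])
      also have "pr (x + y) - (x' + y') = (pr x - x') + (pr y - y')"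
        by (simp add: linear_add[OF pr(2)])
      also have "N \<dots> \<le> N (pr x - x') + N (pr y - y')"
        using prX DX[OF a] DX[OF b] by (intro seminorm_onD(3)[OF N] subspace_diff[OF sub])
      finally show "q (x + y) - (b + N (pr y - y')) \<le> a + N (pr x - x')" by simp
    qed
    then have "q (x + y) - q x \<le> q y" by (intro ge) (simp add: algebra_simps)
    then show ?thesis by simp
  qed
  have hom1: "c * q x \<le> q (c *\<^sub>R x)" if c: "c > 0" for c x
  proof (rule ge)
    fix y a assume a: "(y, a) \<in> D"
    have "(inverse c *\<^sub>R y, inverse c * a) \<in> D" using a c by (intro Dscale) auto
    then have "c * q x \<le> c * (inverse c * a + N (pr x - inverse c *\<^sub>R y))"
      using c by (intro mult_left_mono le) auto
    also have "\<dots> = a + N (c *\<^sub>R (pr x - inverse c *\<^sub>R y))"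
      using c DX[OF a] prX
      by (subst seminorm_onD(4)[OF N]) (auto simp: algebra_simps intro!: subspace_diff[OF sub] subspace_scale[OF sub])
    also have "c *\<^sub>R (pr x - inverse c *\<^sub>R y) = pr (c *\<^sub>R x) - y"
      using c by (simp add: linear_scale[OF pr(2)] scaleR_diff_right)
    finally show "c * q x \<le> a + N (pr (c *\<^sub>R x) - y)" .
  qed
  have "q (c *\<^sub>R x) = c * q x" if c: "c > 0" for c x
  proof (rule antisym)
    have "inverse c * q (c *\<^sub>R x) \<le> q (inverse c *\<^sub>R (c *\<^sub>R x))" using c by (intro hom1) auto
    then show "q (c *\<^sub>R x) \<le> c * q x" using c by (simp add: field_simps)
  qed (rule hom1[OF c])
  with add have "sublinear q" unfolding sublinear_def by blast
  then obtain l where l: "linear l" "\<And>x. l x \<le> q x" by (rule sublinear_dominates_linear) blast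
  show ?thesis
  proof (rule that[OF l(1)])
    \<comment> \<open>The competitor (0, 0) in the infimum gives the bound by \<open>N\<close>; the
      competitor (x, a) itself gives the bound by a.\<close>
    show "l x \<le> N x" if "x \<in> X" for x
      using l(2)[of x] le[OF D0, of x] pr(3)[OF that] by simp
    show "l x \<le> a" if "(x, a) \<in> D" for x a
      using l(2)[of x] le[OF that, of x] pr(3)[OF DX[OF that]] seminorm_onD(5)[OF N] by simp
  qed
qed

text \<open>The usual nested-ball argument, carried out for seminorms; \<open>G\<close> is the graph of a closed
  operator and \<open>snd ` G\<close> its closed range.\<close>

theorem seminorm_open_mapping:
  fixes G :: "('u::real_vector \<times> 'p::real_vector) set"
  assumes G: "subspace G" and N1: "seminorm_on (fst ` G) N1" and N2: "seminorm_on (snd ` G) N2"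
    and complete: "\<And>p. (\<And>n::nat. p n \<in> snd ` G) \<Longrightarrow> summable (\<lambda>n. N2 (p n)) \<Longrightarrow>
          \<exists>q\<in>snd ` G. (\<lambda>n. N2 (q - (\<Sum>i<n. p i))) \<longlonglongrightarrow> 0"
    and closed: "\<And>u p q. (\<And>n::nat. (u n, p n) \<in> G) \<Longrightarrow> summable (\<lambda>n. N1 (u n)) \<Longrightarrow> q \<in> snd ` G \<Longrightarrow>
          (\<lambda>n. N2 (q - (\<Sum>i<n. p i))) \<longlonglongrightarrow> 0 \<Longrightarrow> \<exists>v. (v, q) \<in> G \<and> N1 v \<le> (\<Sum>n. N1 (u n))"
  obtains C where "C \<ge> 0" "\<And>q. q \<in> snd ` G \<Longrightarrow> \<exists>u. (u, q) \<in> G \<and> N1 u \<le> C * N2 q"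
proof -
  define I where "I = snd ` G"
  note sI = seminorm_onD(1)[OF N2, folded I_def]
  note n2 = seminorm_onD[OF N2, folded I_def] and n1 = seminorm_onD[OF N1]
  have GI: "p \<in> I" if "(u, p) \<in> G" for u p using that unfolding I_def by force
  have GU: "u \<in> fst ` G" if "(u, p) \<in> G" for u p using that by force
  have Gdiff: "(u - u', p - p') \<in> G" if "(u, p) \<in> G" "(u', p') \<in> G" for u p u' p'
    using subspace_diff[OF G that] by simp
  have Gscale: "(c *\<^sub>R u, c *\<^sub>R p) \<in> G" if "(u, p) \<in> G" for u p c
    using subspace_scale[OF G that, of c] by simp
  define K where "K n = {p. \<exists>u. (u, p) \<in> G \<and> N1 u \<le> real n}" for n
  have KI: "p \<in> I" if "p \<in> K n" for n p using that GI unfolding K_def by auto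

  \<comment> \<open>Baire's theorem for the cover of \<open>I\<close> by the sets
    \<open>K n\<close>: one of them is dense in some ball of \<open>I\<close>.\<close>
  have "\<exists>n. \<exists>x\<in>I. \<exists>r>0. \<forall>y\<in>I. N2 (y - x) < r \<longrightarrow> (\<forall>e>0. \<exists>z\<in>K n. N2 (y - z) < e)"
  proof (rule ccontr)
    assume neg': "\<not> ?thesis"
    have neg: "\<exists>y\<in>I. N2 (y - x) < r \<and> (\<exists>e>0. \<forall>z\<in>K n. N2 (y - z) \<ge> e)"
      if "x \<in> I" "r > 0" for n x r
    proof -
      have "\<not> (\<forall>y\<in>I. N2 (y - x) < r \<longrightarrow> (\<forall>e>0. \<exists>z\<in>K n. N2 (y - z) < e))"
        using neg' that by blast
      then show ?thesis by (simp add: not_less)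
    qed
    \<comment> \<open>The new centre keeps distance 4 r from \<open>K n\<close>, where r is the new
      radius. As radii at least halve, the limit of the centres lies within 2 r of each of them and
      so misses every \<open>K n\<close>.\<close>
    define Q where "Q n s s' \<longleftrightarrow> N2 (fst s' - fst s) < snd s \<and> snd s' \<le> snd s / 2 \<and>
        (\<forall>z\<in>K n. N2 (fst s' - z) \<ge> 4 * snd s')" for n and s s' :: "'p \<times> real"
    have step: "\<exists>s'. (fst s' \<in> I \<and> snd s' > 0) \<and> Q n s s'" if s: "fst s \<in> I \<and> snd s > 0" for s n
    proof -
      obtain y e where y: "y \<in> I" "N2 (y - fst s) < snd s" "e > 0" "\<And>z. z \<in> K n \<Longrightarrow> N2 (y - z) \<ge> e"
        using neg[of "fst s" "snd s" n] s by blast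
      define r where "r = min (snd s / 2) (e / 4)"
      have r: "r > 0" "r \<le> snd s / 2" "4 * r \<le> e" using s y(3) by (auto simp: r_def)
      have "4 * r \<le> N2 (y - z)" if "z \<in> K n" for z using y(4)[OF that] r(3) by linarith
      then have "Q n s (y, r)" using y(2) r(2) by (simp add: Q_def)
      then show ?thesis using y(1) r(1) by (intro exI[of _ "(y, r)"]) simp
    qed
    have init: "\<exists>s::'p \<times> real. fst s \<in> I \<and> snd s > 0"
      using subspace_0[OF sI] by (intro exI[of _ "(0, 1)"]) simp
    obtain s where s': "\<And>n. fst (s n) \<in> I \<and> snd (s n) > 0" "\<And>n. Q n (s n) (s (Suc n))"
      using dependent_nat_choice[where P="\<lambda>n s. fst s \<in> I \<and> snd s > (0::real)" and Q=Q, OF init step] by blast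
    have s: "fst (s n) \<in> I" "snd (s n) > 0"
        "N2 (fst (s (Suc n)) - fst (s n)) < snd (s n)" "snd (s (Suc n)) \<le> snd (s n) / 2"
        "z \<in> K n \<Longrightarrow> N2 (fst (s (Suc n)) - z) \<ge> 4 * snd (s (Suc n))" for n z
      using s'[of n] unfolding Q_def by blast+
    define x where "x n = fst (s n)" for n
    define r where "r n = snd (s n)" for n
    have xI: "x n \<in> I" for n using s(1) by (simp add: x_def)
    have rpos: "r n > 0" for n using s(2) by (simp add: r_def)
    have rdec: "r (n + j) \<le> r n * (1/2) ^ j" for n j
    proof (induction j)
      case (Suc j)
      have "r (n + Suc j) \<le> r (n + j) / 2" using s(4)[of "n + j"] by (simp add: r_def)
      then show ?case using Suc by simp
    qed simp
    define p where "p n = x (Suc n) - x n" for n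
    have pI: "p n \<in> I" for n unfolding p_def by (intro subspace_diff[OF sI] xI)
    have pN: "N2 (p n) \<le> r n" for n using s(3)[of n] by (simp add: p_def x_def r_def)
    have "summable (\<lambda>n. N2 (p n))"
    proof (rule summable_comparison_test')
      show "summable (\<lambda>n. r 0 * (1/2) ^ n)" by (intro summable_mult) simp
      show "norm (N2 (p n)) \<le> r 0 * (1/2) ^ n" if "n \<ge> 0" for n
        using pN[of n] rdec[of 0 n] n2(2)[OF pI, of n] by simp
    qed
    then obtain q where q: "q \<in> I" "(\<lambda>n. N2 (q - (\<Sum>i<n. p i))) \<longlonglongrightarrow> 0"
      using complete[of p] pI unfolding I_def by blast
    have tele: "(\<Sum>i<n. p i) = x n - x 0" for n
      unfolding p_def by (rule sum_lessThan_telescope)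
    define y where "y = q + x 0"
    have yI: "y \<in> I" unfolding y_def by (intro subspace_add[OF sI] q xI)
    have lim: "(\<lambda>n. N2 (y - x n)) \<longlonglongrightarrow> 0"
      using q(2) by (simp add: tele y_def algebra_simps)
    \<comment> \<open>The factor 2 - 2 (1/2)^j is the sum of the first j powers of 1/2, starting
      with 1.\<close>
    have xx: "N2 (x (n + j) - x n) \<le> r n * (2 - 2 * (1/2) ^ j)" for n j
    proof (induction j)
      case 0
      then show ?case using n2(5) by simp
    next
      case (Suc j)
      have "N2 (x (n + Suc j) - x n) = N2 (p (n + j) + (x (n + j) - x n))" by (simp add: p_def)
      also have "\<dots> \<le> N2 (p (n + j)) + N2 (x (n + j) - x n)"
        by (intro n2(3) pI subspace_diff[OF sI] xI)
      also have "\<dots> \<le> r n * (1/2) ^ j + r n * (2 - 2 * (1/2) ^ j)"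
        using pN[of "n + j"] rdec[of n j] Suc by linarith
      finally show ?case by (simp add: algebra_simps)
    qed
    have yx: "N2 (y - x n) \<le> 2 * r n" for n
    proof (rule LIMSEQ_le_const)
      show "(\<lambda>j. N2 (y - x (j + n)) + 2 * r n) \<longlonglongrightarrow> 2 * r n"
        using tendsto_add[OF LIMSEQ_ignore_initial_segment[OF lim, of n] tendsto_const[of "2 * r n"]] by simp
      have "N2 (y - x n) \<le> N2 (y - x (j + n)) + 2 * r n" for j
      proof -
        have "N2 (y - x n) = N2 ((y - x (j + n)) + (x (n + j) - x n))" by (simp add: add.commute)
        also have "\<dots> \<le> N2 (y - x (j + n)) + N2 (x (n + j) - x n)"
          by (intro n2(3) subspace_diff[OF sI] yI xI)
        also have "N2 (x (n + j) - x n) \<le> r n * 2"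
        proof -
          have "r n * (2 - 2 * (1/2) ^ j) \<le> r n * 2" using rpos[of n] by (intro mult_left_mono) auto
          then show ?thesis using xx[of n j] by linarith
        qed
        finally show ?thesis by simp
      qed
      then show "\<exists>N. \<forall>j\<ge>N. N2 (y - x n) \<le> N2 (y - x (j + n)) + 2 * r n" by blast
    qed
    \<comment> \<open>The limit has a preimage of finite seminorm and therefore lies in some
      \<open>K n\<close> after all, against the distance kept by \<open>Q\<close>.\<close>
    obtain u where u: "(u, y) \<in> G" using yI unfolding I_def by auto
    obtain n where "N1 u \<le> real n" using real_arch_simple by blast
    then have "y \<in> K n" using u unfolding K_def by blast
    then have "4 * r (Suc n) \<le> N2 (x (Suc n) - y)" using s(5) by (simp add: x_def r_def)
    also have "\<dots> = N2 (y - x (Suc n))" by (intro n2(8) yI xI)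
    finally show False using yx[of "Suc n"] rpos[of "Suc n"] by simp
  qed
  then obtain m x0 r where x0: "x0 \<in> I" "r > 0"
    "\<And>y e. y \<in> I \<Longrightarrow> N2 (y - x0) < r \<Longrightarrow> e > 0 \<Longrightarrow> \<exists>z\<in>K m. N2 (y - z) < e" by blast

  \<comment> \<open>The ball about \<open>x0\<close> is moved to the origin by approximating x0 + y
    and x0 separately and subtracting, which doubles the bound m.\<close>
  have small: "\<exists>u z. (u, z) \<in> G \<and> N1 u \<le> 2 * real m \<and> N2 (y - z) < e" if y: "y \<in> I" "N2 y < r" "e > 0" for y e
  proof -
    obtain z1 where z1: "z1 \<in> K m" "N2 ((x0 + y) - z1) < e / 2"
      using x0(3)[of "x0 + y" "e / 2"] y subspace_add[OF sI x0(1) y(1)] by auto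
    obtain z2 where z2: "z2 \<in> K m" "N2 (x0 - z2) < e / 2"
      using x0(3)[of "x0" "e / 2"] y x0(1,2) n2(5) by auto
    obtain u1 u2 where u: "(u1, z1) \<in> G" "N1 u1 \<le> m" "(u2, z2) \<in> G" "N1 u2 \<le> m"
      using z1 z2 unfolding K_def by auto
    have "N1 (u1 - u2) \<le> 2 * real m" using n1(7)[OF GU[OF u(1)] GU[OF u(3)]] u by simp
    moreover have "N2 (y - (z1 - z2)) < e"
    proof -
      have "N2 (y - (z1 - z2)) = N2 (((x0 + y) - z1) - (x0 - z2))" by (simp add: algebra_simps)
      also have "\<dots> \<le> N2 ((x0 + y) - z1) + N2 (x0 - z2)"
        using KI z1 z2 x0(1) y by (intro n2(7) subspace_diff[OF sI] subspace_add[OF sI]) auto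
      finally show ?thesis using z1 z2 by simp
    qed
    ultimately show ?thesis using Gdiff[OF u(1,3)] by blast
  qed
  \<comment> \<open>A vector of seminorm at most s is scaled by t = r / (2 s) into the ball of
    radius r, with room for the strict inequality; scaling the preimage back costs 2 m / t = c
    s.\<close>
  define c where "c = 2 * real m / (r / 2)"
  have c0: "c \<ge> 0" using x0(2) by (simp add: c_def)
  have scaled: "\<exists>u z. (u, z) \<in> G \<and> N1 u \<le> c * s \<and> N2 (y - z) < e"
    if y: "y \<in> I" "N2 y \<le> s" "s > 0" "e > 0" for y s e
  proof -
    define t where "t = r / (2 * s)"
    have t: "t > 0" using y x0(2) by (simp add: t_def)
    have "N2 (t *\<^sub>R y) = t * N2 y" using n2(4)[OF y(1), of t] t by simp
    also have "\<dots> \<le> t * s" using y t by simp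
    also have "\<dots> < r" using y x0(2) by (simp add: t_def)
    finally obtain u z where u: "(u, z) \<in> G" "N1 u \<le> 2 * real m" "N2 (t *\<^sub>R y - z) < t * e"
      using small[OF subspace_scale[OF sI y(1)] _ mult_pos_pos[OF t y(4)]] by blast
    have "N1 (inverse t *\<^sub>R u) = inverse t * N1 u" using n1(4)[OF GU[OF u(1)], of "inverse t"] t by simp
    also have "\<dots> \<le> inverse t * (2 * real m)" using t u by (intro mult_left_mono) auto
    also have "\<dots> = c * s" using y x0(2) by (simp add: t_def c_def field_simps)
    finally have 1: "N1 (inverse t *\<^sub>R u) \<le> c * s" .
    have "N2 (y - inverse t *\<^sub>R z) = N2 (inverse t *\<^sub>R (t *\<^sub>R y - z))" using t by (simp add: scaleR_diff_right)
    also have "\<dots> = inverse t * N2 (t *\<^sub>R y - z)"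
      using n2(4)[of "t *\<^sub>R y - z" "inverse t"] t GI[OF u(1)] y subspace_diff[OF sI] subspace_scale[OF sI] by simp
    also have "\<dots> < inverse t * (t * e)" using t u by (intro mult_strict_left_mono) auto
    also have "\<dots> = e" using t by simp
    finally have "N2 (y - inverse t *\<^sub>R z) < e" .
    with 1 Gscale[OF u(1), of "inverse t"] show ?thesis by blast
  qed

  show ?thesis
  proof (rule that[of "2 * c"])
    fix q assume "q \<in> snd ` G"
    then have qI: "q \<in> I" unfolding I_def .
    show "\<exists>u. (u, q) \<in> G \<and> N1 u \<le> 2 * c * N2 q"
    proof (cases "N2 q = 0")
      case True
      \<comment> \<open>Here q need not be 0 and the geometric scheme has no scale to start from.
        The constant zero sequences approximate q with error 0, so \<open>closed\<close> provides a
        preimage of seminorm 0.\<close>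
      have "\<exists>v. (v, q) \<in> G \<and> N1 v \<le> (\<Sum>n::nat. N1 0)"
        using \<open>q \<in> snd ` G\<close> True n1(5) subspace_0[OF G] by (intro closed[of "\<lambda>_. 0" "\<lambda>_. 0"]) (auto simp: zero_prod_def)
      then show ?thesis using True n1(5) by simp
    next
      case False
      define a where "a = N2 q"
      have a: "a > 0" using False n2(2)[OF qI] by (simp add: a_def)
      have step: "\<exists>uz. (fst uz, snd uz) \<in> G \<and> N1 (fst uz) \<le> c * (a * (1/2)^n) \<and> N2 (y - snd uz) \<le> a * (1/2)^Suc n"
        if "y \<in> I" "N2 y \<le> a * (1/2)^n" for y and n :: nat
      proof -
        have "a * (1/2)^n > 0" "a * (1/2)^Suc n > 0" using a by auto
        from scaled[OF that this] obtain u z where "(u, z) \<in> G" "N1 u \<le> c * (a * (1/2)^n)"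
          "N2 (y - z) < a * (1/2)^Suc n" by blast
        then show ?thesis by (intro exI[of _ "(u, z)"]) (simp only: fst_conv snd_conv less_imp_le simp_thms)
      qed
      define g where "g n y = (SOME uz. (fst uz, snd uz) \<in> G \<and> N1 (fst uz) \<le> c * (a * (1/2)^n) \<and>
          N2 (y - snd uz) \<le> a * (1/2)^Suc n)" for n :: nat and y
      have g: "(fst (g n y), snd (g n y)) \<in> G \<and> N1 (fst (g n y)) \<le> c * (a * (1/2)^n) \<and>
          N2 (y - snd (g n y)) \<le> a * (1/2)^Suc n" if "y \<in> I" "N2 y \<le> a * (1/2)^n" for n y
        unfolding g_def by (rule someI_ex[OF step[OF that]])
      \<comment> \<open>\<open>y n\<close> is the residual left after n corrections. Each correction
        costs at most c times the current scale and halves that scale, so the total cost is at most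
        2 c a.\<close>
      define y where "y = rec_nat q (\<lambda>n y. y - snd (g n y))"
      have y_0: "y 0 = q" and y_Suc: "y (Suc n) = y n - snd (g n (y n))" for n by (simp_all add: y_def)
      have yI: "y n \<in> I \<and> N2 (y n) \<le> a * (1/2)^n" for n
      proof (induction n)
        case 0
        then show ?case using qI by (simp add: y_0 a_def)
      next
        case (Suc n)
        then have g': "(fst (g n (y n)), snd (g n (y n))) \<in> G" "N2 (y n - snd (g n (y n))) \<le> a * (1/2)^Suc n"
          using g[of "y n" n] by blast+
        show ?case unfolding y_Suc using g'(2) Suc subspace_diff[OF sI _ GI[OF g'(1)]] by blast
      qed
      define u where "u n = fst (g n (y n))" for n
      define p where "p n = snd (g n (y n))" for n
      have G': "(u n, p n) \<in> G" and uN: "N1 (u n) \<le> c * a * (1/2)^n" for n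
        using g yI unfolding u_def p_def by (auto simp: mult.assoc)
      have geo: "(\<lambda>n. c * a * (1/2)^n) sums (c * a * 2)"
        using sums_mult[OF geometric_sums[of "1/2::real"], of "c * a"] by simp
      have sm: "summable (\<lambda>n. N1 (u n))"
      proof (rule summable_comparison_test'[OF sums_summable[OF geo]])
        show "norm (N1 (u n)) \<le> c * a * (1/2)^n" if "n \<ge> 0" for n
          using uN[of n] n1(2)[OF GU[OF G'], of n] by simp
      qed
      have ps: "q - (\<Sum>i<n. p i) = y n" for n
        by (induction n) (auto simp: y_0 y_Suc p_def algebra_simps)
      have "(\<lambda>n. N2 (q - (\<Sum>i<n. p i))) \<longlonglongrightarrow> 0"
        unfolding ps
      proof (rule tendsto_sandwich[where f="\<lambda>_. 0" and h="\<lambda>n. a * (1/2)^n"])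
        show "(\<lambda>n. a * (1/2)^n) \<longlonglongrightarrow> 0" by (intro tendsto_mult_right_zero LIMSEQ_realpow_zero) auto
        show "\<forall>\<^sub>F n in sequentially. 0 \<le> N2 (y n)" using n2(2) yI by simp
        show "\<forall>\<^sub>F n in sequentially. N2 (y n) \<le> a * (1/2)^n" using yI by simp
      qed (rule tendsto_const)
      then obtain v where v: "(v, q) \<in> G" "N1 v \<le> (\<Sum>n. N1 (u n))"
        using closed[of u p q] G' sm qI unfolding I_def by blast
      have "(\<Sum>n. N1 (u n)) \<le> c * a * 2"
        using suminf_le[OF uN sm sums_summable[OF geo]] sums_unique[OF geo] by simp
      then show ?thesis using v by (auto simp: a_def)
    qed
  qed (use c0 in simp)
qed

section \<open>The space of integrable vector fields and its dual\<close>

text \<open>With the pointwise linear structure L^1 is a subspace of the function type, to which the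
  abstract lemmas on seminorms apply.\<close>

instantiation "fun" :: (type, real_vector) real_vector
begin

definition scaleR_fun :: "real \<Rightarrow> ('a \<Rightarrow> 'b) \<Rightarrow> 'a \<Rightarrow> 'b" where
  "scaleR_fun r f = (\<lambda>x. r *\<^sub>R f x)"

instance
  by standard (auto simp: scaleR_fun_def fun_eq_iff scaleR_add_left scaleR_add_right)

end

lemma scaleR_fun_apply [simp]: "(r *\<^sub>R f) x = r *\<^sub>R f x"
  by (simp add: scaleR_fun_def)

lemma sum_fun_apply [simp]: "(\<Sum>i\<in>I. f i) x = (\<Sum>i\<in>I. f i x)"
  for f :: "'i \<Rightarrow> 'a \<Rightarrow> 'b::comm_monoid_add"
  by (induction I rule: infinite_finite_induct) auto

section \<open>Dominated convergence and the dual of scalar L^1\<close>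

lemma integral_norm_diff_tendsto_0:
  fixes s :: "nat \<Rightarrow> 'a \<Rightarrow> 'b::{banach, second_countable_topology}"
  assumes h: "integrable M h" and s: "\<And>n. s n \<in> borel_measurable M"
    and f: "integrable M f" and lim: "AE x in M. (\<lambda>n. s n x) \<longlonglongrightarrow> f x"
    and bound: "\<And>n. AE x in M. norm (s n x) \<le> h x"
  shows "(\<lambda>n. \<integral>x. norm (s n x - f x) \<partial>M) \<longlonglongrightarrow> 0"
proof -
  note [measurable] = s borel_measurable_integrable[OF f]
  have "(\<lambda>n. \<integral>x. norm (s n x - f x) \<partial>M) \<longlonglongrightarrow> (\<integral>x. 0 \<partial>M)"
  proof (rule integral_dominated_convergence)
    show "integrable M (\<lambda>x. h x + norm (f x))" using h f by auto
    show "AE x in M. (\<lambda>n. norm (s n x - f x)) \<longlonglongrightarrow> 0"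
      using lim by eventually_elim (simp add: LIM_zero tendsto_norm_zero)
    show "AE x in M. norm (norm (s n x - f x)) \<le> h x + norm (f x)" for n
      using bound[of n] by eventually_elim (auto intro: order_trans[OF norm_triangle_ineq4])
  qed measurable
  then show ?thesis by simp
qed

text \<open>A positive integrable weight \<eta> gives every set finite mass, and adding c times the
  integral makes the functional positive, so the Radon-Nikodym theorem for measures applies. The
  measure \<nu> lies between 0 and 2 c times the weighted measure, hence its density g between 0 and
  2 c \<eta>; undoing weight and shift, w = g / \<eta> - c lies between - c and c.\<close>

theorem (in sigma_finite_measure) L1_dual_scalar:
  fixes L :: "('a \<Rightarrow> real) \<Rightarrow> real"
  assumes add: "\<And>f g. integrable M f \<Longrightarrow> integrable M g \<Longrightarrow> L (\<lambda>x. f x + g x) = L f + L g"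
    and scale: "\<And>a f. integrable M f \<Longrightarrow> L (\<lambda>x. a * f x) = a * L f"
    and bound: "\<And>f. integrable M f \<Longrightarrow> \<bar>L f\<bar> \<le> c * (\<integral>x. \<bar>f x\<bar> \<partial>M)"
  obtains w where "w \<in> borel_measurable M" "AE x in M. \<bar>w x\<bar> \<le> c"
    "\<And>f. integrable M f \<Longrightarrow> L f = (\<integral>x. w x * f x \<partial>M)"
proof -
  obtain \<eta> :: "'a \<Rightarrow> real" where \<eta>: "\<eta> \<in> borel_measurable M" "\<And>x. \<eta> x > 0" "\<And>x. \<eta> x \<le> 1" "integrable M \<eta>"
    using obtain_positive_integrable_function by blast
  note [measurable] = \<eta>(1)
  have diff: "L f - L g = L (\<lambda>x. f x - g x)" if "integrable M f" "integrable M g" for f g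
    using add[of f "\<lambda>x. (-1) * g x"] scale[of g "-1"] that by simp
  \<comment> \<open>Continuity of \<open>L\<close> along dominated limits, for the countable
    additivity of \<nu> and for the limit step of the final induction.\<close>
  have L_lim: "(\<lambda>n. L (s n)) \<longlonglongrightarrow> L f"
    if h: "integrable M h" and s: "\<And>n. s n \<in> borel_measurable M" and f: "integrable M f"
      and lim: "\<And>x. x \<in> space M \<Longrightarrow> (\<lambda>n. s n x) \<longlonglongrightarrow> f x" and b: "\<And>n x. x \<in> space M \<Longrightarrow> norm (s n x) \<le> h x"
    for s f h
  proof -
    have si: "integrable M (s n)" for n
      by (rule Bochner_Integration.integrable_bound[OF h s]) (use b[of _ n] in \<open>auto intro!: AE_I2 intro: order_trans[OF _ abs_ge_self]\<close>)
    have "(\<lambda>n. \<integral>x. norm (s n x - f x) \<partial>M) \<longlonglongrightarrow> 0"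
      using integral_norm_diff_tendsto_0[OF h s f] lim b by auto
    then have "(\<lambda>n. c * (\<integral>x. norm (s n x - f x) \<partial>M)) \<longlonglongrightarrow> 0" by (rule tendsto_mult_right_zero)
    then have "(\<lambda>n. L (s n) - L f) \<longlonglongrightarrow> 0"
      by (rule Lim_null_comparison[rotated]) (use bound si f diff in \<open>auto intro!: always_eventually\<close>)
    then show ?thesis by (simp add: LIM_zero_iff)
  qed
  define J where "J f = L (\<lambda>x. f x * \<eta> x) + c * (\<integral>x. f x * \<eta> x \<partial>M)" for f
  have ind: "integrable M (\<lambda>x. indicator B x * \<eta> x)" if "B \<in> sets M" for B
    using integrable_real_mult_indicator[OF that \<eta>(4)] by (simp add: mult.commute)
  define \<nu> where "\<nu> B = J (indicator B)" for B
  have \<nu>_nn: "0 \<le> \<nu> B" and \<nu>_le: "\<nu> B \<le> 2 * c * (\<integral>x. indicator B x * \<eta> x \<partial>M)" if "B \<in> sets M" for B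
    using bound[OF ind[OF that]] \<eta>(2) by (auto simp: \<nu>_def J_def abs_mult less_imp_le abs_le_iff)
  have J_add: "J (\<lambda>x. f x + g x) = J f + J g"
    if "integrable M (\<lambda>x. f x * \<eta> x)" "integrable M (\<lambda>x. g x * \<eta> x)" for f g
    using add[OF that] that by (simp add: J_def distrib_right ring_distribs)
  have L0: "L (\<lambda>x. 0) = 0" using scale[of "\<lambda>_. 0" 0] by simp
  have J_sum: "J (\<lambda>x. \<Sum>i<n. indicator (A i) x) = (\<Sum>i<n. \<nu> (A i)) \<and>
        integrable M (\<lambda>x. (\<Sum>i<n. indicator (A i) x) * \<eta> x)" if "\<And>i. A i \<in> sets M" for A and n :: nat
  proof (induction n)
    case 0
    then show ?case by (simp add: J_def L0)
  next
    case (Suc n)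
    then show ?case using J_add[of "\<lambda>x. \<Sum>i<n. indicator (A i) x" "indicator (A n)"] ind[of "A n"] that
      by (simp add: \<nu>_def distrib_right)
  qed
  have \<nu>_sums: "(\<lambda>i. \<nu> (A i)) sums \<nu> (\<Union>i. A i)" if A: "\<And>i. A i \<in> sets M" and dis: "disjoint_family A" for A :: "nat \<Rightarrow> 'a set"
  proof -
    have [measurable]: "A i \<in> sets M" for i by (rule A)
    have U: "(\<Union>i. A i) \<in> sets M" using A by auto
    have le1: "(\<Sum>i<n. indicator (A i) x) \<le> (1::real)" for n x
    proof -
      have "(\<Sum>i<n. indicator (A i) x) = (indicator (\<Union>i<n. A i) x :: real)"
        using dis by (intro indicator_UN_disjoint[symmetric]) (auto simp: disjoint_family_on_def)
      then show ?thesis by (simp add: indicator_le_1)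
    qed
    have pt: "(\<lambda>n. (\<Sum>i<n. indicator (A i) x) * \<eta> x) \<longlonglongrightarrow> indicator (\<Union>i. A i) x * \<eta> x" for x
      using indicator_sums[of A x] dis unfolding sums_def disjoint_family_on_def
      by (intro tendsto_mult tendsto_const) auto
    have bd: "norm ((\<Sum>i<n. indicator (A i) x) * \<eta> x) \<le> \<eta> x" for n x
      using le1[of x n] \<eta>(2)[of x] by (auto simp: abs_mult sum_nonneg intro!: mult_left_le_one_le)
    have "(\<lambda>n. L (\<lambda>x. (\<Sum>i<n. indicator (A i) x) * \<eta> x)) \<longlonglongrightarrow> L (\<lambda>x. indicator (\<Union>i. A i) x * \<eta> x)"
      using pt bd by (intro L_lim[OF \<eta>(4) _ ind[OF U]]) measurable
    moreover have "(\<lambda>n. \<integral>x. (\<Sum>i<n. indicator (A i) x) * \<eta> x \<partial>M) \<longlonglongrightarrow> (\<integral>x. indicator (\<Union>i. A i) x * \<eta> x \<partial>M)"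
      using pt bd \<eta>(4) by (intro integral_dominated_convergence[where w=\<eta>]) (auto intro!: AE_I2)
    ultimately have "(\<lambda>n. J (\<lambda>x. \<Sum>i<n. indicator (A i) x)) \<longlonglongrightarrow> \<nu> (\<Union>i. A i)"
      unfolding J_def \<nu>_def by (intro tendsto_intros)
    then show ?thesis using J_sum[OF A] unfolding sums_def by simp
  qed
  define N where "N = measure_of (space M) (sets M) (\<lambda>B. ennreal (\<nu> B))"
  have sN: "sets N = sets M" by (simp add: N_def sets.sigma_sets_eq)
  have eN: "emeasure N B = ennreal (\<nu> B)" if "B \<in> sets M" for B
    unfolding N_def
  proof (rule emeasure_measure_of_sigma)
    show "sigma_algebra (space M) (sets M)" by (rule sets.sigma_algebra_axioms)
    have "\<nu> {} = 0" using \<nu>_nn[of "{}"] \<nu>_le[of "{}"] by simp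
    then show "positive (sets M) (\<lambda>B. ennreal (\<nu> B))" by (simp add: positive_def)
    show "countably_additive (sets M) (\<lambda>B. ennreal (\<nu> B))"
    proof (rule countably_additiveI)
      fix A :: "nat \<Rightarrow> 'a set" assume A: "range A \<subseteq> sets M" "disjoint_family A"
      then have "(\<lambda>i. ennreal (\<nu> (A i))) sums ennreal (\<nu> (\<Union>i. A i))"
        using \<nu>_sums[of A] \<nu>_nn by (subst sums_ennreal) auto
      then show "(\<Sum>i. ennreal (\<nu> (A i))) = ennreal (\<nu> (\<Union> (range A)))" by (simp add: sums_iff)
    qed
  qed (rule that)
  have "absolutely_continuous M N"
    unfolding absolutely_continuous_def
  proof
    fix B assume B: "B \<in> null_sets M"
    then have Bs: "B \<in> sets M" by auto
    have "(\<integral>x. indicator B x * \<eta> x \<partial>M) = 0"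
      using AE_not_in[OF B] by (intro integral_eq_zero_AE) (auto elim: eventually_mono)
    then have "\<nu> B = 0" using \<nu>_nn[OF Bs] \<nu>_le[OF Bs] by simp
    then show "B \<in> null_sets N" using eN[OF Bs] Bs sN by (auto intro: null_setsI)
  qed
  then obtain g where g[measurable]: "g \<in> borel_measurable M" and dg: "density M g = N"
    using Radon_Nikodym[OF _ sN] by blast
  have nng: "(\<integral>\<^sup>+x. g x * indicator B x \<partial>M) = ennreal (\<nu> B)" if "B \<in> sets M" for B
    using eN[OF that] that g by (simp add: dg[symmetric] emeasure_density)
  have nn\<eta>: "(\<integral>\<^sup>+x. ennreal (a * \<eta> x) * indicator B x \<partial>M) = ennreal (a * (\<integral>x. indicator B x * \<eta> x \<partial>M))"
    if B: "B \<in> sets M" and a: "a \<ge> 0" for a B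
  proof -
    have "(\<integral>\<^sup>+x. ennreal (a * \<eta> x) * indicator B x \<partial>M) = (\<integral>\<^sup>+x. ennreal (a * (indicator B x * \<eta> x)) \<partial>M)"
      by (intro nn_integral_cong) (simp split: split_indicator)
    also have "\<dots> = ennreal (\<integral>x. a * (indicator B x * \<eta> x) \<partial>M)"
      using ind[OF B] a \<eta>(2) by (intro nn_integral_eq_integral) (auto intro!: AE_I2 mult_nonneg_nonneg simp: less_imp_le)
    finally show ?thesis by simp
  qed
  \<comment> \<open>The sign of \<open>c\<close> is not given, and a nonnegative constant is needed
    for comparison in \<open>ennreal\<close>.\<close>
  define c' where "c' = max c 0"
  have \<nu>_le': "\<nu> B \<le> 2 * c' * (\<integral>x. indicator B x * \<eta> x \<partial>M)" if "B \<in> sets M" for B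
  proof -
    have "0 \<le> (\<integral>x. indicator B x * \<eta> x \<partial>M)" using \<eta>(2) by (intro integral_nonneg_AE) (auto intro!: AE_I2 simp: less_imp_le)
    then have "2 * c * (\<integral>x. indicator B x * \<eta> x \<partial>M) \<le> 2 * c' * (\<integral>x. indicator B x * \<eta> x \<partial>M)"
      by (intro mult_right_mono) (auto simp: c'_def)
    then show ?thesis using \<nu>_le[OF that] by linarith
  qed
  have g_le: "AE x in M. g x \<le> ennreal (2 * c' * \<eta> x)"
  proof -
    \<comment> \<open>On B the density is larger than the bound, yet its integral over B is not, so
      the excess vanishes almost everywhere.\<close>
    define B where "B = {x \<in> space M. g x > ennreal (2 * c' * \<eta> x)}"
    have B[measurable]: "B \<in> sets M" unfolding B_def by measurable
    have c2: "2 * c' \<ge> 0" by (simp add: c'_def)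
    have "(\<integral>\<^sup>+x. g x * indicator B x - ennreal (2 * c' * \<eta> x) * indicator B x \<partial>M) =
      (\<integral>\<^sup>+x. g x * indicator B x \<partial>M) - (\<integral>\<^sup>+x. ennreal (2 * c' * \<eta> x) * indicator B x \<partial>M)"
    proof (rule nn_integral_diff)
      show "(\<integral>\<^sup>+x. ennreal (2 * c' * \<eta> x) * indicator B x \<partial>M) \<noteq> \<infinity>"
        using nn\<eta>[OF B c2] by simp
      show "AE x in M. ennreal (2 * c' * \<eta> x) * indicator B x \<le> g x * indicator B x"
        by (auto simp: B_def split: split_indicator)
    qed measurable
    also have "\<dots> = 0"
      unfolding nng[OF B] nn\<eta>[OF B c2] using \<nu>_le'[OF B] by (simp add: diff_eq_0_iff_ennreal ennreal_leI)
    finally have "AE x in M. g x * indicator B x - ennreal (2 * c' * \<eta> x) * indicator B x = 0"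
      by (subst (asm) nn_integral_0_iff_AE) auto
    then show ?thesis
      by (auto simp: B_def diff_eq_0_iff_ennreal not_less split: split_indicator_asm elim!: eventually_mono)
  qed
  define g' where "g' x = enn2real (g x)" for x
  have [measurable]: "g' \<in> borel_measurable M" unfolding g'_def by measurable
  have g'_nn: "g' x \<ge> 0" for x by (simp add: g'_def)
  have g'_eq: "AE x in M. g x = ennreal (g' x)" and g'_le: "AE x in M. g' x \<le> 2 * c' * \<eta> x"
  proof -
    show "AE x in M. g x = ennreal (g' x)"
      using g_le by eventually_elim (auto simp: g'_def ennreal_enn2real_if top_unique)
    then show "AE x in M. g' x \<le> 2 * c' * \<eta> x"
      using g_le
    proof eventually_elim
      fix x assume "g x = ennreal (g' x)" "g x \<le> ennreal (2 * c' * \<eta> x)"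
      then show "g' x \<le> 2 * c' * \<eta> x"
        using \<eta>(2)[of x] by (simp add: c'_def ennreal_le_iff less_imp_le)
    qed
  qed
  define w where "w x = g' x / \<eta> x - c" for x
  have [measurable]: "w \<in> borel_measurable M" unfolding w_def by measurable
  \<comment> \<open>A crude bound, valid for either sign of \<open>c\<close>, is enough for
    integrability; the sharp one is proved at the end.\<close>
  have w_le': "AE x in M. \<bar>w x\<bar> \<le> 2 * c' + \<bar>c\<bar>"
    using g'_le
  proof eventually_elim
    fix x assume "g' x \<le> 2 * c' * \<eta> x"
    then have "g' x / \<eta> x \<le> 2 * c'" "0 \<le> g' x / \<eta> x" using \<eta>(2)[of x] g'_nn[of x] by (auto simp: divide_simps)
    then show "\<bar>w x\<bar> \<le> 2 * c' + \<bar>c\<bar>" unfolding w_def by linarith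
  qed
  have w_int: "integrable M (\<lambda>x. w x * f x)" if f: "integrable M f" for f
  proof (rule Bochner_Integration.integrable_bound[OF integrable_mult_right[OF f, of "2 * c' + \<bar>c\<bar>"]])
    show "AE x in M. norm (w x * f x) \<le> norm ((2 * c' + \<bar>c\<bar>) * f x)"
      using w_le' by eventually_elim (auto simp: abs_mult c'_def intro!: mult_right_mono)
  qed (use f in measurable)
  have L_ind: "L (\<lambda>x. indicator B x * \<eta> x) = (\<integral>x. w x * (indicator B x * \<eta> x) \<partial>M)" if B: "B \<in> sets M" for B
  proof -
    have [measurable]: "B \<in> sets M" by (rule B)
    have i\<eta>: "integrable M (\<lambda>x. indicator B x * \<eta> x)" by (rule ind[OF B])
    have "(\<integral>\<^sup>+x. ennreal (g' x * indicator B x) \<partial>M) = (\<integral>\<^sup>+x. g x * indicator B x \<partial>M)"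
      using g'_eq by (intro nn_integral_cong_AE) (auto simp: ennreal_mult'' elim!: eventually_mono split: split_indicator)
    also have "\<dots> = ennreal (\<nu> B)" by (rule nng[OF B])
    finally have "integrable M (\<lambda>x. g' x * indicator B x) \<and> (\<integral>x. g' x * indicator B x \<partial>M) = \<nu> B"
      by (subst (asm) nn_integral_eq_integrable) (auto simp: g'_nn \<nu>_nn[OF B])
    then have "L (\<lambda>x. indicator B x * \<eta> x) + c * (\<integral>x. indicator B x * \<eta> x \<partial>M) = (\<integral>x. g' x * indicator B x \<partial>M)"
      by (simp add: \<nu>_def J_def)
    also have "(\<integral>x. g' x * indicator B x \<partial>M) = (\<integral>x. w x * (indicator B x * \<eta> x) + c * (indicator B x * \<eta> x) \<partial>M)"
      using \<eta>(2) by (intro Bochner_Integration.integral_cong) (auto simp: w_def field_simps less_imp_neq[symmetric])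
    also have "\<dots> = (\<integral>x. w x * (indicator B x * \<eta> x) \<partial>M) + c * (\<integral>x. indicator B x * \<eta> x \<partial>M)"
      using w_int[OF i\<eta>] i\<eta> by simp
    finally show ?thesis by simp
  qed
  have dens: "integrable (density M \<eta>) h \<longleftrightarrow> integrable M (\<lambda>x. h x * \<eta> x)" if [measurable]: "h \<in> borel_measurable M" for h :: "'a \<Rightarrow> real"
    using \<eta>(2) by (subst integrable_density) (auto simp: mult.commute less_imp_le)
  \<comment> \<open>The induction runs over functions integrable for the finite measure with density
    \<eta>. Every f integrable for \<open>M\<close> has the form h \<eta> with h = f /
    \<eta>.\<close>
  have main: "L (\<lambda>x. h x * \<eta> x) = (\<integral>x. w x * (h x * \<eta> x) \<partial>M)" if "integrable (density M \<eta>) h" for h :: "'a \<Rightarrow> real"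
    using that
  proof (induction rule: integrable_induct)
    case (base A a)
    then have A: "A \<in> sets M" by simp
    show ?case using scale[OF ind[OF A], of a] L_ind[OF A]
      by (simp add: mult_ac)
  next
    case (add f g)
    then have [measurable]: "f \<in> borel_measurable M" "g \<in> borel_measurable M" by (auto dest: borel_measurable_integrable)
    have i: "integrable M (\<lambda>x. f x * \<eta> x)" "integrable M (\<lambda>x. g x * \<eta> x)" using add dens by auto
    show ?case using assms(1)[OF i] add.IH w_int[OF i(1)] w_int[OF i(2)] by (simp add: algebra_simps)
  next
    case (lim f s)
    then have [measurable]: "f \<in> borel_measurable M" "\<And>i. s i \<in> borel_measurable M"
      by (auto dest: borel_measurable_integrable)
    have i: "integrable M (\<lambda>x. f x * \<eta> x)" "\<And>n. integrable M (\<lambda>x. s n x * \<eta> x)" using lim dens by auto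
    have h: "integrable M (\<lambda>x. 2 * norm (f x * \<eta> x))" using i by simp
    have pt: "(\<lambda>n. s n x * \<eta> x) \<longlonglongrightarrow> f x * \<eta> x" if "x \<in> space M" for x
      using lim.hyps(2) that by (intro tendsto_mult tendsto_const) auto
    have b: "norm (s n x * \<eta> x) \<le> 2 * norm (f x * \<eta> x)" if "x \<in> space M" for x n
      using lim.hyps(3)[of x n] that \<eta>(2)[of x] by (simp add: abs_mult mult_right_mono)
    have "(\<lambda>n. L (\<lambda>x. s n x * \<eta> x)) \<longlonglongrightarrow> L (\<lambda>x. f x * \<eta> x)"
      using pt b by (intro L_lim[OF h _ i(1)]) auto
    moreover have "(\<lambda>n. \<integral>x. w x * (s n x * \<eta> x) \<partial>M) \<longlonglongrightarrow> (\<integral>x. w x * (f x * \<eta> x) \<partial>M)"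
    proof (rule integral_dominated_convergence)
      show "integrable M (\<lambda>x. \<bar>w x * (2 * norm (f x * \<eta> x))\<bar>)" using w_int[OF h] by (rule integrable_abs)
      show "AE x in M. norm (w x * (s n x * \<eta> x)) \<le> \<bar>w x * (2 * norm (f x * \<eta> x))\<bar>" for n
        using b by (intro AE_I2) (auto simp: abs_mult[of "w _"] intro!: mult_left_mono)
      show "AE x in M. (\<lambda>n. w x * (s n x * \<eta> x)) \<longlonglongrightarrow> w x * (f x * \<eta> x)"
        by (rule AE_I2) (rule tendsto_mult[OF tendsto_const pt])
    qed measurable
    ultimately show ?case unfolding lim.IH by (rule LIMSEQ_unique)
  qed
  have rep: "L f = (\<integral>x. w x * f x \<partial>M)" if f: "integrable M f" for f
  proof -
    have [measurable]: "f \<in> borel_measurable M" using f by auto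
    have "(\<lambda>x. f x / \<eta> x * \<eta> x) = f" using \<eta>(2) by (auto simp: fun_eq_iff less_imp_neq[symmetric])
    then show ?thesis using main[of "\<lambda>x. f x / \<eta> x"] dens[of "\<lambda>x. f x / \<eta> x"] f
      by (simp add: fun_eq_iff)
  qed
  have "AE x in M. \<bar>w x\<bar> \<le> c"
  proof (cases "c \<ge> 0")
    case True
    then have "c' = c" by (simp add: c'_def)
    show ?thesis using g'_le
    proof eventually_elim
      fix x assume "g' x \<le> 2 * c' * \<eta> x"
      then have "g' x / \<eta> x \<le> 2 * c'" "0 \<le> g' x / \<eta> x" using \<eta>(2)[of x] g'_nn[of x] by (auto simp: divide_simps)
      then show "\<bar>w x\<bar> \<le> c" unfolding w_def \<open>c' = c\<close> by linarith
    qed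
  next
    case False
    \<comment> \<open>For c < 0 the bound tested with \<eta> forces the integral of the positive
      function \<eta> to vanish, so \<open>M\<close> is the zero measure and every property holds
      almost everywhere.\<close>
    have "0 \<le> c * (\<integral>x. \<bar>\<eta> x\<bar> \<partial>M)" using bound[OF \<eta>(4)] by linarith
    moreover have "(\<integral>x. \<bar>\<eta> x\<bar> \<partial>M) \<ge> 0" by simp
    ultimately have "(\<integral>x. \<bar>\<eta> x\<bar> \<partial>M) = 0" using False by (simp add: zero_le_mult_iff)
    then have "AE x in M. \<bar>\<eta> x\<bar> = 0" using \<eta>(4) by (subst (asm) integral_nonneg_eq_0_iff_AE) auto
    then show ?thesis using \<eta>(2) by (auto elim!: eventually_mono simp: less_imp_neq[symmetric])
  qed
  from that[OF _ this rep] show ?thesis by measurable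
qed

section \<open>Vector fields in L^1 and L^infinity\<close>

lemma sigma_finite_completion:
  assumes "sigma_finite_measure M"
  shows "sigma_finite_measure (completion M)"
proof -
  interpret sigma_finite_measure M by (rule assms)
  obtain A where "countable A" "A \<subseteq> sets M" "\<Union>A = space M" "\<forall>a\<in>A. emeasure M a \<noteq> \<infinity>"
    using sigma_finite_countable by blast
  then show ?thesis
    by (intro sigma_finite_measure.intro exI[of _ A]) (auto simp: emeasure_completion intro: sets_completionI_sets)
qed

lemma sigma_finite_lebesgue_on:
  assumes "\<Omega> \<in> sets lebesgue" shows "sigma_finite_measure (lebesgue_on \<Omega>)"
  using assms by (intro sigma_finite_measure_restrict_space sigma_finite_completion sigma_finite_lborel)

lemma subspace_L1: "subspace (L1 \<Omega>)"
  by (auto intro!: subspaceI simp: L1_def plus_fun_def zero_fun_def scaleR_fun_def)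

lemma seminorm_L1: "seminorm_on (L1 \<Omega>) (L1_norm \<Omega>)"
proof -
  have "L1_norm \<Omega> (u + v) \<le> L1_norm \<Omega> u + L1_norm \<Omega> v" if "u \<in> L1 \<Omega>" "v \<in> L1 \<Omega>" for u v :: "real^'a \<Rightarrow> real^'b"
  proof -
    have "L1_norm \<Omega> (u + v) \<le> (LINT x|lebesgue_on \<Omega>. norm (u x) + norm (v x))"
      unfolding L1_norm_def using that by (intro integral_mono) (auto simp: L1_def norm_triangle_ineq)
    then show ?thesis using that by (simp add: L1_norm_def L1_def)
  qed
  then show ?thesis by (auto simp: seminorm_on_def subspace_L1 L1_norm_def)
qed

lemma L1_cong_AE:
  assumes "u \<in> L1 \<Omega>" "v \<in> borel_measurable (lebesgue_on \<Omega>)" "AE x in lebesgue_on \<Omega>. u x = v x"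
  shows "v \<in> L1 \<Omega>"
  using assms unfolding L1_def by (auto intro: integrable_cong_AE_imp elim: eventually_mono)

lemma L1_norm_diff_eq_0_iff:
  assumes "u \<in> L1 \<Omega>" "v \<in> L1 \<Omega>"
  shows "L1_norm \<Omega> (u - v) = 0 \<longleftrightarrow> (AE x in lebesgue_on \<Omega>. u x = v x)"
proof -
  have "integrable (lebesgue_on \<Omega>) (\<lambda>x. norm (u x - v x))" using assms by (auto simp: L1_def)
  then show ?thesis
    unfolding L1_norm_def by (simp add: integral_nonneg_eq_0_iff_AE)
qed

lemma Linf_bound:
  assumes "w \<in> Linf \<Omega>"
  obtains C where "C \<ge> 0" "AE x in lebesgue_on \<Omega>. norm (w x) \<le> C"
proof -
  obtain C where "AE x in lebesgue_on \<Omega>. norm (w x) \<le> C" using assms by (auto simp: Linf_def)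
  then have "AE x in lebesgue_on \<Omega>. norm (w x) \<le> max C 0" by (auto elim!: eventually_mono)
  then show ?thesis using that[of "max C 0"] by simp
qed

lemma integrable_pairing:
  assumes w: "w \<in> Linf \<Omega>" and u: "u \<in> L1 \<Omega>"
  shows "integrable (lebesgue_on \<Omega>) (\<lambda>x. w x \<bullet> u x)"
proof -
  obtain C where C: "C \<ge> 0" "AE x in lebesgue_on \<Omega>. norm (w x) \<le> C" using Linf_bound[OF w] .
  have [measurable]: "w \<in> borel_measurable (lebesgue_on \<Omega>)" "u \<in> borel_measurable (lebesgue_on \<Omega>)"
    using w u by (auto simp: Linf_def L1_def)
  show ?thesis
  proof (rule Bochner_Integration.integrable_bound)
    show "integrable (lebesgue_on \<Omega>) (\<lambda>x. C * norm (u x))" using u by (auto simp: L1_def)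
    show "AE x in lebesgue_on \<Omega>. norm (w x \<bullet> u x) \<le> norm (C * norm (u x))"
      using C(2)
    proof eventually_elim
      fix x assume "norm (w x) \<le> C"
      then have "norm (w x) * norm (u x) \<le> C * norm (u x)" by (intro mult_right_mono) auto
      then show "norm (w x \<bullet> u x) \<le> norm (C * norm (u x))"
        using Cauchy_Schwarz_ineq2[of "w x" "u x"] C(1) by simp
    qed
  qed measurable
qed

lemma pairing_bound:
  assumes w: "w \<in> Linf \<Omega>"
  obtains C where "C \<ge> 0" "\<And>u. u \<in> L1 \<Omega> \<Longrightarrow> \<bar>pairing \<Omega> w u\<bar> \<le> C * L1_norm \<Omega> u"
proof -
  obtain C where C: "C \<ge> 0" "AE x in lebesgue_on \<Omega>. norm (w x) \<le> C" using Linf_bound[OF w] .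
  have "\<bar>pairing \<Omega> w u\<bar> \<le> C * L1_norm \<Omega> u" if u: "u \<in> L1 \<Omega>" for u
  proof -
    have "\<bar>pairing \<Omega> w u\<bar> \<le> (LINT x|lebesgue_on \<Omega>. \<bar>w x \<bullet> u x\<bar>)"
      unfolding pairing_def by (rule integral_abs_bound)
    also have "\<dots> \<le> (LINT x|lebesgue_on \<Omega>. C * norm (u x))"
    proof (rule integral_mono_AE)
      show "integrable (lebesgue_on \<Omega>) (\<lambda>x. C * norm (u x))" using u by (auto simp: L1_def)
      show "AE x in lebesgue_on \<Omega>. \<bar>w x \<bullet> u x\<bar> \<le> C * norm (u x)"
        using C(2)
      proof eventually_elim
        fix x assume "norm (w x) \<le> C"
        then have "norm (w x) * norm (u x) \<le> C * norm (u x)" by (intro mult_right_mono) auto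
        then show "\<bar>w x \<bullet> u x\<bar> \<le> C * norm (u x)"
          using Cauchy_Schwarz_ineq2[of "w x" "u x"] by simp
      qed
    qed (use integrable_pairing[OF w u] in auto)
    finally show ?thesis by (simp add: L1_norm_def)
  qed
  then show ?thesis using that C(1) by blast
qed

lemma pairing_add:
  assumes "w \<in> Linf \<Omega>" "u \<in> L1 \<Omega>" "v \<in> L1 \<Omega>"
  shows "pairing \<Omega> w (u + v) = pairing \<Omega> w u + pairing \<Omega> w v"
  using integrable_pairing[OF assms(1,2)] integrable_pairing[OF assms(1,3)]
  by (simp add: pairing_def inner_add_right)

lemma pairing_diff:
  assumes "w \<in> Linf \<Omega>" "u \<in> L1 \<Omega>" "v \<in> L1 \<Omega>"
  shows "pairing \<Omega> w (u - v) = pairing \<Omega> w u - pairing \<Omega> w v"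
  using integrable_pairing[OF assms(1,2)] integrable_pairing[OF assms(1,3)]
  by (simp add: pairing_def inner_diff_right)

lemma pairing_scaleR: "pairing \<Omega> w (c *\<^sub>R u) = c * pairing \<Omega> w u"
  by (simp add: pairing_def)

lemma pairing_cong_AE:
  assumes w: "w \<in> Linf \<Omega>" and u: "u \<in> L1 \<Omega>" "v \<in> L1 \<Omega>" and "AE x in lebesgue_on \<Omega>. u x = v x"
  shows "pairing \<Omega> w u = pairing \<Omega> w v"
proof -
  have [measurable]: "w \<in> borel_measurable (lebesgue_on \<Omega>)" "u \<in> borel_measurable (lebesgue_on \<Omega>)"
     "v \<in> borel_measurable (lebesgue_on \<Omega>)"
    using w u by (auto simp: Linf_def L1_def)
  show ?thesis unfolding pairing_def
    using assms(4) by (intro integral_cong_AE) (auto elim!: eventually_mono)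
qed

lemma basis_expansion_scaleR: "(\<Sum>i\<in>UNIV. (x $ i) *\<^sub>R axis i 1) = (x :: real^'m)"
  using basis_expansion[of x] by (simp add: scalar_mult_eq_scaleR)

text \<open>Testing with multiples of the coordinate vectors reduces to one scalar functional per
  coordinate. A one-sided bound is enough, because linearity applied to - u gives the other side.
  Each coordinate of w is bounded by c; summing over coordinates loses a dimensional factor,
  harmless for membership in L^infinity.\<close>

theorem L1_dual:
  fixes l :: "(real^'d \<Rightarrow> real^'m) \<Rightarrow> real"
  assumes \<Omega>: "\<Omega> \<in> sets lebesgue" and l: "linear l"
    and b: "\<And>u. u \<in> L1 \<Omega> \<Longrightarrow> l u \<le> c * L1_norm \<Omega> u"
  obtains w where "w \<in> Linf \<Omega>" "\<And>u. u \<in> L1 \<Omega> \<Longrightarrow> l u = pairing \<Omega> w u"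
proof -
  interpret sigma_finite_measure "lebesgue_on \<Omega>" by (rule sigma_finite_lebesgue_on[OF \<Omega>])
  have L1_axis: "(\<lambda>x. f x *\<^sub>R axis i (1::real)) \<in> L1 \<Omega>" if "integrable (lebesgue_on \<Omega>) f" for i :: 'm and f
    using that by (simp add: L1_def)
  define P where "P i w \<longleftrightarrow> w \<in> borel_measurable (lebesgue_on \<Omega>) \<and> (AE x in lebesgue_on \<Omega>. \<bar>w x\<bar> \<le> c) \<and>
     (\<forall>f. integrable (lebesgue_on \<Omega>) f \<longrightarrow> l (\<lambda>x. f x *\<^sub>R axis i 1) = (LINT x|lebesgue_on \<Omega>. w x * f x))" for i w
  have "\<exists>w. P i w" for i
  proof (rule L1_dual_scalar[where L="\<lambda>f. l (\<lambda>x. f x *\<^sub>R axis i 1)" and c=c])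
    show "l (\<lambda>x. (f x + g x) *\<^sub>R axis i 1) = l (\<lambda>x. f x *\<^sub>R axis i 1) + l (\<lambda>x. g x *\<^sub>R axis i 1)" for f g
      using linear_add[OF l, of "\<lambda>x. f x *\<^sub>R axis i 1" "\<lambda>x. g x *\<^sub>R axis i 1"]
      by (simp add: plus_fun_def scaleR_add_left)
    show "l (\<lambda>x. (a * f x) *\<^sub>R axis i 1) = a * l (\<lambda>x. f x *\<^sub>R axis i 1)" for f a
      using linear_scale[OF l, of a "\<lambda>x. f x *\<^sub>R axis i 1"] by (simp add: scaleR_fun_def)
    show "\<bar>l (\<lambda>x. f x *\<^sub>R axis i 1)\<bar> \<le> c * (LINT x|lebesgue_on \<Omega>. \<bar>f x\<bar>)"
      if f: "integrable (lebesgue_on \<Omega>) f" for f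
    proof -
      let ?u = "\<lambda>x. f x *\<^sub>R axis i (1::real)"
      have "- ?u \<in> L1 \<Omega>" using L1_axis[OF f] by (rule subspace_neg[OF subspace_L1])
      then have "- l ?u \<le> c * L1_norm \<Omega> (- ?u)" using b[of "- ?u"] linear_neg[OF l, of ?u] by simp
      then show ?thesis using b[OF L1_axis[OF f], of i] seminorm_onD(6)[OF seminorm_L1 L1_axis[OF f], of i]
        by (simp add: L1_norm_def norm_axis_1 abs_le_iff)
    qed
  qed (auto simp: P_def)
  then obtain W where "\<And>i. P i (W i)" using choice[of P] by blast
  then have W: "W i \<in> borel_measurable (lebesgue_on \<Omega>)" "AE x in lebesgue_on \<Omega>. \<bar>W i x\<bar> \<le> c"
    "integrable (lebesgue_on \<Omega>) f \<Longrightarrow> l (\<lambda>x. f x *\<^sub>R axis i 1) = (LINT x|lebesgue_on \<Omega>. W i x * f x)" for i f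
    unfolding P_def by blast+
  note [measurable] = W(1)
  define w where "w x = (\<chi> i. W i x)" for x
  have wi: "w = (\<lambda>x. \<Sum>i\<in>UNIV. W i x *\<^sub>R axis i 1)"
    using basis_expansion_scaleR[of "w _"] by (simp add: fun_eq_iff w_def)
  have "(\<lambda>x. \<Sum>i\<in>UNIV. W i x *\<^sub>R axis i (1::real)) \<in> borel_measurable (lebesgue_on \<Omega>)" by measurable
  then have "w \<in> borel_measurable (lebesgue_on \<Omega>)" by (simp only: wi)
  moreover have "AE x in lebesgue_on \<Omega>. norm (w x) \<le> (\<Sum>i\<in>(UNIV::'m set). c)"
  proof -
    have "AE x in lebesgue_on \<Omega>. \<forall>i\<in>UNIV. \<bar>W i x\<bar> \<le> c" using W(2) by (intro AE_finite_allI) auto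
    then show ?thesis
    proof eventually_elim
      fix x assume "\<forall>i\<in>UNIV. \<bar>W i x\<bar> \<le> c"
      then have "(\<Sum>i\<in>UNIV. \<bar>w x $ i\<bar>) \<le> (\<Sum>i\<in>(UNIV::'m set). c)" by (intro sum_mono) (auto simp: w_def)
      then show "norm (w x) \<le> (\<Sum>i\<in>(UNIV::'m set). c)" using norm_le_l1_cart[of "w x"] by linarith
    qed
  qed
  ultimately have "w \<in> Linf \<Omega>" by (auto simp: Linf_def)
  moreover have "l u = pairing \<Omega> w u" if u: "u \<in> L1 \<Omega>" for u
  proof -
    have ui: "integrable (lebesgue_on \<Omega>) (\<lambda>x. u x $ i)" for i using u integrable_inner_left[of "axis i 1" "lebesgue_on \<Omega>" u] by (simp add: L1_def inner_axis)
    have "u = (\<Sum>i\<in>UNIV. (\<lambda>x. (u x $ i) *\<^sub>R axis i 1))"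
      by (simp add: fun_eq_iff basis_expansion_scaleR)
    then have "l u = (\<Sum>i\<in>UNIV. l (\<lambda>x. (u x $ i) *\<^sub>R axis i 1))" by (subst linear_sum[OF l, symmetric]) simp
    also have "\<dots> = (\<Sum>i\<in>UNIV. (LINT x|lebesgue_on \<Omega>. W i x * u x $ i))" by (intro sum.cong refl W(3) ui)
    also have "\<dots> = (LINT x|lebesgue_on \<Omega>. (\<Sum>i\<in>UNIV. W i x * u x $ i))"
    proof (rule Bochner_Integration.integral_sum[symmetric])
      fix i
      show "integrable (lebesgue_on \<Omega>) (\<lambda>x. W i x * u x $ i)"
      proof (rule Bochner_Integration.integrable_bound[OF integrable_mult_right[OF ui, of c i]])
        show "AE x in lebesgue_on \<Omega>. norm (W i x * u x $ i) \<le> norm (c * u x $ i)"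
          using W(2)[of i] by eventually_elim (auto simp: abs_mult intro!: mult_right_mono)
      qed (use borel_measurable_integrable[OF ui, of i] in measurable)
    qed
    also have "\<dots> = pairing \<Omega> w u" by (simp add: pairing_def inner_vec_def w_def)
    finally show ?thesis .
  qed
  ultimately show ?thesis using that by blast
qed

text \<open>Riesz-Fischer for series, the form that the open mapping argument consumes: corrections
  with summable norms are added up, and the norm of the sum has to be controlled. The integrable
  majorant is the pointwise sum of the norms.\<close>

lemma L1_complete:
  fixes u :: "nat \<Rightarrow> real^'d \<Rightarrow> real^'m"
  assumes u: "\<And>n. u n \<in> L1 \<Omega>" and s: "summable (\<lambda>n. L1_norm \<Omega> (u n))"
  obtains v where "v \<in> L1 \<Omega>" "(\<lambda>n. L1_norm \<Omega> (v - (\<Sum>i<n. u i))) \<longlonglongrightarrow> 0"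
    "L1_norm \<Omega> v \<le> (\<Sum>n. L1_norm \<Omega> (u n))"
proof -
  let ?M = "lebesgue_on \<Omega>"
  have ui: "integrable ?M (u n)" for n using u by (simp add: L1_def)
  have un: "integrable ?M (\<lambda>x. norm (u n x))" for n using ui by simp
  note [measurable] = borel_measurable_integrable[OF ui]
  have "(\<integral>\<^sup>+x. (\<Sum>n. ennreal (norm (u n x))) \<partial>?M) = (\<Sum>n. \<integral>\<^sup>+x. norm (u n x) \<partial>?M)"
    by (intro nn_integral_suminf) measurable
  also have "\<dots> = (\<Sum>n. ennreal (L1_norm \<Omega> (u n)))"
    unfolding L1_norm_def by (intro suminf_cong nn_integral_eq_integral un) auto
  also have "\<dots> \<noteq> \<infinity>"
    using s by (simp add: suminf_ennreal2 L1_norm_def)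
  finally have "AE x in ?M. (\<Sum>n. ennreal (norm (u n x))) \<noteq> \<infinity>"
    by (intro nn_integral_PInf_AE) auto
  then have AEs: "AE x in ?M. summable (\<lambda>n. norm (u n x))"
    by eventually_elim (auto intro: summable_suminf_not_top)
  define h where "h x = (\<Sum>n. norm (u n x))" for x
  define v where "v x = (\<Sum>n. u n x)" for x
  have sn: "summable (\<lambda>n. LINT x|?M. norm (norm (u n x)))" "summable (\<lambda>n. LINT x|?M. norm (u n x))"
    using s by (simp_all add: L1_norm_def)
  have AEs': "AE x in ?M. summable (\<lambda>n. norm (norm (u n x)))" using AEs by simp
  have h: "integrable ?M h" unfolding h_def by (rule integrable_suminf[OF un AEs' sn(1)])
  have v: "integrable ?M v" unfolding v_def by (rule integrable_suminf[OF ui AEs sn(2)])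
  have "(\<lambda>n. LINT x|?M. norm ((\<Sum>i<n. u i x) - v x)) \<longlonglongrightarrow> 0"
  proof (rule integral_norm_diff_tendsto_0[OF h _ v])
    show "AE x in ?M. (\<lambda>n. \<Sum>i<n. u i x) \<longlonglongrightarrow> v x"
      using AEs unfolding v_def by eventually_elim (auto intro: summable_LIMSEQ summable_norm_cancel)
    show "AE x in ?M. norm (\<Sum>i<n. u i x) \<le> h x" for n
      using AEs unfolding h_def
      by eventually_elim (auto intro!: order_trans[OF norm_sum] sum_le_suminf)
  qed measurable
  then have lim: "(\<lambda>n. L1_norm \<Omega> (v - (\<Sum>i<n. u i))) \<longlonglongrightarrow> 0"
    by (simp add: L1_norm_def norm_minus_commute)
  have le: "L1_norm \<Omega> v \<le> (\<Sum>n. L1_norm \<Omega> (u n))"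
  proof -
    have "L1_norm \<Omega> v \<le> (LINT x|?M. h x)"
      unfolding L1_norm_def
    proof (rule integral_mono_AE)
      show "AE x in ?M. norm (v x) \<le> h x"
        using AEs unfolding v_def h_def by eventually_elim (rule summable_norm)
    qed (use v h in auto)
    also have "\<dots> = (\<Sum>n. L1_norm \<Omega> (u n))"
      unfolding h_def L1_norm_def by (rule integral_suminf[OF un AEs' sn(1)])
    finally show ?thesis .
  qed
  have "v \<in> L1 \<Omega>" using v by (simp add: L1_def)
  then show ?thesis using lim le by (rule that)
qed

section \<open>Differentiable functions, bumps and integration by parts\<close>

lemma partial_deriv_eq:
  assumes "(g has_derivative g') (at x)"
  shows "partial_deriv i g x = g' (axis i 1)"
proof -
  interpret bounded_linear g' using assms by (rule has_derivative_bounded_linear)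
  have "(g has_derivative g') (at (x + 0 *\<^sub>R axis i 1))" using assms by simp
  moreover have "((\<lambda>t. x + t *\<^sub>R axis i (1::real)) has_derivative (\<lambda>t. t *\<^sub>R axis i 1)) (at 0)"
    by (auto intro!: derivative_eq_intros)
  ultimately have "((\<lambda>t. g (x + t *\<^sub>R axis i 1)) has_derivative (\<lambda>t. g' (t *\<^sub>R axis i 1))) (at 0)"
    by (rule has_derivative_compose[rotated])
  then have "((\<lambda>t. g (x + t *\<^sub>R axis i 1)) has_vector_derivative g' (axis i 1)) (at 0)"
    by (simp add: has_vector_derivative_def scaleR)
  then show ?thesis unfolding partial_deriv_def by (rule vector_derivative_at)
qed

lemma partial_deriv_has_derivative_line:
  assumes "g differentiable (at (x + s *\<^sub>R axis i 1))"
  shows "((\<lambda>t. g (x + t *\<^sub>R axis i 1)) has_vector_derivative partial_deriv i g (x + s *\<^sub>R axis i 1)) (at s)"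
proof -
  obtain g' where g': "(g has_derivative g') (at (x + s *\<^sub>R axis i 1))"
    using assms unfolding differentiable_def by blast
  interpret bounded_linear g' using g' by (rule has_derivative_bounded_linear)
  have "((\<lambda>t. x + t *\<^sub>R axis i (1::real)) has_derivative (\<lambda>t. t *\<^sub>R axis i 1)) (at s)"
    by (auto intro!: derivative_eq_intros)
  with g' have "((\<lambda>t. g (x + t *\<^sub>R axis i 1)) has_derivative (\<lambda>t. g' (t *\<^sub>R axis i 1))) (at s)"
    by (rule has_derivative_compose[rotated])
  then show ?thesis
    by (simp add: has_vector_derivative_def scaleR partial_deriv_eq[OF g'])
qed

lemma partial_deriv_cong:
  assumes "open S" "x \<in> S" "\<And>y. y \<in> S \<Longrightarrow> g y = h y"
  shows "partial_deriv i g x = partial_deriv i h x"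
  unfolding partial_deriv_def
proof (rule vector_derivative_cong_eq)
  have "((\<lambda>t. x + t *\<^sub>R axis i (1::real)) \<longlongrightarrow> x + 0 *\<^sub>R axis i 1) (nhds 0)"
    by (intro tendsto_add tendsto_const tendsto_scaleR filterlim_ident)
  then have "((\<lambda>t. x + t *\<^sub>R axis i (1::real)) \<longlongrightarrow> x) (nhds 0)" by simp
  then have "\<forall>\<^sub>F t in nhds 0. x + t *\<^sub>R axis i 1 \<in> S" using assms(1,2) by (rule topological_tendstoD)
  then show "\<forall>\<^sub>F t in nhds 0. t \<in> UNIV \<longrightarrow> g (x + t *\<^sub>R axis i 1) = h (x + t *\<^sub>R axis i 1)"
    by eventually_elim (simp add: assms(3))
qed auto

lemma partial_derivs_cong:
  assumes "open S" "x \<in> S" "\<And>y. y \<in> S \<Longrightarrow> g y = h y"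
  shows "partial_derivs s g x = partial_derivs s h x"
  using assms(2)
proof (induction s arbitrary: x)
  case (Cons i s)
  have "partial_deriv i (partial_derivs s g) x = partial_deriv i (partial_derivs s h) x"
    using Cons.IH by (rule partial_deriv_cong[OF assms(1) Cons.prems])
  then show ?case by simp
qed (use assms(3) in simp)

lemma partial_derivs_append: "partial_derivs (s @ t) g = partial_derivs s (partial_derivs t g)"
  by (induction s) auto

lemma partial_derivs_0: "partial_derivs s (\<lambda>x. 0) = (\<lambda>x. 0)"
proof (induction s)
  case (Cons i s)
  then show ?case by (auto simp: partial_deriv_def fun_eq_iff intro: vector_derivative_at)
qed simp

lemma partial_derivs_eq_0:
  assumes "compact K" "\<And>x. x \<notin> K \<Longrightarrow> g x = 0" "x \<notin> K"
  shows "partial_derivs s g x = 0"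
proof -
  have "partial_derivs s g x = partial_derivs s (\<lambda>_. 0) x"
    using assms by (intro partial_derivs_cong[of "- K"]) (auto simp: compact_imp_closed)
  then show ?thesis by (simp add: partial_derivs_0)
qed

lemma Ck_on_0: "Ck_on 0 \<Omega> g \<longleftrightarrow> continuous_on \<Omega> g"
  by (auto simp: Ck_on_def)

text \<open>Lists of directions act from the right, so the derivative taken first is the last entry.
  Splitting it off turns \<open>Ck_on\<close> into a recursion on the order and permits inductions
  over k that generalise over the function.\<close>

lemma Ck_on_Suc:
  "Ck_on (Suc k) \<Omega> g \<longleftrightarrow> (\<forall>x\<in>\<Omega>. g differentiable (at x)) \<and> continuous_on \<Omega> g \<and> (\<forall>i. Ck_on k \<Omega> (partial_deriv i g))"
    (is "?L \<longleftrightarrow> ?R")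
proof
  assume L: ?L
  have "partial_derivs (s @ [i]) g = partial_derivs s (partial_deriv i g)" for s i
    by (simp add: partial_derivs_append)
  moreover have "\<forall>x\<in>\<Omega>. partial_derivs (s @ [i]) g differentiable (at x)" if "length s < k" for s i
    using L that unfolding Ck_on_def by auto
  moreover have "continuous_on \<Omega> (partial_derivs (s @ [i]) g)" if "length s \<le> k" for s i
    using L that unfolding Ck_on_def by auto
  ultimately have "Ck_on k \<Omega> (partial_deriv i g)" for i
    unfolding Ck_on_def by metis
  moreover have "\<forall>x\<in>\<Omega>. partial_derivs [] g differentiable (at x)" "continuous_on \<Omega> (partial_derivs [] g)"
    using L[unfolded Ck_on_def, THEN conjunct1, rule_format, of "[]"]
      L[unfolded Ck_on_def, THEN conjunct2, rule_format, of "[]"] by auto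
  ultimately show ?R by simp
next
  assume R: ?R
  have "\<forall>x\<in>\<Omega>. partial_derivs s g differentiable (at x)" if "length s < Suc k" for s
    using R that by (cases s rule: rev_cases) (auto simp: Ck_on_def partial_derivs_append)
  moreover have "continuous_on \<Omega> (partial_derivs s g)" if "length s \<le> Suc k" for s
    using R that by (cases s rule: rev_cases) (auto simp: Ck_on_def partial_derivs_append)
  ultimately show ?L unfolding Ck_on_def by blast
qed

lemma Ck_on_mono: "Ck_on m \<Omega> g \<Longrightarrow> k \<le> m \<Longrightarrow> Ck_on k \<Omega> g"
  unfolding Ck_on_def by auto

lemma Ck_on_continuous_partial_derivs: "Ck_on k \<Omega> g \<Longrightarrow> length s \<le> k \<Longrightarrow> continuous_on \<Omega> (partial_derivs s g)"
  unfolding Ck_on_def by blast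

lemma Ck_on_partial_derivs:
  assumes "Ck_on (length s + k) \<Omega> g" shows "Ck_on k \<Omega> (partial_derivs s g)"
  using assms
proof (induction s arbitrary: g rule: rev_induct)
  case (snoc i s)
  then have "Ck_on (length s + k) \<Omega> (partial_deriv i g)" by (simp add: Ck_on_Suc)
  then show ?case using snoc.IH by (simp add: partial_derivs_append)
qed simp

lemma Ck_on_cong:
  assumes "open \<Omega>" "\<And>x. x \<in> \<Omega> \<Longrightarrow> g x = h x" "Ck_on k \<Omega> g"
  shows "Ck_on k \<Omega> h"
proof -
  have eq: "partial_derivs s g x = partial_derivs s h x" if "x \<in> \<Omega>" for s x
    using assms that by (intro partial_derivs_cong) auto
  have "partial_derivs s h differentiable (at x)" if x: "x \<in> \<Omega>" and "length s < k" for s x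
  proof -
    have "partial_derivs s g differentiable (at x)" using assms(3) that unfolding Ck_on_def by blast
    then obtain D where "(partial_derivs s g has_derivative D) (at x)" unfolding differentiable_def by blast
    then have "(partial_derivs s h has_derivative D) (at x)"
      using assms(1) x eq by (rule has_derivative_transform_within_open)
    then show ?thesis unfolding differentiable_def by blast
  qed
  moreover have "continuous_on \<Omega> (partial_derivs s h)" if "length s \<le> k" for s
    using assms(3) eq that continuous_on_cong[OF refl, of \<Omega> "partial_derivs s g" "partial_derivs s h"]
    unfolding Ck_on_def by blast
  ultimately show ?thesis unfolding Ck_on_def by blast
qed

lemma Ck_on_Un:
  assumes "open S" "open T" "Ck_on k S g" "Ck_on k T g"
  shows "Ck_on k (S \<union> T) g"
  using assms unfolding Ck_on_def by (auto intro: continuous_on_open_Un)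

lemma Ck_on_zero: "Ck_on k \<Omega> (\<lambda>x. 0)"
  by (simp add: Ck_on_def partial_derivs_0)

text \<open>\<Omega> and the complement of K are an open cover of the space, and on the latter the
  function is zero. In this way products of test functions with coefficients, which are regular only
  inside \<Omega>, become functions of class C^k on the whole space.\<close>

lemma Ck_on_extend_zero:
  assumes "open \<Omega>" "compact K" "K \<subseteq> \<Omega>" "\<And>x. x \<notin> K \<Longrightarrow> g x = 0" "Ck_on k \<Omega> g"
  shows "Ck_on k UNIV g"
proof -
  have o: "open (- K)" using assms(2) compact_imp_closed by auto
  have "Ck_on k (- K) g"
    using assms(4) by (intro Ck_on_cong[OF o _ Ck_on_zero]) auto
  moreover have "\<Omega> \<union> - K = UNIV" using assms(3) by auto
  ultimately show ?thesis using Ck_on_Un[OF assms(1) o assms(5)] by simp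
qed

lemma Ck_on_add:
  assumes "open \<Omega>" "Ck_on k \<Omega> g" "Ck_on k \<Omega> h"
  shows "Ck_on k \<Omega> (\<lambda>x. g x + h x)"
  using assms(2,3)
proof (induction k arbitrary: g h)
  case 0
  then show ?case by (simp add: Ck_on_0 continuous_on_add)
next
  case (Suc k)
  have "Ck_on k \<Omega> (partial_deriv i (\<lambda>x. g x + h x))" for i
  proof (rule Ck_on_cong[OF assms(1)])
    show "Ck_on k \<Omega> (\<lambda>x. partial_deriv i g x + partial_deriv i h x)"
      using Suc.prems by (intro Suc.IH) (auto simp: Ck_on_Suc)
    fix x assume "x \<in> \<Omega>"
    then have "g differentiable (at x)" "h differentiable (at x)" using Suc.prems by (auto simp: Ck_on_Suc)
    then obtain g' h' where "(g has_derivative g') (at x)" "(h has_derivative h') (at x)"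
      unfolding differentiable_def by blast
    note gh = this
    show "partial_deriv i g x + partial_deriv i h x = partial_deriv i (\<lambda>x. g x + h x) x"
      by (simp only: partial_deriv_eq[OF has_derivative_add[OF gh]] partial_deriv_eq[OF gh(1)] partial_deriv_eq[OF gh(2)])
  qed
  then show ?case using Suc.prems by (auto simp: Ck_on_Suc intro: continuous_on_add)
qed

lemma partial_deriv_bilinear:
  assumes "bounded_bilinear b" "g differentiable (at x)" "h differentiable (at x)"
  shows "partial_deriv i (\<lambda>x. b (g x) (h x)) x = b (g x) (partial_deriv i h x) + b (partial_deriv i g x) (h x)"
    "(\<lambda>x. b (g x) (h x)) differentiable (at x)"
proof -
  obtain g' h' where gh: "(g has_derivative g') (at x)" "(h has_derivative h') (at x)"
    using assms by (auto simp: differentiable_def)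
  note d = bounded_bilinear.FDERIV[OF assms(1) gh]
  show "partial_deriv i (\<lambda>x. b (g x) (h x)) x = b (g x) (partial_deriv i h x) + b (partial_deriv i g x) (h x)"
    using partial_deriv_eq[OF d] gh by (simp add: partial_deriv_eq)
  show "(\<lambda>x. b (g x) (h x)) differentiable (at x)" using d by (auto simp: differentiable_def)
qed

text \<open>One product rule covers real products, scalar multiples and matrices acting on vectors.
  Its formula for partial derivatives is available at points of \<Omega>, hence the passage through
  \<open>Ck_on_cong\<close>.\<close>

lemma Ck_on_bilinear:
  assumes b: "bounded_bilinear b" and "open \<Omega>" "Ck_on k \<Omega> g" "Ck_on k \<Omega> h"
  shows "Ck_on k \<Omega> (\<lambda>x. b (g x) (h x))"
  using assms(3,4)
proof (induction k arbitrary: g h)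
  case 0
  then show ?case by (simp add: Ck_on_0 bounded_bilinear.continuous_on[OF b])
next
  case (Suc k)
  have "Ck_on k \<Omega> (partial_deriv i (\<lambda>x. b (g x) (h x)))" for i
  proof (rule Ck_on_cong[OF assms(2)])
    have "Ck_on k \<Omega> g" "Ck_on k \<Omega> h" using Suc.prems by (auto intro: Ck_on_mono)
    then show "Ck_on k \<Omega> (\<lambda>x. b (g x) (partial_deriv i h x) + b (partial_deriv i g x) (h x))"
      using Suc.prems by (intro Ck_on_add Suc.IH assms(2)) (auto simp: Ck_on_Suc)
    fix x assume "x \<in> \<Omega>"
    then show "b (g x) (partial_deriv i h x) + b (partial_deriv i g x) (h x) = partial_deriv i (\<lambda>x. b (g x) (h x)) x"
      using Suc.prems by (subst partial_deriv_bilinear(1)[OF b]) (auto simp: Ck_on_Suc)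
  qed
  then show ?case using Suc.prems
    by (auto simp: Ck_on_Suc intro: bounded_bilinear.continuous_on[OF b] partial_deriv_bilinear(2)[OF b])
qed

lemma continuous_on_Ck: "Ck_on k \<Omega> g \<Longrightarrow> continuous_on \<Omega> g"
  using Ck_on_continuous_partial_derivs[of k \<Omega> g "[]"] by simp

section \<open>Smooth bumps supported in boxes\<close>

definition flat_exp :: "real poly \<Rightarrow> real \<Rightarrow> real" where
  "flat_exp p t = (if t > 0 then poly p (1 / t) * exp (- (1 / t)) else 0)"

lemma poly_div_exp_at_top: "((\<lambda>u. poly p u / exp u) \<longlongrightarrow> (0::real)) at_top"
proof -
  have "((\<lambda>u. \<Sum>i\<le>degree p. coeff p i * (u ^ i / exp u)) \<longlongrightarrow> (\<Sum>i\<le>degree p. coeff p i * 0)) at_top"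
    by (intro tendsto_intros tendsto_power_div_exp_0)
  then show ?thesis by (simp add: poly_altdef sum_divide_distrib)
qed

text \<open>With u = 1/t the derivative of p(u) e^(-u) in t is u^2 (p(u) - p'(u)) e^(-u), so the
  family indexed by polynomials is closed under differentiation and one induction over the order
  gives smoothness. At t = 0 the exponential beats every polynomial.\<close>

lemma flat_exp_has_derivative:
  "(flat_exp p has_real_derivative flat_exp ([:0, 0, 1:] * (p - pderiv p)) t) (at t)"
proof (cases t "0::real" rule: linorder_cases)
  case less
  have "((\<lambda>t. 0) has_real_derivative 0) (at t)" by simp
  then have "(flat_exp p has_real_derivative 0) (at t)"
    by (rule has_field_derivative_transform_within_open[of _ _ _ "{..<0}"]) (use less in \<open>auto simp: flat_exp_def\<close>)
  then show ?thesis using less by (simp add: flat_exp_def)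
next
  case greater
  have "((\<lambda>t. poly p (1 / t) * exp (- (1 / t))) has_real_derivative
     flat_exp ([:0, 0, 1:] * (p - pderiv p)) t) (at t)"
    using greater
    by (auto intro!: derivative_eq_intros DERIV_chain'[OF _ poly_DERIV] simp: flat_exp_def field_simps power2_eq_square)
  then show ?thesis
    by (rule has_field_derivative_transform_within_open[of _ _ _ "{0<..}"]) (use greater in \<open>auto simp: flat_exp_def\<close>)
next
  case equal
  have "((\<lambda>h. (flat_exp p (0 + h) - flat_exp p 0) / h) \<longlongrightarrow> 0) (at 0)"
    unfolding filterlim_at_split
  proof
    have "\<forall>\<^sub>F h in at_left 0. (flat_exp p (0 + h) - flat_exp p 0) / h = (0::real)"
      by (auto simp: eventually_at_filter flat_exp_def)
    then show "((\<lambda>h. (flat_exp p (0 + h) - flat_exp p 0) / h) \<longlongrightarrow> 0) (at_left 0)"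
      by (rule tendsto_eventually)
    \<comment> \<open>In terms of u = 1/h the right difference quotient is u p(u) e^(-u), whence the
      polynomial \<open>pCons 0 p\<close>.\<close>
    have "((\<lambda>h. poly (pCons 0 p) (inverse h) / exp (inverse h)) \<longlongrightarrow> (0::real)) (at_right 0)"
      by (rule filterlim_compose[OF poly_div_exp_at_top filterlim_inverse_at_top_right])
    moreover have "\<forall>\<^sub>F h in at_right 0. (flat_exp p (0 + h) - flat_exp p 0) / h = poly (pCons 0 p) (inverse h) / exp (inverse h)"
      by (auto simp: eventually_at_filter flat_exp_def exp_minus field_simps)
    ultimately show "((\<lambda>h. (flat_exp p (0 + h) - flat_exp p 0) / h) \<longlongrightarrow> 0) (at_right 0)"
      by (simp add: filterlim_cong)
  qed
  then show ?thesis using equal by (simp add: DERIV_def flat_exp_def[of _ 0])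
qed

lemma Ck_on_flat_exp: "Ck_on k UNIV (\<lambda>x::real^'d. flat_exp p (c * x $ i + e))"
proof (induction k arbitrary: p)
  case 0
  have "continuous_on UNIV (flat_exp p)"
    using flat_exp_has_derivative by (intro continuous_at_imp_continuous_on) (blast intro: DERIV_isCont)
  then show ?case unfolding Ck_on_0
    by (rule continuous_on_compose2) (auto intro!: continuous_intros)
next
  case (Suc k)
  define q where "q = [:0, 0, 1:] * (p - pderiv p)"
  have d: "((\<lambda>x::real^'d. flat_exp p (c * x $ i + e)) has_derivative
      (\<lambda>h. h $ i * (c * flat_exp q (c * x $ i + e)))) (at x)" for x
  proof -
    have "((\<lambda>x::real^'d. c * x $ i + e) has_derivative (\<lambda>h. c * h $ i)) (at x)"
      by (auto intro!: derivative_eq_intros bounded_linear.has_derivative[OF bounded_linear_vec_nth])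
    moreover have "(flat_exp p has_derivative (*) (flat_exp q (c * x $ i + e))) (at (c * x $ i + e))"
      using flat_exp_has_derivative[of p "c * x $ i + e"] by (simp add: q_def has_field_derivative_def)
    ultimately have "((\<lambda>x::real^'d. flat_exp p (c * x $ i + e)) has_derivative (\<lambda>h. flat_exp q (c * x $ i + e) * (c * h $ i))) (at x)"
      by (rule has_derivative_compose)
    then show ?thesis by (simp add: mult_ac)
  qed
  \<comment> \<open>The slope c is absorbed into the polynomial, and directions other than i give
    the zero polynomial, so the induction hypothesis for arbitrary \<open>p\<close> applies.\<close>
  have "partial_deriv j (\<lambda>x::real^'d. flat_exp p (c * x $ i + e)) =
     (\<lambda>x. flat_exp (if i = j then smult c q else 0) (c * x $ i + e))" for j
    by (rule ext, subst partial_deriv_eq[OF d]) (auto simp: axis_def flat_exp_def)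
  moreover have "continuous_on UNIV (\<lambda>x::real^'d. flat_exp p (c * x $ i + e))"
    using d by (intro continuous_at_imp_continuous_on) (blast intro: has_derivative_continuous)
  ultimately show ?case using Suc.IH d by (auto simp: Ck_on_Suc differentiable_def)
qed

lemma Ck_on_const: "Ck_on k UNIV (\<lambda>x::real^'d. c)"
proof (induction k)
  case 0
  then show ?case by (simp add: Ck_on_0)
next
  case (Suc k)
  have "partial_deriv i (\<lambda>x::real^'d. c) = (\<lambda>x. 0)" for i
    by (auto simp: partial_deriv_def fun_eq_iff intro: vector_derivative_at)
  then show ?case by (simp add: Ck_on_Suc Ck_on_zero)
qed

lemma Ck_on_prod:
  fixes g :: "'i \<Rightarrow> real^'d \<Rightarrow> real"
  assumes "\<And>i. i \<in> I \<Longrightarrow> Ck_on k UNIV (g i)"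
  shows "Ck_on k UNIV (\<lambda>x. \<Prod>i\<in>I. g i x)"
  using assms
proof (induction I rule: infinite_finite_induct)
  case (insert i I)
  then show ?case by (simp add: Ck_on_bilinear[OF bounded_bilinear_mult])
qed (auto simp: Ck_on_const)

text \<open>Inside the box each factor is e^(-1/(n d)), with d the distance to one face, and beyond
  that face it is 0; so the product tends to the indicator of the open box as n grows. The arguments
  are expanded to match the affine shape in \<open>Ck_on_flat_exp\<close>.\<close>

definition box_bump :: "real^'d \<Rightarrow> real^'d \<Rightarrow> nat \<Rightarrow> real^'d \<Rightarrow> real" where
  "box_bump a b n x =
     (\<Prod>i\<in>UNIV. flat_exp 1 (real n * x $ i + - real n * a $ i) * flat_exp 1 (- real n * x $ i + real n * b $ i))"

lemma flat_exp_1_bounds: "0 \<le> flat_exp 1 t" "flat_exp 1 t \<le> 1"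
  by (auto simp: flat_exp_def)

lemma Ck_on_box_bump: "Ck_on k UNIV (box_bump a b n)"
  unfolding box_bump_def[abs_def]
  by (intro Ck_on_prod Ck_on_bilinear[OF bounded_bilinear_mult] Ck_on_flat_exp) auto

lemma box_bump_bounds: "0 \<le> box_bump a b n x" "box_bump a b n x \<le> 1"
  unfolding box_bump_def
  by (intro prod_nonneg prod_le_1 mult_le_one mult_nonneg_nonneg conjI ballI flat_exp_1_bounds)+

lemma box_bump_outside:
  assumes "x \<notin> box a b" shows "box_bump a b n x = 0"
proof -
  obtain i where "\<not> (a $ i < x $ i \<and> x $ i < b $ i)" using assms by (auto simp: mem_box_cart)
  then have "real n * x $ i + - real n * a $ i \<le> 0 \<or> - real n * x $ i + real n * b $ i \<le> 0"
    by (auto simp: not_less mult_left_mono)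
  then have "flat_exp 1 (real n * x $ i + - real n * a $ i) * flat_exp 1 (- real n * x $ i + real n * b $ i) = 0"
    by (auto simp: flat_exp_def)
  then show ?thesis unfolding box_bump_def by (intro prod_zero) auto
qed

lemma flat_exp_1_tendsto: "t > 0 \<Longrightarrow> (\<lambda>n. flat_exp 1 (real n * t)) \<longlonglongrightarrow> 1"
proof -
  assume t: "t > 0"
  have "(\<lambda>n. exp (- (inverse (real n) * (1 / t)))) \<longlonglongrightarrow> exp (- (0 * (1 / t)))"
    by (intro tendsto_intros LIMSEQ_inverse_real_of_nat[THEN LIMSEQ_imp_Suc] lim_inverse_n)
  moreover have "\<forall>\<^sub>F n in sequentially. flat_exp 1 (real n * t) = exp (- (inverse (real n) * (1 / t)))"
    using eventually_gt_at_top[of 0] by eventually_elim (use t in \<open>simp add: flat_exp_def field_simps\<close>)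
  ultimately show ?thesis by (simp add: filterlim_cong)
qed

lemma box_bump_tendsto: "(\<lambda>n. box_bump a b n x) \<longlonglongrightarrow> indicator (box a b) x"
proof (cases "x \<in> box a b")
  case True
  have "(\<lambda>n. box_bump a b n x) \<longlonglongrightarrow> (\<Prod>i\<in>(UNIV::'a set). 1 * 1)"
    unfolding box_bump_def
  proof (intro tendsto_prod tendsto_mult)
    fix i
    have "0 < x $ i - a $ i" "0 < b $ i - x $ i" using True by (auto simp: mem_box_cart)
    then show "(\<lambda>n. flat_exp 1 (real n * x $ i + - real n * a $ i)) \<longlonglongrightarrow> 1"
      "(\<lambda>n. flat_exp 1 (- real n * x $ i + real n * b $ i)) \<longlonglongrightarrow> 1"
      using flat_exp_1_tendsto[of "x $ i - a $ i"] flat_exp_1_tendsto[of "b $ i - x $ i"] by (simp_all add: algebra_simps)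
  qed
  then show ?thesis using True by simp
qed (simp add: box_bump_outside)

lemma test_function_box_bump:
  assumes "cbox a b \<subseteq> \<Omega>"
  shows "(\<lambda>x. box_bump a b n x *\<^sub>R v) \<in> test_functions \<Omega>"
proof -
  have "Ck_on k UNIV (\<lambda>x. box_bump a b n x *\<^sub>R v)" for k
    by (intro Ck_on_bilinear[OF bounded_bilinear_scaleR] Ck_on_box_bump Ck_on_const) auto
  moreover have "box_bump a b n x *\<^sub>R v = 0" if "x \<notin> cbox a b" for x
    using that box_bump_outside[of x a b n] box_subset_cbox[of a b] by auto
  ultimately show ?thesis using assms unfolding test_functions_def
    by (intro CollectI conjI allI exI[of _ "cbox a b"]) auto
qed

section \<open>Integration by parts with compact support\<close>

lemma integrable_compact_support:
  fixes g :: "real^'d \<Rightarrow> 'b::{banach, second_countable_topology}"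
  assumes "compact K" "continuous_on K g" "\<And>x. x \<notin> K \<Longrightarrow> g x = 0"
  shows "integrable lborel g"
proof -
  have "integrable lborel (\<lambda>x. indicator K x *\<^sub>R g x)" using assms(1,2) by (rule borel_integrable_compact)
  also have "(\<lambda>x. indicator K x *\<^sub>R g x) = g" using assms(3) by (auto simp: fun_eq_iff indicator_def)
  finally show ?thesis .
qed

lemma lborel_integral_translation:
  fixes g :: "'a::euclidean_space \<Rightarrow> 'b::{banach, second_countable_topology}"
  assumes [measurable]: "g \<in> borel_measurable borel"
  shows "(LINT x|lborel. g (c + x)) = (LINT x|lborel. g x)"
  by (subst (2) lborel_distr_plus[of c, symmetric]) (simp add: integral_distr)

text \<open>Difference quotients have integral zero by translation invariance, and they converge
  dominatedly.\<close>

lemma integral_partial_deriv_eq_0: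
  fixes h :: "real^'d \<Rightarrow> real"
  assumes d: "\<And>x. h differentiable (at x)" and c: "continuous_on UNIV (partial_deriv i h)"
    and K: "compact K" "\<And>x. x \<notin> K \<Longrightarrow> h x = 0"
  shows "(LINT x|lborel. partial_deriv i h x) = 0"
proof -
  define e :: "real^'d" where "e = axis i 1"
  have hc: "continuous_on UNIV h"
    using d by (intro continuous_at_imp_continuous_on) (auto intro: differentiable_imp_continuous_within)
  have [measurable]: "h \<in> borel_measurable borel" using hc by (rule borel_measurable_continuous_onI)
  have [measurable]: "partial_deriv i h \<in> borel_measurable borel" using c by (rule borel_measurable_continuous_onI)
  have hint: "integrable lborel h"
    using K hc by (intro integrable_compact_support[of K]) (auto intro: continuous_on_subset)
  have K': "partial_deriv i h x = 0" if "x \<notin> K" for x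
    using partial_derivs_eq_0[where s="[i]", OF K that] by simp
  obtain B where B: "B \<ge> 0" "\<And>x. \<bar>partial_deriv i h x\<bar> \<le> B"
  proof -
    have "bounded (partial_deriv i h ` K)"
      using K(1) c by (intro compact_imp_bounded compact_continuous_image) (auto intro: continuous_on_subset)
    then obtain B where "\<And>x. x \<in> K \<Longrightarrow> \<bar>partial_deriv i h x\<bar> \<le> B" by (auto simp: bounded_iff)
    then have "\<bar>partial_deriv i h x\<bar> \<le> max B 0" for x using K'[of x] by (cases "x \<in> K") force+
    then show ?thesis using that[of "max B 0"] by auto
  qed
  obtain R where R: "K \<subseteq> cball 0 R" using bounded_subset_ballD[OF compact_imp_bounded[OF K(1)], of 0] ball_subset_cball by blast
  have line: "((\<lambda>t. h (x + t *\<^sub>R e)) has_real_derivative partial_deriv i h (x + s *\<^sub>R e)) (at s)" for x s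
    using partial_deriv_has_derivative_line[where x=x and s=s and i=i, OF d]
    by (simp add: e_def has_real_derivative_iff_has_vector_derivative)
  have lip: "\<bar>h (x + t *\<^sub>R e) - h x\<bar> \<le> B * t" if t: "t > 0" for x t
  proof -
    obtain z where "h (x + t *\<^sub>R e) - h (x + 0 *\<^sub>R e) = (t - 0) * partial_deriv i h (x + z *\<^sub>R e)"
      using MVT2[of 0 t "\<lambda>t. h (x + t *\<^sub>R e)" "\<lambda>s. partial_deriv i h (x + s *\<^sub>R e)"] line t by blast
    then show ?thesis using B(2)[of "x + z *\<^sub>R e"] t by (simp add: abs_mult mult.commute)
  qed
  define t where "t n = inverse (real (Suc n))" for n
  have t: "t n > 0" "t n \<le> 1" for n by (auto simp: t_def field_simps)
  define D where "D n x = (h (x + t n *\<^sub>R e) - h x) / t n" for n x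
  have [measurable]: "D n \<in> borel_measurable borel" for n unfolding D_def by measurable
  have "(\<lambda>n. LINT x|lborel. D n x) \<longlonglongrightarrow> (LINT x|lborel. partial_deriv i h x)"
  proof (rule integral_dominated_convergence)
    \<comment> \<open>The steps have length at most 1 and K lies in the ball of radius R, so all
      difference quotients vanish outside the ball of radius R + 1; inside, the mean value theorem
      bounds them by B.\<close>
    show "integrable lborel (\<lambda>x. B * indicator (cball (0::real^'d) (R + 1)) x)"
      by (intro integrable_mult_right integrable_real_indicator emeasure_bounded_finite) auto
    show "AE x in lborel. (\<lambda>n. D n x) \<longlonglongrightarrow> partial_deriv i h x"
    proof (rule AE_I2)
      fix x :: "real^'d"
      have "((\<lambda>s. (h (x + s *\<^sub>R e) - h x) / s) \<longlongrightarrow> partial_deriv i h x) (at 0)"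
        using line[of x 0] by (simp add: DERIV_def)
      moreover have "filterlim t (at 0) sequentially"
        unfolding t_def filterlim_at using LIMSEQ_inverse_real_of_nat by auto
      ultimately show "(\<lambda>n. D n x) \<longlonglongrightarrow> partial_deriv i h x" unfolding D_def by (rule filterlim_compose)
    qed
    show "AE x in lborel. norm (D n x) \<le> B * indicator (cball (0::real^'d) (R + 1)) x" for n
    proof (rule AE_I2)
      fix x :: "real^'d"
      show "norm (D n x) \<le> B * indicator (cball (0::real^'d) (R + 1)) x"
      proof (cases "x \<in> cball 0 (R + 1)")
        case True
        then show ?thesis using lip[OF t(1), of x n] t(1)[of n] by (simp add: D_def field_simps)
      next
        case False
        have "norm x \<le> norm (x + t n *\<^sub>R e) + norm (t n *\<^sub>R e)" by (metis norm_triangle_ineq4 add_diff_cancel_right')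
        also have "norm (t n *\<^sub>R e) \<le> 1" using t[of n] by (simp add: e_def)
        finally have "x + t n *\<^sub>R e \<notin> cball 0 R" "x \<notin> cball 0 R" using False by auto
        then have "x + t n *\<^sub>R e \<notin> K" "x \<notin> K" using R by auto
        then show ?thesis using K(2) B(1) by (simp add: D_def)
      qed
    qed
  qed measurable
  moreover have "(LINT x|lborel. D n x) = 0" for n
  proof -
    have i1: "integrable lborel (\<lambda>x. h (t n *\<^sub>R e + x))"
      using hint by (subst (asm) lborel_distr_plus[of "t n *\<^sub>R e", symmetric]) (simp add: integrable_distr_eq)
    have "(LINT x|lborel. D n x) = ((LINT x|lborel. h (t n *\<^sub>R e + x)) - (LINT x|lborel. h x)) / t n"
      unfolding D_def using i1 hint by (simp add: add.commute)
    then show ?thesis by (simp add: lborel_integral_translation)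
  qed
  ultimately show ?thesis by (simp add: LIMSEQ_const_iff)
qed

lemma integration_by_parts:
  fixes g u :: "real^'d \<Rightarrow> real^'m"
  assumes g: "Ck_on 1 UNIV g" and u: "Ck_on 1 UNIV u" and K: "compact K" "\<And>x. x \<notin> K \<Longrightarrow> u x = 0"
  shows "(LINT x|lborel. partial_deriv i g x \<bullet> u x) = - (LINT x|lborel. g x \<bullet> partial_deriv i u x)"
proof -
  have gd: "g differentiable (at x)" and ud: "u differentiable (at x)" for x
    using g u by (auto simp: Ck_on_Suc)
  have c: "continuous_on UNIV g" "continuous_on UNIV u" "continuous_on UNIV (partial_deriv i g)" "continuous_on UNIV (partial_deriv i u)"
    using g u by (auto simp: Ck_on_Suc Ck_on_0)
  note pb = partial_deriv_bilinear[OF bounded_bilinear_inner gd ud]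
  have K': "partial_deriv i u x = 0" if "x \<notin> K" for x
    using partial_derivs_eq_0[where s="[i]", OF K that] by simp
  have "0 = (LINT x|lborel. partial_deriv i (\<lambda>x. g x \<bullet> u x) x)"
    using K by (intro integral_partial_deriv_eq_0[symmetric, of _ _ K] pb(2)) (auto simp: pb(1) intro!: continuous_intros c)
  also have "\<dots> = (LINT x|lborel. g x \<bullet> partial_deriv i u x + partial_deriv i g x \<bullet> u x)"
    by (simp add: pb(1))
  also have "\<dots> = (LINT x|lborel. g x \<bullet> partial_deriv i u x) + (LINT x|lborel. partial_deriv i g x \<bullet> u x)"
    using K K' by (intro Bochner_Integration.integral_add integrable_compact_support[of K])
      (auto intro!: continuous_intros continuous_on_subset[OF c(1)] continuous_on_subset[OF c(2)] continuous_on_subset[OF c(3)]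
        continuous_on_subset[OF c(4)])
  finally show ?thesis by simp
qed

text \<open>The outermost derivative of g is moved first and becomes the innermost one of u, so the
  list arrives reversed, with one sign per entry.\<close>

lemma integration_by_parts_list:
  fixes g u :: "real^'d \<Rightarrow> real^'m"
  assumes "Ck_on (length s) UNIV g" "Ck_on (length s) UNIV u" and K: "compact K" "\<And>x. x \<notin> K \<Longrightarrow> u x = 0"
  shows "(LINT x|lborel. partial_derivs s g x \<bullet> u x) = (- 1) ^ length s * (LINT x|lborel. g x \<bullet> partial_derivs (rev s) u x)"
  using assms(1,2,4)
proof (induction s arbitrary: u)
  case (Cons i s)
  have "(LINT x|lborel. partial_derivs (i # s) g x \<bullet> u x) = - (LINT x|lborel. partial_derivs s g x \<bullet> partial_deriv i u x)"
    unfolding partial_derivs.simps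
  proof (rule integration_by_parts[OF _ _ K(1) Cons.prems(3)])
    show "Ck_on 1 UNIV (partial_derivs s g)"
      using Cons.prems(1) by (intro Ck_on_partial_derivs) simp
    show "Ck_on 1 UNIV u" using Cons.prems(2) by (rule Ck_on_mono) simp
  qed
  also have "(LINT x|lborel. partial_derivs s g x \<bullet> partial_deriv i u x) =
     (- 1) ^ length s * (LINT x|lborel. g x \<bullet> partial_derivs (rev s) (partial_deriv i u) x)"
  proof (rule Cons.IH)
    show "Ck_on (length s) UNIV g" using Cons.prems(1) by (rule Ck_on_mono) simp
    show "Ck_on (length s) UNIV (partial_deriv i u)" using Cons.prems(2) by (simp add: Ck_on_Suc)
    show "partial_deriv i u x = 0" if "x \<notin> K" for x
      using partial_derivs_eq_0[where s="[i]", OF K(1) Cons.prems(3) that] by simp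
  qed
  finally show ?case by (simp add: partial_derivs_append)
qed simp

section \<open>Test functions and the graph of the operator\<close>

lemma L1_lborelI:
  fixes g :: "real^'d \<Rightarrow> real^'m"
  assumes "\<Omega> \<in> sets lebesgue" "integrable lborel g" shows "g \<in> L1 \<Omega>"
proof -
  have "integrable lebesgue g" using assms(2) by (simp add: integrable_completion)
  then have "integrable lebesgue (\<lambda>x. indicator \<Omega> x *\<^sub>R g x)"
    using assms(1) by (intro integrable_mult_indicator)
  then show ?thesis using assms(1) by (simp add: L1_def integrable_restrict_space)
qed

lemma integral_lebesgue_on_eq_lborel:
  fixes g :: "real^'d \<Rightarrow> 'b::{banach, second_countable_topology}"
  assumes "\<Omega> \<in> sets lebesgue" "g \<in> borel_measurable borel" "\<And>x. x \<notin> \<Omega> \<Longrightarrow> g x = 0"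
  shows "integral\<^sup>L (lebesgue_on \<Omega>) g = integral\<^sup>L lborel g"
proof -
  have "(\<lambda>x. indicator \<Omega> x *\<^sub>R g x) = g" using assms(3) by (auto simp: fun_eq_iff indicator_def)
  then show ?thesis using assms(1,2) by (simp add: integral_restrict_space integral_completion)
qed

lemma borel_measurable_lebesgue_onI:
  fixes g :: "real^'d \<Rightarrow> 'b::topological_space"
  shows "g \<in> borel_measurable borel \<Longrightarrow> g \<in> borel_measurable (lebesgue_on \<Omega>)"
  by (intro measurable_restrict_space1 measurable_completion) simp

lemma Linf_compact_support:
  fixes g :: "real^'d \<Rightarrow> real^'m"
  assumes "continuous_on UNIV g" "compact K" "\<And>x. x \<notin> K \<Longrightarrow> g x = 0"
  shows "g \<in> Linf \<Omega>"
proof -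
  have "bounded (g ` K)"
    using assms by (intro compact_imp_bounded compact_continuous_image) (auto intro: continuous_on_subset)
  then obtain B where "\<And>x. x \<in> K \<Longrightarrow> norm (g x) \<le> B" by (auto simp: bounded_iff)
  then have "norm (g x) \<le> max B 0" for x using assms(3)[of x] by (cases "x \<in> K") force+
  then show ?thesis
    using borel_measurable_lebesgue_onI[OF borel_measurable_continuous_onI[OF assms(1)]] unfolding Linf_def by blast
qed

lemma test_functionsD:
  assumes "\<phi> \<in> test_functions \<Omega>"
  obtains K where "compact K" "K \<subseteq> \<Omega>" "\<And>x. x \<notin> K \<Longrightarrow> \<phi> x = 0" "\<And>k. Ck_on k UNIV \<phi>"
  using assms unfolding test_functions_def by blast

lemma test_function_Linf:
  assumes "\<phi> \<in> test_functions \<Omega>" shows "\<phi> \<in> Linf \<Omega>"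
proof -
  obtain K where K: "compact K" "\<And>x. x \<notin> K \<Longrightarrow> \<phi> x = 0" "\<And>k. Ck_on k UNIV \<phi>"
    using assms by (rule test_functionsD) blast
  show ?thesis by (rule Linf_compact_support[OF continuous_on_Ck[OF K(3)] K(1,2)])
qed

lemma test_function_L1:
  assumes "\<Omega> \<in> sets lebesgue" "\<phi> \<in> test_functions \<Omega>" shows "\<phi> \<in> L1 \<Omega>"
proof -
  obtain K where K: "compact K" "\<And>x. x \<notin> K \<Longrightarrow> \<phi> x = 0" "\<And>k. Ck_on k UNIV \<phi>"
    using assms(2) by (rule test_functionsD) blast
  have "continuous_on K \<phi>" using continuous_on_Ck[OF K(3)] by (rule continuous_on_subset) simp
  then show ?thesis by (intro L1_lborelI[OF assms(1)] integrable_compact_support[OF K(1) _ K(2)])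
qed

lemma open_in_lebesgue: "open \<Omega> \<Longrightarrow> \<Omega> \<in> sets lebesgue" for \<Omega> :: "(real^'d) set"
  by (intro sets_completionI_sets) simp

lemma bounded_bilinear_transpose_mult: "bounded_bilinear (\<lambda>(M::real^'N^'n) v. transpose M *v v)"
  unfolding bilinear_conv_bounded_bilinear[symmetric] bilinear_def
  by (auto intro!: linearI simp: vec_eq_iff matrix_vector_mult_def transpose_def sum.distrib sum_distrib_left algebra_simps
      simp del: transpose_matrix_vector)

lemma bounded_bilinear_mult_vec: "bounded_bilinear (\<lambda>(M::real^'N^'n) v. M *v v)"
  unfolding bilinear_conv_bounded_bilinear[symmetric] bilinear_def
  by (auto intro!: linearI simp: vec_eq_iff matrix_vector_mult_def sum.distrib sum_distrib_left algebra_simps)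

locale diff_operator =
  fixes \<Omega> :: "(real^'d::finite) set" and k :: nat and A :: "('d::finite, 'N::finite, 'n::finite) coefficients"
  assumes open_\<Omega>: "open \<Omega>" and adm: "admissible_coefficients \<Omega> k A"
begin

lemma Ck_on_adjoint_term:
  assumes "\<phi> \<in> test_functions \<Omega>" "length s \<le> k"
  shows "Ck_on (length s) UNIV (\<lambda>y. transpose (A s y) *v \<phi> y)"
proof -
  obtain K where K: "compact K" "K \<subseteq> \<Omega>" "\<And>x. x \<notin> K \<Longrightarrow> \<phi> x = 0" "\<And>k. Ck_on k UNIV \<phi>"
    using assms(1) by (rule test_functionsD) blast
  have "Ck_on (length s) \<Omega> (A s)" using adm assms(2) by (auto simp: admissible_coefficients_def)
  moreover have "Ck_on (length s) \<Omega> \<phi>"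
    using K(4)[of "length s"] unfolding Ck_on_def by (auto intro: continuous_on_subset)
  ultimately have "Ck_on (length s) \<Omega> (\<lambda>y. transpose (A s y) *v \<phi> y)"
    by (rule Ck_on_bilinear[OF bounded_bilinear_transpose_mult open_\<Omega>])
  then show ?thesis
    using K(3) by (intro Ck_on_extend_zero[OF open_\<Omega> K(1,2)]) auto
qed

lemma formal_adjoint_continuous_support:
  assumes "\<phi> \<in> test_functions \<Omega>"
  shows "continuous_on UNIV (formal_adjoint k A \<phi>)"
    "compact K \<Longrightarrow> (\<And>x. x \<notin> K \<Longrightarrow> \<phi> x = 0) \<Longrightarrow> x \<notin> K \<Longrightarrow> formal_adjoint k A \<phi> x = 0"
proof -
  show "continuous_on UNIV (formal_adjoint k A \<phi>)"
    unfolding formal_adjoint_def[abs_def]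
    using Ck_on_adjoint_term[OF assms]
    by (intro continuous_on_sum continuous_on_scaleR continuous_on_const)
       (auto intro: Ck_on_continuous_partial_derivs simp del: transpose_matrix_vector)
  show "formal_adjoint k A \<phi> x = 0" if "compact K" "\<And>x. x \<notin> K \<Longrightarrow> \<phi> x = 0" "x \<notin> K"
    unfolding formal_adjoint_def
  proof (intro sum.neutral ballI)
    fix s
    have "partial_derivs s (\<lambda>y. transpose (A s y) *v \<phi> y) x = 0"
      using that by (intro partial_derivs_eq_0[of K]) auto
    then show "(- 1) ^ length s *\<^sub>R partial_derivs s (\<lambda>y. transpose (A s y) *v \<phi> y) x = 0"
      by (simp del: transpose_matrix_vector)
  qed
qed

lemma formal_adjoint_Linf:
  assumes "\<phi> \<in> test_functions \<Omega>" shows "formal_adjoint k A \<phi> \<in> Linf \<Omega>"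
proof -
  obtain K where K: "compact K" "\<And>x. x \<notin> K \<Longrightarrow> \<phi> x = 0"
    using assms by (rule test_functionsD) blast
  show ?thesis
    using formal_adjoint_continuous_support(1)[OF assms] K(1) formal_adjoint_continuous_support(2)[OF assms K]
    by (rule Linf_compact_support)
qed

definition op_graph :: "((real^'d \<Rightarrow> real^'N) \<times> (real^'d \<Rightarrow> real^'n)) set" where
  "op_graph = {(u, p). u \<in> L1 \<Omega> \<and> p \<in> L1 \<Omega> \<and> has_distributional_image \<Omega> k A u p}"

text \<open>For a smooth field of compact support the operator is evaluated classically, and
  integration by parts identifies this value with the distributional image. The value is bounded
  with compact support, hence integrable.\<close>

lemma test_function_in_op_graph:
  assumes u: "u \<in> test_functions \<Omega>"
  shows "\<exists>p. (u, p) \<in> op_graph"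
proof -
  have \<Omega>[measurable]: "\<Omega> \<in> sets lebesgue" using open_\<Omega> by (rule open_in_lebesgue)
  obtain K where K: "compact K" "K \<subseteq> \<Omega>" "\<And>x. x \<notin> K \<Longrightarrow> u x = 0" "\<And>k. Ck_on k UNIV u"
    using u by (rule test_functionsD) blast
  let ?I = "{s :: 'd list. length s \<le> k}"
  \<comment> \<open>The reversed list is the order in which integration by parts hands the
    derivatives to u.\<close>
  define q where "q s x = A s x *v partial_derivs (rev s) u x" for s x
  define p where "p x = (\<Sum>s\<in>?I. q s x)" for x
  have q0: "q s x = 0" if "x \<notin> K" for s x
    using partial_derivs_eq_0[OF K(1,3) that] by (simp add: q_def)
  \<comment> \<open>The coefficients are continuous inside \<Omega> only; continuity on the compact
    support is what \<open>integrable_compact_support\<close> asks for.\<close>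
  have qc: "continuous_on K (q s)" if "s \<in> ?I" for s
  proof -
    have "Ck_on (length s) \<Omega> (A s)" using adm that by (auto simp: admissible_coefficients_def)
    then have "continuous_on K (A s)" using K(2) by (auto intro: continuous_on_subset dest: continuous_on_Ck)
    moreover have "continuous_on K (partial_derivs (rev s) u)"
      using Ck_on_continuous_partial_derivs[OF K(4)[of "length s"], of "rev s"] by (auto intro: continuous_on_subset)
    ultimately show ?thesis unfolding q_def[abs_def]
      by (rule bounded_bilinear.continuous_on[OF bounded_bilinear_mult_vec])
  qed
  have pc: "continuous_on K p" unfolding p_def[abs_def] by (intro continuous_on_sum qc)
  have p0: "p x = 0" if "x \<notin> K" for x using q0[OF that] by (simp add: p_def)
  have pi: "integrable lborel p" by (rule integrable_compact_support[OF K(1) pc p0])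
  have uc: "continuous_on UNIV u" using K(4) by (rule continuous_on_Ck)
  have u0: "u x = 0" and p0': "p x = 0" if "x \<notin> \<Omega>" for x
    using that K(2,3) p0 by blast+
  have "has_distributional_image \<Omega> k A u p"
    unfolding has_distributional_image_def
  proof
    fix \<phi> :: "real^'d \<Rightarrow> real^'n" assume \<phi>: "\<phi> \<in> test_functions \<Omega>"
    define g where "g s y = transpose (A s y) *v \<phi> y" for s y
    have g: "Ck_on (length s) UNIV (g s)" if "s \<in> ?I" for s
      using Ck_on_adjoint_term[OF \<phi>, of s] that unfolding g_def[abs_def] by blast
    have \<phi>c: "continuous_on UNIV \<phi>" using \<phi> by (rule test_functionsD) (blast intro: continuous_on_Ck)
    have fa: "formal_adjoint k A \<phi> x = (\<Sum>s\<in>?I. (- 1) ^ length s *\<^sub>R partial_derivs s (g s) x)" for x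
      unfolding formal_adjoint_def g_def[abs_def] by (rule refl)
    have fac: "continuous_on UNIV (formal_adjoint k A \<phi>)"
      by (rule formal_adjoint_continuous_support(1)[OF \<phi>])
    have [measurable]: "u \<in> borel_measurable borel" "\<phi> \<in> borel_measurable borel" "formal_adjoint k A \<phi> \<in> borel_measurable borel"
      using uc \<phi>c fac by (auto intro: borel_measurable_continuous_onI)
    have [measurable]: "p \<in> borel_measurable borel" using borel_measurable_integrable[OF pi] by simp
    have "pairing \<Omega> (formal_adjoint k A \<phi>) u = (LINT x|lborel. formal_adjoint k A \<phi> x \<bullet> u x)"
      unfolding pairing_def using u0 by (intro integral_lebesgue_on_eq_lborel[OF \<Omega>]) simp_all
    also have "\<dots> = (LINT x|lborel. (\<Sum>s\<in>?I. (- 1) ^ length s * (partial_derivs s (g s) x \<bullet> u x)))"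
      unfolding fa by (simp add: inner_sum_left)
    also have "\<dots> = (\<Sum>s\<in>?I. (LINT x|lborel. (- 1) ^ length s * (partial_derivs s (g s) x \<bullet> u x)))"
    proof (rule Bochner_Integration.integral_sum)
      fix s assume s: "s \<in> ?I"
      have "continuous_on UNIV (partial_derivs s (g s))"
        using g[OF s] by (rule Ck_on_continuous_partial_derivs) simp
      then have "continuous_on K (\<lambda>x. (- 1) ^ length s * (partial_derivs s (g s) x \<bullet> u x))"
        using uc by (intro continuous_intros) (auto intro: continuous_on_subset)
      then show "integrable lborel (\<lambda>x. (- 1) ^ length s * (partial_derivs s (g s) x \<bullet> u x))"
        using K(3) by (intro integrable_compact_support[OF K(1)]) auto
    qed
    also have "\<dots> = (\<Sum>s\<in>?I. (LINT x|lborel. \<phi> x \<bullet> q s x))"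
    proof (rule sum.cong[OF refl])
      fix s assume s: "s \<in> ?I"
      have "(LINT x|lborel. (- 1) ^ length s * (partial_derivs s (g s) x \<bullet> u x)) =
          (- 1) ^ length s * (LINT x|lborel. partial_derivs s (g s) x \<bullet> u x)" by simp
      also have "\<dots> = (- 1) ^ length s * ((- 1) ^ length s * (LINT x|lborel. g s x \<bullet> partial_derivs (rev s) u x))"
        by (rule arg_cong[OF integration_by_parts_list[OF g[OF s] K(4) K(1,3)]])
      also have "\<dots> = (LINT x|lborel. g s x \<bullet> partial_derivs (rev s) u x)"
        by (simp add: mult.assoc[symmetric] power_mult_distrib[symmetric])
      also have "\<dots> = (LINT x|lborel. \<phi> x \<bullet> q s x)"
        by (simp add: g_def q_def dot_lmul_matrix)
      finally show "(LINT x|lborel. (- 1) ^ length s * (partial_derivs s (g s) x \<bullet> u x)) = (LINT x|lborel. \<phi> x \<bullet> q s x)" .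
    qed
    also have "\<dots> = (LINT x|lborel. (\<Sum>s\<in>?I. \<phi> x \<bullet> q s x))"
    proof (rule Bochner_Integration.integral_sum[symmetric])
      fix s assume s: "s \<in> ?I"
      have "continuous_on K (\<lambda>x. \<phi> x \<bullet> q s x)"
        using \<phi>c qc[OF s] by (intro continuous_intros) (auto intro: continuous_on_subset)
      then show "integrable lborel (\<lambda>x. \<phi> x \<bullet> q s x)"
        using q0 by (intro integrable_compact_support[OF K(1)]) auto
    qed
    also have "\<dots> = (LINT x|lborel. \<phi> x \<bullet> p x)" by (simp add: p_def inner_sum_right)
    also have "\<dots> = pairing \<Omega> \<phi> p"
      unfolding pairing_def using p0' by (intro integral_lebesgue_on_eq_lborel[OF \<Omega>, symmetric]) simp_all
    finally show "pairing \<Omega> (formal_adjoint k A \<phi>) u = pairing \<Omega> \<phi> p" .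
  qed
  then show ?thesis
    using test_function_L1[OF \<Omega> u] L1_lborelI[OF \<Omega> pi] unfolding op_graph_def by blast
qed

lemma subspace_op_graph: "subspace op_graph"
proof (rule subspaceI)
  note L = subspace_L1
  show "0 \<in> op_graph"
    by (auto simp: op_graph_def zero_prod_def subspace_0[OF L] has_distributional_image_def pairing_def)
  show "x + y \<in> op_graph" if "x \<in> op_graph" "y \<in> op_graph" for x y
    using that
    by (auto simp: op_graph_def has_distributional_image_def pairing_add subspace_add[OF L] test_function_Linf
        formal_adjoint_Linf)
  show "c *\<^sub>R x \<in> op_graph" if "x \<in> op_graph" for x c
    using that
    by (auto simp: op_graph_def has_distributional_image_def pairing_scaleR subspace_scale[OF L])
qed

text \<open>For a fixed test function both sides of the defining identity are pairings with fixed
  bounded fields, hence continuous under L^1 convergence of u and of p.\<close>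

lemma op_graph_closed:
  assumes up: "\<And>n. (us n, ps n) \<in> op_graph" and u: "u \<in> L1 \<Omega>" and p: "p \<in> L1 \<Omega>"
    and lim: "(\<lambda>n. L1_norm \<Omega> (u - us n)) \<longlonglongrightarrow> 0" "(\<lambda>n. L1_norm \<Omega> (p - ps n)) \<longlonglongrightarrow> 0"
  shows "(u, p) \<in> op_graph"
proof -
  have tend: "(\<lambda>n. pairing \<Omega> w (vs n)) \<longlonglongrightarrow> pairing \<Omega> w v"
    if w: "w \<in> Linf \<Omega>" and vs: "\<And>n. vs n \<in> L1 \<Omega>" and v: "v \<in> L1 \<Omega>" and l: "(\<lambda>n. L1_norm \<Omega> (v - vs n)) \<longlonglongrightarrow> 0"
    for w v :: "real^'d \<Rightarrow> real^'q" and vs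
  proof -
    obtain C where C: "C \<ge> 0" "\<And>u. u \<in> L1 \<Omega> \<Longrightarrow> \<bar>pairing \<Omega> w u\<bar> \<le> C * L1_norm \<Omega> u" using pairing_bound[OF w] by blast
    have "(\<lambda>n. pairing \<Omega> w v - pairing \<Omega> w (vs n)) \<longlonglongrightarrow> 0"
    proof (rule Lim_null_comparison)
      show "(\<lambda>n. C * L1_norm \<Omega> (v - vs n)) \<longlonglongrightarrow> 0" using l by (rule tendsto_mult_right_zero)
      show "\<forall>\<^sub>F n in sequentially. norm (pairing \<Omega> w v - pairing \<Omega> w (vs n)) \<le> C * L1_norm \<Omega> (v - vs n)"
        using C(2)[OF subspace_diff[OF subspace_L1 v vs]] pairing_diff[OF w v vs] by (auto intro!: always_eventually)
    qed
    then have "(\<lambda>n. pairing \<Omega> w v - (pairing \<Omega> w v - pairing \<Omega> w (vs n))) \<longlonglongrightarrow> pairing \<Omega> w v - 0"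
      by (intro tendsto_intros)
    then show ?thesis by simp
  qed
  have "pairing \<Omega> (formal_adjoint k A \<phi>) u = pairing \<Omega> \<phi> p" if \<phi>: "\<phi> \<in> test_functions \<Omega>" for \<phi>
  proof (rule LIMSEQ_unique)
    show "(\<lambda>n. pairing \<Omega> (formal_adjoint k A \<phi>) (us n)) \<longlonglongrightarrow> pairing \<Omega> (formal_adjoint k A \<phi>) u"
      using up u lim by (intro tend formal_adjoint_Linf[OF \<phi>]) (auto simp: op_graph_def)
    have "(\<lambda>n. pairing \<Omega> \<phi> (ps n)) \<longlonglongrightarrow> pairing \<Omega> \<phi> p"
      using up p lim by (intro tend test_function_Linf[OF \<phi>]) (auto simp: op_graph_def)
    then show "(\<lambda>n. pairing \<Omega> (formal_adjoint k A \<phi>) (us n)) \<longlonglongrightarrow> pairing \<Omega> \<phi> p"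
      using up \<phi> by (simp add: op_graph_def has_distributional_image_def)
  qed
  then show ?thesis using u p by (auto simp: op_graph_def has_distributional_image_def)
qed

end

text \<open>A monotone class argument: the bumps give indicators of boxes, Dynkin's lemma those of Borel
  subsets of a box, and a countable cover by boxes the rest.\<close>

theorem indicators_in_bounded_closure:
  fixes S :: "(real^'d \<Rightarrow> real^'m) set"
  assumes \<Omega>: "open \<Omega>" and test: "test_functions \<Omega> \<subseteq> S"
    and add: "\<And>f g. f \<in> S \<Longrightarrow> g \<in> S \<Longrightarrow> (\<lambda>x. f x + g x) \<in> S"
    and scale: "\<And>f c. f \<in> S \<Longrightarrow> (\<lambda>x. c *\<^sub>R f x) \<in> S"
    and ae: "\<And>f g. f \<in> S \<Longrightarrow> g \<in> borel_measurable lebesgue \<Longrightarrow> AE x in lebesgue. f x = g x \<Longrightarrow> g \<in> S"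
    and lim: "\<And>s f C E. (\<And>n. s n \<in> S) \<Longrightarrow> (\<And>x. (\<lambda>n. s n x) \<longlonglongrightarrow> f x) \<Longrightarrow> E \<in> sets borel \<Longrightarrow>
        emeasure lborel E < \<infinity> \<Longrightarrow> (\<And>n x. norm (s n x) \<le> C * indicator E x) \<Longrightarrow> f \<in> S"
    and B: "B \<in> sets lebesgue" "B \<subseteq> \<Omega>" "emeasure lebesgue B < \<infinity>"
  shows "(\<lambda>x. indicator B x *\<^sub>R v) \<in> S"
proof -
  have box: "(\<lambda>x. indicator (box a b) x *\<^sub>R v) \<in> S" if "cbox a b \<subseteq> \<Omega>" for a b
  proof (rule lim)
    show "(\<lambda>x. box_bump a b n x *\<^sub>R v) \<in> S" for n using test test_function_box_bump[OF that] by blast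
    show "(\<lambda>n. box_bump a b n x *\<^sub>R v) \<longlonglongrightarrow> indicator (box a b) x *\<^sub>R v" for x
      by (intro tendsto_scaleR box_bump_tendsto tendsto_const)
    show "box a b \<in> sets borel" by simp
    show "emeasure lborel (box a b) < \<infinity>" by (rule emeasure_bounded_finite) (rule bounded_box)
    show "norm (box_bump a b n x *\<^sub>R v) \<le> norm v * indicator (box a b) x" for n x
      using box_bump_bounds[of a b n x] box_bump_outside[of x a b n]
      by (cases "x \<in> box a b") (auto intro: mult_left_le_one_le)
  qed
  have sum: "(\<lambda>x. \<Sum>i<n. f i x) \<in> S" if "\<And>i. f i \<in> S" for f and n :: nat
  proof (induction n)
    case 0
    then show ?case using scale[OF that[of 0], of 0] by simp
  next
    case (Suc n)
    then show ?case using add[OF Suc that[of n]] by simp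
  qed
  \<comment> \<open>Intersecting with a fixed box keeps all partial sums below one indicator of
    finite measure, as \<open>lim\<close> demands.\<close>
  have inbox: "(\<lambda>x. indicator (B \<inter> box a b) x *\<^sub>R v) \<in> S" if ab: "cbox a b \<subseteq> \<Omega>" and B: "B \<in> sets borel" for a b B
  proof -
    have "B \<in> sigma_sets UNIV (range (\<lambda>(a, b). box a b :: (real^'d) set))"
      using B by (simp add: borel_eq_box)
    then show ?thesis
    proof (rule sigma_sets_induct_disjoint[rotated 2])
      show "Int_stable (range (\<lambda>(a, b). box a b :: (real^'d) set))"
        by (auto simp: Int_stable_def box_Int_box)
    next
      fix D assume "D \<in> range (\<lambda>(a, b). box a b :: (real^'d) set)"
      then obtain c d where D: "D = box c d" by auto
      have "D \<inter> box a b = box (\<chi> i. max (c $ i) (a $ i)) (\<chi> i. min (d $ i) (b $ i))"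
        unfolding D by (auto simp: mem_box_cart)
      moreover have "cbox (\<chi> i. max (c $ i) (a $ i)) (\<chi> i. min (d $ i) (b $ i)) \<subseteq> cbox a b"
        by (auto simp: mem_box_cart)
      ultimately show "(\<lambda>x. indicator (D \<inter> box a b) x *\<^sub>R v) \<in> S" using box ab by auto
    next
      show "(\<lambda>x. indicator ({} \<inter> box a b) x *\<^sub>R v) \<in> S" using scale[OF box[OF ab], of 0] by simp
    next
      fix D assume D: "(\<lambda>x. indicator (D \<inter> box a b) x *\<^sub>R v) \<in> S"
      have "(\<lambda>x. indicator (box a b) x *\<^sub>R v + (-1) *\<^sub>R (indicator (D \<inter> box a b) x *\<^sub>R v)) \<in> S"
        by (intro add scale box ab D)
      also have "(\<lambda>x. indicator (box a b) x *\<^sub>R v + (-1) *\<^sub>R (indicator (D \<inter> box a b) x *\<^sub>R v)) =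
         (\<lambda>x. indicator ((UNIV - D) \<inter> box a b) x *\<^sub>R v)"
        by (auto simp: fun_eq_iff indicator_def)
      finally show "(\<lambda>x. indicator ((UNIV - D) \<inter> box a b) x *\<^sub>R v) \<in> S" .
    next
      fix D :: "nat \<Rightarrow> (real^'d) set" assume D: "disjoint_family D" "\<And>i. (\<lambda>x. indicator (D i \<inter> box a b) x *\<^sub>R v) \<in> S"
      have ind: "(\<Sum>i<n. indicator (D i \<inter> box a b) x) = (indicator ((\<Union>i<n. D i) \<inter> box a b) x :: real)" for n x
      proof -
        have "(\<Union>i<n. D i) \<inter> box a b = (\<Union>i\<in>{..<n}. D i \<inter> box a b)" by auto
        moreover have "disjoint_family_on (\<lambda>i. D i \<inter> box a b) {..<n}" using D(1) by (auto simp: disjoint_family_on_def)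
        ultimately show ?thesis
          by (simp only: indicator_UN_disjoint[OF finite_lessThan])
      qed
      show "(\<lambda>x. indicator ((\<Union>i. D i) \<inter> box a b) x *\<^sub>R v) \<in> S"
      proof (rule lim)
        show "(\<lambda>x. \<Sum>i<n. indicator (D i \<inter> box a b) x *\<^sub>R v) \<in> S" for n using D(2) by (rule sum)
        show "(\<lambda>n. \<Sum>i<n. indicator (D i \<inter> box a b) x *\<^sub>R v) \<longlonglongrightarrow> indicator ((\<Union>i. D i) \<inter> box a b) x *\<^sub>R v" for x
        proof -
          have "(\<lambda>i. indicator (D i \<inter> box a b) x) sums (indicator (\<Union>i. D i \<inter> box a b) x :: real)"
            using D(1) by (intro indicator_sums) (auto simp: disjoint_family_on_def)
          moreover have "(\<Union>i. D i \<inter> box a b) = (\<Union>i. D i) \<inter> box a b" by auto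
          ultimately have "(\<lambda>n. \<Sum>i<n. indicator (D i \<inter> box a b) x) \<longlonglongrightarrow> (indicator ((\<Union>i. D i) \<inter> box a b) x :: real)"
            by (simp add: sums_def)
          then show ?thesis unfolding scaleR_sum_left[symmetric] by (intro tendsto_scaleR tendsto_const)
        qed
        show "box a b \<in> sets borel" by simp
        show "emeasure lborel (box a b) < \<infinity>" by (rule emeasure_bounded_finite) (rule bounded_box)
        show "norm (\<Sum>i<n. indicator (D i \<inter> box a b) x *\<^sub>R v) \<le> norm v * indicator (box a b) x" for n x
          unfolding scaleR_sum_left[symmetric] ind by (auto simp: indicator_def)
      qed
    qed auto
  qed
  define F where "F = {box a b | a b. cbox a b \<subseteq> \<Omega>}"
  have "\<Union>F = \<Omega>"
  proof
    show "\<Union>F \<subseteq> \<Omega>" unfolding F_def using box_subset_cbox by blast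
    show "\<Omega> \<subseteq> \<Union>F"
    proof
      fix x assume "x \<in> \<Omega>"
      then obtain a b where "cbox a b \<subseteq> \<Omega>" "x \<in> box a b" using open_contains_cbox[OF \<Omega>] by metis
      then show "x \<in> \<Union>F" unfolding F_def by blast
    qed
  qed
  moreover obtain F' where F': "F' \<subseteq> F" "countable F'" "\<Union>F' = \<Union>F"
    using Lindelof[of F] by (auto simp: F_def)
  \<comment> \<open>Adjoining the empty box makes the countable family nonempty, so that
    \<open>from_nat_into\<close> enumerates it.\<close>
  moreover have "{} \<in> F"
  proof -
    have "cbox 1 (0::real^'d) = {}" "box 1 (0::real^'d) = {}" by (auto simp: interval_eq_empty_cart)
    then show ?thesis unfolding F_def by (metis (mono_tags, lifting) mem_Collect_eq empty_subsetI)
  qed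
  ultimately have F'': "insert {} F' \<subseteq> F" "countable (insert {} F')" "\<Union>(insert {} F') = \<Omega>" by auto
  define Q where "Q = from_nat_into (insert {} F')"
  have rQ: "range Q = insert {} F'" unfolding Q_def using F''(2) by (intro range_from_nat_into) auto
  have QF: "Q n \<in> F" for n using subsetD[OF F''(1)] rangeI[of Q n] unfolding rQ by simp
  have QU: "(\<Union>n. Q n) = \<Omega>" using rQ F''(3) by auto
  have Qb: "Q n \<in> sets borel" for n using QF[of n] by (auto simp: F_def)
  have borel: "(\<lambda>x. indicator B x *\<^sub>R v) \<in> S" if B: "B \<in> sets borel" "B \<subseteq> \<Omega>" "emeasure lborel B < \<infinity>" for B
  proof -
    \<comment> \<open>The pieces are disjoint and each sits in a single box, where
      \<open>inbox\<close> applies.\<close>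
    define D where "D n = B \<inter> disjointed Q n" for n
    have Dd: "disjoint_family D" using disjoint_family_disjointed[of Q] by (auto simp: D_def disjoint_family_on_def)
    have DU: "(\<Union>n. D n) = B" using B(2) QU UN_disjointed_eq[of Q] by (auto simp: D_def)
    have DS: "(\<lambda>x. indicator (D n) x *\<^sub>R v) \<in> S" for n
    proof -
      obtain a b where ab: "Q n = box a b" "cbox a b \<subseteq> \<Omega>" using QF[of n] by (auto simp: F_def)
      have "D n = (B - (\<Union>i\<in>{0..<n}. Q i)) \<inter> box a b" by (auto simp: D_def disjointed_def ab(1))
      moreover have "B - (\<Union>i\<in>{0..<n}. Q i) \<in> sets borel" using B(1) Qb by auto
      ultimately show ?thesis using inbox[OF ab(2)] by simp
    qed
    show ?thesis
    proof (rule lim)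
      show "(\<lambda>x. \<Sum>i<n. indicator (D i) x *\<^sub>R v) \<in> S" for n using DS by (rule sum)
      show "(\<lambda>n. \<Sum>i<n. indicator (D i) x *\<^sub>R v) \<longlonglongrightarrow> indicator B x *\<^sub>R v" for x
      proof -
        have "(\<lambda>i. indicator (D i) x) sums (indicator (\<Union>i. D i) x :: real)"
          using Dd by (intro indicator_sums) (auto simp: disjoint_family_on_def)
        then have "(\<lambda>n. \<Sum>i<n. indicator (D i) x) \<longlonglongrightarrow> (indicator B x :: real)"
          by (simp add: sums_def DU)
        then show ?thesis unfolding scaleR_sum_left[symmetric] by (intro tendsto_scaleR tendsto_const)
      qed
      show "norm (\<Sum>i<n. indicator (D i) x *\<^sub>R v) \<le> norm v * indicator B x" for n x
      proof -
        have "(\<Sum>i<n. indicator (D i) x) = (indicator (\<Union>i<n. D i) x :: real)"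
          using Dd by (intro indicator_UN_disjoint[symmetric]) (auto simp: disjoint_family_on_def)
        then show ?thesis unfolding scaleR_sum_left[symmetric] using DU by (auto simp: indicator_def)
      qed
    qed (use B in auto)
  qed
  \<comment> \<open>A Lebesgue set is a Borel set up to a null set, which \<open>ae\<close>
    absorbs.\<close>
  let ?B = "main_part lborel B"
  have mn: "?B \<union> null_part lborel B = B" using B(1) by (rule main_part_null_part_Un)
  have mB: "?B \<in> sets borel" "?B \<subseteq> B"
    using main_part_sets[OF B(1)] mn by auto
  have "(\<lambda>x. indicator ?B x *\<^sub>R v) \<in> S"
    using mB B by (intro borel) (auto simp: emeasure_completion)
  moreover have "AE x in lebesgue. indicator ?B x *\<^sub>R v = indicator B x *\<^sub>R v"
  proof -
    have "AE x in lebesgue. x \<notin> null_part lborel B"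
      using AE_notin_null_part[of B lborel] B(1) by (simp add: AE_completion_iff)
    then show ?thesis
      by eventually_elim (use mn in \<open>auto simp: indicator_def\<close>)
  qed
  moreover have "(\<lambda>x. indicator B x *\<^sub>R v) \<in> borel_measurable lebesgue"
    using B(1) by (intro borel_measurable_scaleR borel_measurable_indicator borel_measurable_const)
  ultimately show ?thesis using ae by blast
qed

section \<open>Test functions separate and are dense in L^1\<close>

lemma AE_lebesgue_on_if: "\<Omega> \<in> sets lebesgue \<Longrightarrow> AE x in lebesgue. P x \<Longrightarrow> AE x in lebesgue_on \<Omega>. P x"
  by (subst AE_restrict_space_iff) (auto elim: eventually_mono)

text \<open>The fundamental lemma of the calculus of variations, which makes the image A u unique.
  The fields orthogonal to p contain the test functions and are closed under dominated limits, so
  they contain indicators of sets of finite measure; testing with the sets where a coordinate of p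
  has a given sign shows that these are null.\<close>

lemma test_functions_separate:
  fixes p :: "real^'d \<Rightarrow> real^'m"
  assumes \<Omega>: "open \<Omega>" and p: "p \<in> L1 \<Omega>" and zero: "\<And>\<phi>. \<phi> \<in> test_functions \<Omega> \<Longrightarrow> pairing \<Omega> \<phi> p = 0"
  shows "AE x in lebesgue_on \<Omega>. p x = 0"
proof -
  have \<Omega>s[measurable]: "\<Omega> \<in> sets lebesgue" using \<Omega> by (rule open_in_lebesgue)
  have [measurable]: "p \<in> borel_measurable (lebesgue_on \<Omega>)" using p by (auto simp: L1_def)
  have pn: "integrable (lebesgue_on \<Omega>) (\<lambda>x. norm (p x))" using p by (auto simp: L1_def)
  define S where "S = {g :: real^'d \<Rightarrow> real^'m. g \<in> borel_measurable lebesgue \<and>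
      integrable (lebesgue_on \<Omega>) (\<lambda>x. g x \<bullet> p x) \<and> pairing \<Omega> g p = 0}"
  have leb_on: "g \<in> borel_measurable (lebesgue_on \<Omega>)" if "g \<in> borel_measurable lebesgue" for g :: "real^'d \<Rightarrow> real^'m"
    using that by (rule measurable_restrict_space1)
  have S: "(\<lambda>x. indicator B x *\<^sub>R v) \<in> S"
    if B: "B \<in> sets lebesgue" "B \<subseteq> \<Omega>" "emeasure lebesgue B < \<infinity>" for B v
  proof (rule indicators_in_bounded_closure[OF \<Omega> _ _ _ _ _ B])
    show "test_functions \<Omega> \<subseteq> S"
    proof
      fix \<phi> :: "real^'d \<Rightarrow> real^'m" assume \<phi>: "\<phi> \<in> test_functions \<Omega>"
      have "\<phi> \<in> borel_measurable borel"
        using \<phi> by (rule test_functionsD) (blast intro: borel_measurable_continuous_onI continuous_on_Ck)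
      then have "\<phi> \<in> borel_measurable lebesgue" by (intro measurable_completion) simp
      then show "\<phi> \<in> S" using zero[OF \<phi>] integrable_pairing[OF test_function_Linf[OF \<phi>] p] by (simp add: S_def)
    qed
    show "(\<lambda>x. f x + g x) \<in> S" if "f \<in> S" "g \<in> S" for f g
      using that by (auto simp: S_def pairing_def inner_add_left)
    show "(\<lambda>x. c *\<^sub>R f x) \<in> S" if "f \<in> S" for f c
      using that by (auto simp: S_def pairing_def)
    show "g \<in> S" if "f \<in> S" and g: "g \<in> borel_measurable lebesgue" and ae: "AE x in lebesgue. f x = g x" for f g
    proof -
      have f: "f \<in> borel_measurable lebesgue" "integrable (lebesgue_on \<Omega>) (\<lambda>x. f x \<bullet> p x)" "pairing \<Omega> f p = 0"
        using that by (auto simp: S_def)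
      note [measurable] = leb_on[OF g] leb_on[OF f(1)]
      have ae': "AE x in lebesgue_on \<Omega>. f x \<bullet> p x = g x \<bullet> p x"
        using AE_lebesgue_on_if[OF \<Omega>s ae] by (auto elim!: eventually_mono)
      have "integrable (lebesgue_on \<Omega>) (\<lambda>x. g x \<bullet> p x)"
        using f(2) ae' by (subst integrable_cong_AE[of _ _ "\<lambda>x. f x \<bullet> p x"]) (auto elim!: eventually_mono)
      moreover have "pairing \<Omega> g p = pairing \<Omega> f p"
        unfolding pairing_def using ae' by (intro integral_cong_AE) (auto elim!: eventually_mono)
      ultimately show ?thesis using f g by (simp add: S_def)
    qed
    fix s :: "nat \<Rightarrow> real^'d \<Rightarrow> real^'m" and f C E
    assume s: "\<And>n. s n \<in> S" "\<And>x. (\<lambda>n. s n x) \<longlonglongrightarrow> f x" "\<And>n x. norm (s n x) \<le> C * indicator E x"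
    have sm: "s n \<in> borel_measurable lebesgue" for n using s(1) by (auto simp: S_def)
    have fm: "f \<in> borel_measurable lebesgue" by (rule borel_measurable_LIMSEQ_metric[OF sm s(2)])
    note [measurable] = leb_on[OF fm] leb_on[OF sm]
    have C: "0 \<le> C * indicator E x" for x :: "real^'d" using s(3)[of 0 x] norm_ge_zero order_trans by blast
    have bd: "norm (s n x \<bullet> p x) \<le> \<bar>C\<bar> * norm (p x)" for n x
    proof -
      have "norm (s n x) \<le> \<bar>C\<bar>" using s(3)[of n x] by (cases "x \<in> E") auto
      then have "norm (s n x) * norm (p x) \<le> \<bar>C\<bar> * norm (p x)" by (rule mult_right_mono) simp
      then show ?thesis using Cauchy_Schwarz_ineq2[of "s n x" "p x"] by simp
    qed
    have lim: "(\<lambda>n. s n x \<bullet> p x) \<longlonglongrightarrow> f x \<bullet> p x" for x using s(2) by (intro tendsto_intros)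
    have w: "integrable (lebesgue_on \<Omega>) (\<lambda>x. \<bar>C\<bar> * norm (p x))" using pn by simp
    have "integrable (lebesgue_on \<Omega>) (\<lambda>x. f x \<bullet> p x)"
      by (rule integrable_dominated_convergence[OF _ _ w, where s="\<lambda>n x. s n x \<bullet> p x"])
         (use lim bd in \<open>auto simp del: real_norm_def\<close>)
    moreover have "(\<lambda>n. pairing \<Omega> (s n) p) \<longlonglongrightarrow> pairing \<Omega> f p"
      unfolding pairing_def
      by (rule integral_dominated_convergence[OF _ _ w]) (use lim bd in \<open>auto simp del: real_norm_def\<close>)
    then have "pairing \<Omega> f p = 0" using s(1) by (simp add: S_def LIMSEQ_const_iff)
    ultimately show "f \<in> S" using fm by (simp add: S_def)
  qed
  have half: "AE x in lebesgue_on \<Omega>. \<not> c * p x $ i > 0" for i and c :: real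
  proof -
    have "AE x in lebesgue_on \<Omega>. \<forall>n. \<not> (c * p x $ i > 0 \<and> x \<in> ball 0 (real n))"
    proof (rule AE_all_countable[THEN iffD2, rule_format])
      fix n
      \<comment> \<open>The ball makes the measure finite; c = 1 and c = -1 will treat the two
        signs.\<close>
      define B where "B = {x \<in> \<Omega>. c * p x $ i > 0} \<inter> ball 0 (real n)"
      have pim: "(\<lambda>x. c * p x $ i) \<in> borel_measurable (lebesgue_on \<Omega>)"
      proof -
        have "(\<lambda>x. c * (p x \<bullet> axis i 1)) \<in> borel_measurable (lebesgue_on \<Omega>)" by measurable
        then show ?thesis by (simp add: inner_axis)
      qed
      have "{x \<in> space (lebesgue_on \<Omega>). c * p x $ i > 0} \<in> sets (lebesgue_on \<Omega>)" using pim by measurable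
      then have "{x \<in> \<Omega>. c * p x $ i > 0} \<in> sets lebesgue"
        using \<Omega>s by (auto simp: sets_restrict_space_iff)
      then have B: "B \<in> sets lebesgue" "B \<subseteq> \<Omega>" by (auto simp: B_def)
      have "emeasure lebesgue B \<le> emeasure lebesgue (ball (0::real^'d) (real n))"
        by (intro emeasure_mono) (auto simp: B_def)
      also have "\<dots> < \<infinity>" using emeasure_bounded_finite[OF bounded_ball] by simp
      finally have "(\<lambda>x. indicator B x *\<^sub>R (c *\<^sub>R axis i 1)) \<in> S" using B by (intro S)
      then have i: "integrable (lebesgue_on \<Omega>) (\<lambda>x. indicator B x * (c * p x $ i))"
        "(LINT x|lebesgue_on \<Omega>. indicator B x * (c * p x $ i)) = 0"
        by (auto simp: S_def pairing_def inner_axis' mult.assoc)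
      have "AE x in lebesgue_on \<Omega>. indicator B x * (c * p x $ i) = 0"
        using i by (subst integral_nonneg_eq_0_iff_AE[OF i(1), symmetric]) (auto simp: B_def indicator_def)
      then show "AE x in lebesgue_on \<Omega>. \<not> (c * p x $ i > 0 \<and> x \<in> ball 0 (real n))"
        using AE_space[of "lebesgue_on \<Omega>"] by eventually_elim (auto simp: B_def indicator_def split: if_splits)
    qed
    then show ?thesis
    proof eventually_elim
      fix x assume *: "\<forall>n. \<not> (c * p x $ i > 0 \<and> x \<in> ball 0 (real n))"
      obtain n where "norm x < real n" using reals_Archimedean2 by blast
      then show "\<not> c * p x $ i > 0" using * by auto
    qed
  qed
  have "AE x in lebesgue_on \<Omega>. \<forall>i\<in>UNIV. \<not> 1 * p x $ i > 0 \<and> \<not> (-1) * p x $ i > 0"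
    using half[of 1] half[of "-1"] by (intro AE_finite_allI AE_conjI) auto
  then show ?thesis by eventually_elim (auto simp: vec_eq_iff not_less intro: antisym)
qed

text \<open>The monotone class argument is applied to the L^1 closure \<open>S\<close> of the test
  functions. It yields indicators of sets of finite measure, and approximation by simple functions
  yields all integrable fields.\<close>

theorem test_functions_dense_L1:
  fixes u :: "real^'d \<Rightarrow> real^'m"
  assumes \<Omega>: "open \<Omega>" and u: "u \<in> L1 \<Omega>" and e: "e > 0"
  obtains \<phi> where "\<phi> \<in> test_functions \<Omega>" "L1_norm \<Omega> (u - \<phi>) < e"
proof -
  have \<Omega>s[measurable]: "\<Omega> \<in> sets lebesgue" using \<Omega> by (rule open_in_lebesgue)
  note tL = test_function_L1[OF \<Omega>s]
  define S where "S = {g :: real^'d \<Rightarrow> real^'m. g \<in> L1 \<Omega> \<and> (\<forall>e>0. \<exists>\<phi>\<in>test_functions \<Omega>. L1_norm \<Omega> (g - \<phi>) < e)}"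
  note sub = subspace_L1 and n = seminorm_onD[OF seminorm_L1]
  have test_add: "\<phi> + \<psi> \<in> test_functions \<Omega>"
    if \<phi>: "\<phi> \<in> test_functions \<Omega>" and \<psi>: "\<psi> \<in> test_functions \<Omega>" for \<phi> \<psi> :: "real^'d \<Rightarrow> real^'m"
  proof -
    obtain K where K: "compact K" "K \<subseteq> \<Omega>" "\<And>x. x \<notin> K \<Longrightarrow> \<phi> x = 0" "\<And>k. Ck_on k UNIV \<phi>"
      using \<phi> by (rule test_functionsD) blast
    obtain K' where K': "compact K'" "K' \<subseteq> \<Omega>" "\<And>x. x \<notin> K' \<Longrightarrow> \<psi> x = 0" "\<And>k. Ck_on k UNIV \<psi>"
      using \<psi> by (rule test_functionsD) blast
    have "Ck_on k UNIV (\<phi> + \<psi>)" for k unfolding plus_fun_def using K K' by (intro Ck_on_add) auto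
    then show ?thesis unfolding test_functions_def
      using K K' by (intro CollectI conjI allI exI[of _ "K \<union> K'"]) auto
  qed
  have test_scale: "c *\<^sub>R \<phi> \<in> test_functions \<Omega>" if \<phi>: "\<phi> \<in> test_functions \<Omega>" for \<phi> :: "real^'d \<Rightarrow> real^'m" and c
  proof -
    obtain K where K: "compact K" "K \<subseteq> \<Omega>" "\<And>x. x \<notin> K \<Longrightarrow> \<phi> x = 0" "\<And>k. Ck_on k UNIV \<phi>"
      using \<phi> by (rule test_functionsD) blast
    have "Ck_on k UNIV (c *\<^sub>R \<phi>)" for k
      unfolding scaleR_fun_def using K by (intro Ck_on_bilinear[OF bounded_bilinear_scaleR] Ck_on_const) auto
    then show ?thesis unfolding test_functions_def
      using K by (intro CollectI conjI allI exI[of _ "K"]) auto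
  qed
  have S_add: "f + g \<in> S" if "f \<in> S" "g \<in> S" for f g
    unfolding S_def
  proof (intro CollectI conjI allI impI)
    show "f + g \<in> L1 \<Omega>" using that by (auto simp: S_def intro: subspace_add[OF sub])
    fix e :: real assume "e > 0"
    then have "e / 2 > 0" by simp
    then have "\<exists>\<phi>\<in>test_functions \<Omega>. L1_norm \<Omega> (f - \<phi>) < e / 2" "\<exists>\<psi>\<in>test_functions \<Omega>. L1_norm \<Omega> (g - \<psi>) < e / 2"
      using that unfolding S_def by blast+
    then obtain \<phi> \<psi> where a: "\<phi> \<in> test_functions \<Omega>" "L1_norm \<Omega> (f - \<phi>) < e / 2" "\<psi> \<in> test_functions \<Omega>" "L1_norm \<Omega> (g - \<psi>) < e / 2"
      by blast
    have "L1_norm \<Omega> ((f - \<phi>) + (g - \<psi>)) \<le> L1_norm \<Omega> (f - \<phi>) + L1_norm \<Omega> (g - \<psi>)"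
      using that a tL by (intro n(3) subspace_diff[OF sub]) (auto simp: S_def)
    moreover have "(f - \<phi>) + (g - \<psi>) = (f + g) - (\<phi> + \<psi>)" by simp
    ultimately have "L1_norm \<Omega> ((f + g) - (\<phi> + \<psi>)) < e" using a by simp
    then show "\<exists>\<phi>\<in>test_functions \<Omega>. L1_norm \<Omega> ((f + g) - \<phi>) < e" using test_add a by blast
  qed
  have S_scale: "c *\<^sub>R f \<in> S" if "f \<in> S" for f c
    unfolding S_def
  proof (intro CollectI conjI allI impI)
    show "c *\<^sub>R f \<in> L1 \<Omega>" using that by (auto simp: S_def intro: subspace_scale[OF sub])
    fix e :: real assume e: "e > 0"
    then have "e / (\<bar>c\<bar> + 1) > 0" by simp
    then have "\<exists>\<phi>\<in>test_functions \<Omega>. L1_norm \<Omega> (f - \<phi>) < e / (\<bar>c\<bar> + 1)"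
      using that unfolding S_def by blast
    then obtain \<phi> where a: "\<phi> \<in> test_functions \<Omega>" "L1_norm \<Omega> (f - \<phi>) < e / (\<bar>c\<bar> + 1)" by blast
    have "L1_norm \<Omega> (c *\<^sub>R (f - \<phi>)) = \<bar>c\<bar> * L1_norm \<Omega> (f - \<phi>)"
      using that a tL by (intro n(4) subspace_diff[OF sub]) (auto simp: S_def)
    also have "\<dots> \<le> \<bar>c\<bar> * (e / (\<bar>c\<bar> + 1))" using a by (intro mult_left_mono) auto
    also have "\<dots> < e" using e by (simp add: field_simps)
    finally have "L1_norm \<Omega> (c *\<^sub>R f - c *\<^sub>R \<phi>) < e" by (simp only: scaleR_diff_right)
    then show "\<exists>\<phi>\<in>test_functions \<Omega>. L1_norm \<Omega> (c *\<^sub>R f - \<phi>) < e" using test_scale a by blast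
  qed
  have S_lim: "f \<in> S" if f: "f \<in> L1 \<Omega>" and s: "\<And>n. s n \<in> S" and l: "(\<lambda>n. L1_norm \<Omega> (s n - f)) \<longlonglongrightarrow> 0" for s f
    unfolding S_def
  proof (intro CollectI conjI allI impI f)
    fix e :: real assume "e > 0"
    then have e2: "e / 2 > 0" by simp
    obtain m where m: "L1_norm \<Omega> (s m - f) < e / 2"
      using order_tendstoD(2)[OF l e2] by (auto simp: eventually_sequentially)
    have "\<exists>\<phi>\<in>test_functions \<Omega>. L1_norm \<Omega> (s m - \<phi>) < e / 2"
      using s[of m] e2 unfolding S_def by blast
    then obtain \<phi> where \<phi>: "\<phi> \<in> test_functions \<Omega>" "L1_norm \<Omega> (s m - \<phi>) < e / 2" by blast
    have sm: "s m \<in> L1 \<Omega>" using s by (auto simp: S_def)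
    have "L1_norm \<Omega> ((s m - \<phi>) - (s m - f)) \<le> L1_norm \<Omega> (s m - \<phi>) + L1_norm \<Omega> (s m - f)"
      using f sm \<phi> tL by (intro n(7) subspace_diff[OF sub]) auto
    moreover have "(s m - \<phi>) - (s m - f) = f - \<phi>" by simp
    ultimately have "L1_norm \<Omega> (f - \<phi>) < e" using m \<phi> by simp
    then show "\<exists>\<phi>\<in>test_functions \<Omega>. L1_norm \<Omega> (f - \<phi>) < e" using \<phi> by blast
  qed
  have S_ae: "g \<in> S" if "f \<in> S" and g: "g \<in> borel_measurable (lebesgue_on \<Omega>)" and ae: "AE x in lebesgue_on \<Omega>. f x = g x" for f g
  proof (rule S_lim)
    have f: "f \<in> L1 \<Omega>" using that by (auto simp: S_def)
    show gL: "g \<in> L1 \<Omega>" using L1_cong_AE[OF f g ae] .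
    show "f \<in> S" by fact
    have "L1_norm \<Omega> (f - g) = 0" using ae L1_norm_diff_eq_0_iff[OF f gL] by simp
    then show "(\<lambda>n. L1_norm \<Omega> (f - g)) \<longlonglongrightarrow> 0" by simp
  qed
  have ind: "(\<lambda>x. indicator B x *\<^sub>R v) \<in> S"
    if B: "B \<in> sets lebesgue" "B \<subseteq> \<Omega>" "emeasure lebesgue B < \<infinity>" for B v
  proof (rule indicators_in_bounded_closure[OF \<Omega> _ _ _ _ _ B])
    show "test_functions \<Omega> \<subseteq> S"
    proof
      fix \<phi> :: "real^'d \<Rightarrow> real^'m" assume \<phi>: "\<phi> \<in> test_functions \<Omega>"
      have "L1_norm \<Omega> (\<phi> - \<phi>) = 0" using n(5)[of \<Omega>] by simp
      then have "\<forall>e>0. \<exists>\<psi>\<in>test_functions \<Omega>. L1_norm \<Omega> (\<phi> - \<psi>) < e" using \<phi> by metis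
      then show "\<phi> \<in> S" using tL[OF \<phi>] unfolding S_def by blast
    qed
    show "(\<lambda>x. f x + g x) \<in> S" if "f \<in> S" "g \<in> S" for f g using S_add[OF that] by (simp add: plus_fun_def)
    show "(\<lambda>x. c *\<^sub>R f x) \<in> S" if "f \<in> S" for f c using S_scale[OF that] by (simp add: scaleR_fun_def)
    show "g \<in> S" if "f \<in> S" "g \<in> borel_measurable lebesgue" "AE x in lebesgue. f x = g x" for f g
      using S_ae[OF that(1) measurable_restrict_space1[OF that(2)] AE_lebesgue_on_if[OF \<Omega>s that(3)]] .
    fix s :: "nat \<Rightarrow> real^'d \<Rightarrow> real^'m" and f C E
    assume s: "\<And>n. s n \<in> S" "\<And>x. (\<lambda>n. s n x) \<longlonglongrightarrow> f x" and E: "E \<in> sets borel" "emeasure lborel E < \<infinity>"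
      and bd: "\<And>n x. norm (s n x) \<le> C * indicator E x"
    have sm: "s n \<in> borel_measurable (lebesgue_on \<Omega>)" for n using s(1)[of n] by (auto simp: S_def L1_def)
    have fm: "f \<in> borel_measurable (lebesgue_on \<Omega>)" by (rule borel_measurable_LIMSEQ_metric[OF sm s(2)])
    have "integrable lborel (\<lambda>x. C * indicator E x)" using E by (intro integrable_mult_right integrable_real_indicator) auto
    then have "integrable lebesgue (\<lambda>x. C * indicator E x)" by (subst integrable_completion) auto
    then have h: "integrable (lebesgue_on \<Omega>) (\<lambda>x. C * indicator E x)"
      using \<Omega>s by (subst integrable_restrict_space) (auto intro!: integrable_mult_indicator simp del: real_scaleR_def)
    have fi: "integrable (lebesgue_on \<Omega>) f"
      by (rule integrable_dominated_convergence[where s=s, OF fm sm h]) (use s(2) bd in auto)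
    have "(\<lambda>n. LINT x|lebesgue_on \<Omega>. norm (s n x - f x)) \<longlonglongrightarrow> 0"
      using integral_norm_diff_tendsto_0[OF h sm fi] s(2) bd by simp
    then show "f \<in> S"
      using fi s(1) by (intro S_lim[of f s]) (simp_all add: L1_def L1_norm_def)
  qed
  have "u \<in> S"
  proof -
    have "integrable (lebesgue_on \<Omega>) u" using u by (simp add: L1_def)
    then show ?thesis
    proof (induction rule: integrable_induct)
      case (base B c)
      then show ?case using \<Omega>s by (intro ind) (auto simp: sets_restrict_space_iff emeasure_restrict_space)
    next
      case (add f g)
      then show ?case using S_add[of f g] by (simp add: plus_fun_def)
    next
      case (lim f s)
      have h: "integrable (lebesgue_on \<Omega>) (\<lambda>x. 2 * norm (f x))" using lim.hyps by simp
      have "(\<lambda>n. LINT x|lebesgue_on \<Omega>. norm (s n x - f x)) \<longlonglongrightarrow> 0"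
      proof (rule integral_norm_diff_tendsto_0[OF h _ lim.hyps(4)])
        show "s n \<in> borel_measurable (lebesgue_on \<Omega>)" for n using lim.hyps(1) by (rule borel_measurable_integrable)
        show "AE x in lebesgue_on \<Omega>. (\<lambda>n. s n x) \<longlonglongrightarrow> f x" using lim.hyps(2) by (rule AE_I2)
        show "AE x in lebesgue_on \<Omega>. norm (s n x) \<le> 2 * norm (f x)" for n using lim.hyps(3) by (rule AE_I2)
      qed
      then have "(\<lambda>n. L1_norm \<Omega> (s n - f)) \<longlonglongrightarrow> 0" by (simp add: L1_norm_def)
      moreover have "f \<in> L1 \<Omega>" using lim.hyps(4) by (simp add: L1_def)
      ultimately show ?case using lim.IH by (intro S_lim[of f s])
    qed
  qed
  then have "\<exists>\<phi>\<in>test_functions \<Omega>. L1_norm \<Omega> (u - \<phi>) < e" using e unfolding S_def by blast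
  then show ?thesis using that by blast
qed

section \<open>Integrands of linear growth\<close>

text \<open>Difference quotients of a convex function increase along a ray, so each is at most the
  slope at infinity, which linear growth bounds by M.\<close>

lemma convex_linear_growth_lipschitz:
  fixes g :: "'v::real_normed_vector \<Rightarrow> real"
  assumes g: "convex_on UNIV g" and nn: "\<And>z. 0 \<le> g z" and gr: "\<And>z. g z \<le> M * (1 + norm z)" and M: "M > 0"
  shows "\<bar>g z - g y\<bar> \<le> M * norm (z - y)"
proof -
  have one: "g z - g y \<le> M * norm (z - y)" for y z
  proof (rule field_le_epsilon)
    fix e :: real assume e: "e > 0"
    \<comment> \<open>Prolonging the segment from y through z by a factor t \<ge> 1 makes z a convex
      combination of y and the endpoint w. The part of the bound at w that does not grow with t
      contributes at most e after division by t.\<close>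
    define t where "t = max 1 (M * (1 + norm y) / e)"
    have t: "t \<ge> 1" "M * (1 + norm y) / e \<le> t" by (auto simp: t_def)
    define w where "w = y + t *\<^sub>R (z - y)"
    have "(1 - 1 / t) *\<^sub>R y + (1 / t) *\<^sub>R w = z"
      using t(1) by (simp add: w_def scaleR_add_right scaleR_diff_left scaleR_diff_right)
    moreover have "g ((1 - 1 / t) *\<^sub>R y + (1 / t) *\<^sub>R w) \<le> (1 - 1 / t) * g y + (1 / t) * g w"
      using t(1) by (intro convex_onD[OF g]) auto
    ultimately have "g z \<le> (1 - 1 / t) * g y + (1 / t) * g w" by simp
    then have "g z - g y \<le> (1 / t) * g w - (1 / t) * g y" by (simp add: algebra_simps)
    also have "\<dots> \<le> (1 / t) * g w" using nn[of y] t(1) by simp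
    also have "\<dots> \<le> (1 / t) * (M * (1 + (norm y + t * norm (z - y))))"
    proof (intro mult_left_mono)
      have "norm w \<le> norm y + t * norm (z - y)"
        unfolding w_def using norm_triangle_ineq[of y "t *\<^sub>R (z - y)"] t(1) by simp
      then have "M * (1 + norm w) \<le> M * (1 + (norm y + t * norm (z - y)))" using M by (intro mult_left_mono) auto
      then show "g w \<le> M * (1 + (norm y + t * norm (z - y)))" using gr[of w] by linarith
    qed (use t(1) in auto)
    also have "\<dots> = M * (1 + norm y) / t + M * norm (z - y)" using t(1) by (simp add: field_simps)
    also have "M * (1 + norm y) / t \<le> e"
      using t e by (simp add: field_simps)
    finally show "g z - g y \<le> M * norm (z - y) + e" by simp
  qed
  show ?thesis using one[of z y] one[of y z] by (simp add: abs_le_iff norm_minus_commute)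
qed

text \<open>An integrable minorant rules out \<infinity> - \<infinity>: the negative part of g has
  finite integral, and the excess over \<open>g0\<close> is nonnegative, so that monotone
  convergence can be applied to it.\<close>

lemma ereal_integral_eq_integral_plus:
  fixes g :: "'a \<Rightarrow> ereal"
  assumes g[measurable]: "g \<in> borel_measurable M" and g0: "integrable M g0"
    and le: "\<And>x. x \<in> space M \<Longrightarrow> ereal (g0 x) \<le> g x"
  shows "ereal_integral M g = ereal (integral\<^sup>L M g0) + enn2ereal (\<integral>\<^sup>+x. e2ennreal (g x - ereal (g0 x)) \<partial>M)"
proof -
  note [measurable] = borel_measurable_integrable[OF g0]
  define P where "P = (\<integral>\<^sup>+x. e2ennreal (g x) \<partial>M)"
  define N where "N = (\<integral>\<^sup>+x. e2ennreal (- g x) \<partial>M)"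
  define D where "D = (\<integral>\<^sup>+x. e2ennreal (g x - ereal (g0 x)) \<partial>M)"
  define a where "a = (\<integral>\<^sup>+x. ennreal (g0 x) \<partial>M)"
  define b where "b = (\<integral>\<^sup>+x. ennreal (- g0 x) \<partial>M)"
  have ab: "a < \<infinity>" "b < \<infinity>" using g0 by (auto simp: a_def b_def real_integrable_def less_top)
  have int: "integral\<^sup>L M g0 = enn2real a - enn2real b"
    unfolding a_def b_def by (rule real_lebesgue_integral_def[OF g0])
  \<comment> \<open>The identity g = (g - g0) + g0, written with positive and negative parts as g^+
    + g0^- = (g - g0) + g0^+ + g^-, so that only nonnegative quantities are added.\<close>
  have pt: "e2ennreal (g x) + ennreal (- g0 x) = e2ennreal (g x - ereal (g0 x)) + ennreal (g0 x) + e2ennreal (- g x)"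
    if x: "x \<in> space M" for x
  proof (cases "g x")
    case (real r)
    then have r: "g0 x \<le> r" using le[OF x] by simp
    have e: "e2ennreal (ereal c) = ennreal c" for c by (simp add: ennreal.rep_eq e2ennreal_def max_def ennreal_def)
    have m: "ennreal c = ennreal (max c 0)" for c by (auto simp: max_def ennreal_neg)
    have "ennreal r + ennreal (- g0 x) = ennreal (max r 0) + ennreal (max (- g0 x) 0)"
      using m[of r] m[of "- g0 x"] by simp
    also have "\<dots> = ennreal (max r 0 + max (- g0 x) 0)" by (rule ennreal_plus[symmetric]) auto
    finally have "ennreal r + ennreal (- g0 x) = ennreal (max r 0 + max (- g0 x) 0)" .
    also have "max r 0 + max (- g0 x) 0 = (r - g0 x) + max (g0 x) 0 + max (- r) 0" by (auto simp: max_def)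
    also have "ennreal \<dots> = ennreal (r - g0 x) + ennreal (max (g0 x) 0) + ennreal (max (- r) 0)"
      using r by (simp add: ennreal_plus)
    also have "\<dots> = ennreal (r - g0 x) + ennreal (g0 x) + ennreal (- r)"
      using m[of "g0 x"] m[of "- r"] by simp
    finally show ?thesis using e by (simp add: real)
  next
    case PInf
    have "e2ennreal \<infinity> = top" using e2ennreal_enn2ereal[of top] by simp
    then show ?thesis by (simp add: PInf)
  qed (use le[OF x] in auto)
  have "P + b = D + a + N"
  proof -
    have "P + b = (\<integral>\<^sup>+x. e2ennreal (g x) + ennreal (- g0 x) \<partial>M)"
      unfolding P_def b_def by (rule nn_integral_add[symmetric]) measurable
    also have "\<dots> = (\<integral>\<^sup>+x. e2ennreal (g x - ereal (g0 x)) + ennreal (g0 x) + e2ennreal (- g x) \<partial>M)"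
      by (intro nn_integral_cong pt)
    also have "\<dots> = D + a + N" unfolding D_def a_def N_def by (simp add: nn_integral_add)
    finally show ?thesis .
  qed
  moreover have "N \<le> b" unfolding N_def b_def
  proof (rule nn_integral_mono)
    fix x assume "x \<in> space M"
    then have "- g x \<le> ereal (- g0 x)" using le[of x] by (cases "g x") auto
    then have "e2ennreal (- g x) \<le> e2ennreal (ereal (- g0 x))" by (rule e2ennreal_mono)
    then show "e2ennreal (- g x) \<le> ennreal (- g0 x)" by (simp add: ennreal.rep_eq e2ennreal_def max_def ennreal_def)
  qed
  then have "N < \<infinity>" using ab by auto
  ultimately have "enn2ereal P - enn2ereal N = ereal (enn2real a - enn2real b) + enn2ereal D"
    using ab
    by (cases P; cases D; cases N; cases a; cases b)
      (auto simp: enn2ereal_ennreal ennreal_plus[symmetric] simp del: ennreal_plus)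
  then show ?thesis unfolding ereal_integral_def P_def[symmetric] N_def[symmetric] D_def[symmetric] int .
qed

lemma enn2ereal_nn_integral_eq_integral:
  "integrable M h \<Longrightarrow> (\<And>x. x \<in> space M \<Longrightarrow> 0 \<le> h x) \<Longrightarrow> enn2ereal (\<integral>\<^sup>+x. ennreal (h x) \<partial>M) = ereal (integral\<^sup>L M h)"
  by (subst nn_integral_eq_integral) (auto intro!: AE_I2 integral_nonneg_AE simp: enn2ereal_ennreal)

section \<open>The integral functional on L^1 and its conjugate\<close>

locale linear_growth_integrand =
  fixes \<Omega> :: "(real^'d::finite) set" and f :: "real^'d \<Rightarrow> real^'N::finite \<Rightarrow> real" and M :: real
  assumes open_\<Omega>: "open \<Omega>"
    and cont: "continuous_on (\<Omega> \<times> UNIV) (\<lambda>(x, z). f x z)"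
    and nonneg: "\<And>x z. x \<in> \<Omega> \<Longrightarrow> 0 \<le> f x z"
    and conv: "\<And>x. x \<in> \<Omega> \<Longrightarrow> convex_on UNIV (f x)"
    and M: "M > 0"
    and growth: "\<And>x z. x \<in> \<Omega> \<Longrightarrow> f x z \<le> M * (1 + norm z)"
    and finite_somewhere: "\<exists>u\<in>L1 \<Omega>. primal_functional \<Omega> f u < \<infinity>"
begin

definition F_int :: "(real^'d \<Rightarrow> real^'N) \<Rightarrow> real" where
  "F_int u = (LINT x|lebesgue_on \<Omega>. f x (u x))"

lemma f_lipschitz: "x \<in> \<Omega> \<Longrightarrow> \<bar>f x z - f x y\<bar> \<le> M * norm (z - y)"
  by (rule convex_linear_growth_lipschitz[OF conv nonneg growth M])

lemma f_measurable:
  assumes "u \<in> borel_measurable (lebesgue_on \<Omega>)"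
  shows "(\<lambda>x. f x (u x)) \<in> borel_measurable (lebesgue_on \<Omega>)"
proof -
  have "(\<lambda>(x, z). f x z) \<in> borel_measurable (restrict_space borel (\<Omega> \<times> UNIV))"
    using cont by (rule borel_measurable_continuous_on_restrict)
  moreover have "(\<lambda>x. (x, u x)) \<in> measurable (lebesgue_on \<Omega>) (restrict_space borel (\<Omega> \<times> UNIV))"
  proof (rule measurable_restrict_space2)
    have "(\<lambda>x. x) \<in> measurable (lebesgue_on \<Omega>) (borel :: (real^'d) measure)"
      by (rule borel_measurable_lebesgue_onI) simp
    then show "(\<lambda>x. (x, u x)) \<in> measurable (lebesgue_on \<Omega>) borel"
      using assms unfolding borel_prod[symmetric] by (rule measurable_Pair)
  qed auto
  ultimately have "(\<lambda>x. case (x, u x) of (x, z) \<Rightarrow> f x z) \<in> borel_measurable (lebesgue_on \<Omega>)"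
    by (rule measurable_compose[rotated])
  then show ?thesis by simp
qed

text \<open>One field v of finite energy is enough: the Lipschitz bound lets f(x, u) exceed f(x, v)
  by at most M |u - v|, which is integrable also when \<Omega> has infinite measure.\<close>

lemma f_integrable:
  assumes u: "u \<in> L1 \<Omega>" shows "integrable (lebesgue_on \<Omega>) (\<lambda>x. f x (u x))"
proof -
  obtain v where v: "v \<in> L1 \<Omega>" "primal_functional \<Omega> f v < \<infinity>" using finite_somewhere by blast
  note [measurable] = f_measurable[OF borel_measurable_integrable[OF v(1)[unfolded L1_def, simplified]]]
     f_measurable[OF borel_measurable_integrable[OF u[unfolded L1_def, simplified]]]
  have "(\<integral>\<^sup>+x. ennreal (norm (f x (v x))) \<partial>lebesgue_on \<Omega>) = (\<integral>\<^sup>+x. ennreal (f x (v x)) \<partial>lebesgue_on \<Omega>)"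
    using nonneg by (intro nn_integral_cong) simp
  also have "\<dots> < \<infinity>" using v(2) by (auto simp: primal_functional_def less_top enn2ereal_eq_top_iff)
  finally have fv: "integrable (lebesgue_on \<Omega>) (\<lambda>x. f x (v x))" by (intro integrableI_bounded) measurable
  have "integrable (lebesgue_on \<Omega>) (\<lambda>x. f x (v x) + M * norm (u x - v x))"
    using fv u v(1) by (auto simp: L1_def)
  then show ?thesis
  proof (rule Bochner_Integration.integrable_bound)
    show "AE x in lebesgue_on \<Omega>. norm (f x (u x)) \<le> norm (f x (v x) + M * norm (u x - v x))"
    proof (rule AE_I2)
      fix x assume "x \<in> space (lebesgue_on \<Omega>)"
      then have "x \<in> \<Omega>" by simp
      then show "norm (f x (u x)) \<le> norm (f x (v x) + M * norm (u x - v x))"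
        using f_lipschitz[of x "u x" "v x"] nonneg[of x "u x"] by auto
    qed
  qed measurable
qed

lemma primal_functional_eq: "u \<in> L1 \<Omega> \<Longrightarrow> primal_functional \<Omega> f u = ereal (F_int u)"
  unfolding primal_functional_def F_int_def
  using nonneg by (intro enn2ereal_nn_integral_eq_integral f_integrable) auto

lemma F_int_nonneg: "0 \<le> F_int u"
  unfolding F_int_def using nonneg by (intro integral_nonneg_AE AE_I2) auto

lemma F_int_lipschitz:
  assumes "u \<in> L1 \<Omega>" "v \<in> L1 \<Omega>" shows "\<bar>F_int u - F_int v\<bar> \<le> M * L1_norm \<Omega> (u - v)"
proof -
  have "\<bar>F_int u - F_int v\<bar> = \<bar>LINT x|lebesgue_on \<Omega>. f x (u x) - f x (v x)\<bar>"
    unfolding F_int_def using assms by (simp add: f_integrable)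
  also have "\<dots> \<le> (LINT x|lebesgue_on \<Omega>. \<bar>f x (u x) - f x (v x)\<bar>)" by (rule integral_abs_bound)
  also have "\<dots> \<le> (LINT x|lebesgue_on \<Omega>. M * norm (u x - v x))"
    using assms f_integrable[OF assms(1)] f_integrable[OF assms(2)]
    by (intro integral_mono) (auto simp: L1_def f_lipschitz)
  finally show ?thesis by (simp add: L1_norm_def)
qed

lemma F_int_convex:
  assumes "u \<in> L1 \<Omega>" "v \<in> L1 \<Omega>" "a \<ge> 0" "b \<ge> 0" "a + b = 1"
  shows "F_int (a *\<^sub>R u + b *\<^sub>R v) \<le> a * F_int u + b * F_int v"
proof -
  have L: "a *\<^sub>R u + b *\<^sub>R v \<in> L1 \<Omega>" using assms by (intro subspace_add subspace_scale subspace_L1)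
  have "F_int (a *\<^sub>R u + b *\<^sub>R v) \<le> (LINT x|lebesgue_on \<Omega>. a * f x (u x) + b * f x (v x))"
    unfolding F_int_def
  proof (rule integral_mono)
    show "integrable (lebesgue_on \<Omega>) (\<lambda>x. f x ((a *\<^sub>R u + b *\<^sub>R v) x))" by (rule f_integrable[OF L])
    show "integrable (lebesgue_on \<Omega>) (\<lambda>x. a * f x (u x) + b * f x (v x))"
      using assms by (intro Bochner_Integration.integrable_add integrable_mult_right f_integrable)
    fix x assume "x \<in> space (lebesgue_on \<Omega>)"
    then have "convex_on UNIV (f x)" by (intro conv) simp
    then show "f x ((a *\<^sub>R u + b *\<^sub>R v) x) \<le> a * f x (u x) + b * f x (v x)"
      using assms by (simp add: convex_on_def)
  qed
  also have "\<dots> = a * F_int u + b * F_int v"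
    unfolding F_int_def using assms by (simp add: f_integrable)
  finally show ?thesis .
qed

text \<open>The supremum over \<open>L\<^sup>1\<close> is approached by functions that pick pointwise the best of finitely
  many vectors from a countable dense set, on bounded sets only, so that they stay integrable.\<close>

theorem integral_fenchel_conjugate:
  assumes v: "v \<in> Linf \<Omega>"
  shows "ereal_integral (lebesgue_on \<Omega>) (\<lambda>x. fenchel_conjugate f x (v x)) =
     (SUP u\<in>L1 \<Omega>. ereal (pairing \<Omega> v u - F_int u))"
proof -
  let ?M = "lebesgue_on \<Omega>"
  define h where "h x z = v x \<bullet> z - f x z" for x z
  define g where "g x = fenchel_conjugate f x (v x)" for x
  have \<Omega>[measurable]: "\<Omega> \<in> sets lebesgue" using open_\<Omega> by (rule open_in_lebesgue)
  have [measurable]: "v \<in> borel_measurable ?M" using v by (simp add: Linf_def)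
  have hm: "(\<lambda>x. h x (u x)) \<in> borel_measurable ?M" if [measurable]: "u \<in> borel_measurable ?M" for u
    unfolding h_def using f_measurable[OF that] by measurable
  have hi: "integrable ?M (\<lambda>x. h x (u x))" and hI: "integral\<^sup>L ?M (\<lambda>x. h x (u x)) = pairing \<Omega> v u - F_int u"
    if "u \<in> L1 \<Omega>" for u
    unfolding h_def pairing_def F_int_def using integrable_pairing[OF v that] f_integrable[OF that] by auto
  have hg: "ereal (h x z) \<le> g x" for x z
    unfolding g_def fenchel_conjugate_def h_def by (rule SUP_upper) simp
  obtain D :: "(real^'N) set" where D: "countable D" "\<And>X. open X \<Longrightarrow> X \<noteq> {} \<Longrightarrow> \<exists>d\<in>D. d \<in> X"
    by (rule countable_dense_setE) blast
  define q where "q = from_nat_into D"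
  have q: "\<exists>n. q n \<in> X" if X: "open X" "X \<noteq> {}" for X
  proof -
    obtain d where "d \<in> D" "d \<in> X" using D(2)[OF X] by blast
    then show ?thesis using from_nat_into_surj[OF D(1)] unfolding q_def by metis
  qed
  have g_le: "g x \<le> ereal b" if x: "x \<in> \<Omega>" and b: "\<And>n. h x (q n) \<le> b" for x b
    unfolding g_def fenchel_conjugate_def
  proof (rule SUP_least)
    fix z
    have "h x z \<le> b"
    proof (rule field_le_epsilon)
      fix e :: real assume e: "e > 0"
      \<comment> \<open>L is a Lipschitz constant of \<open>h x\<close>, so a point of the dense
        sequence within e / L of z loses at most e.\<close>
      define L where "L = norm (v x) + M"
      have L: "L > 0" using M by (simp add: L_def add_nonneg_pos)
      have "ball z (e / L) \<noteq> {}" using e L by (simp add: not_le)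
      then obtain n where n: "q n \<in> ball z (e / L)" using q[OF open_ball] by blast
      have "h x z - h x (q n) = v x \<bullet> (z - q n) - (f x z - f x (q n))" by (simp add: h_def inner_diff_right)
      also have "\<dots> \<le> norm (v x) * norm (z - q n) + M * norm (z - q n)"
        using Cauchy_Schwarz_ineq2[of "v x" "z - q n"] f_lipschitz[OF x, of z "q n"] by linarith
      also have "\<dots> = L * norm (z - q n)" by (simp add: L_def algebra_simps)
      also have "\<dots> \<le> L * (e / L)" using n L by (intro mult_left_mono) (auto simp: dist_norm)
      also have "\<dots> = e" using L by simp
      finally show "h x z \<le> b + e" using b[of n] by linarith
    qed
    then show "ereal (v x \<bullet> z - f x z) \<le> ereal b" by (simp add: h_def)
  qed
  \<comment> \<open>A countable supremum of measurable functions, which makes the conjugate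
    measurable.\<close>
  have g_SUP: "g x = (SUP n. ereal (h x (q n)))" if x: "x \<in> \<Omega>" for x
  proof (rule antisym)
    show "g x \<le> (SUP n. ereal (h x (q n)))"
    proof (cases "SUP n. ereal (h x (q n))")
      case (real b)
      have "h x (q n) \<le> b" for n using SUP_upper[of n UNIV "\<lambda>n. ereal (h x (q n))"] by (simp add: real)
      then show ?thesis using g_le[OF x] real by simp
    next
      case MInf
      then show ?thesis using SUP_upper[of 0 UNIV "\<lambda>n. ereal (h x (q n))"] by simp
    qed simp
    show "(SUP n. ereal (h x (q n))) \<le> g x" by (intro SUP_least hg)
  qed
  have "(\<lambda>x. SUP n. ereal (h x (q n))) \<in> borel_measurable ?M"
    using hm by (intro borel_measurable_SUP) auto
  then have [measurable]: "g \<in> borel_measurable ?M"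
    using g_SUP by (subst measurable_cong) auto
  obtain u0 :: "real^'d \<Rightarrow> real^'N" where u0: "u0 \<in> L1 \<Omega>" using finite_somewhere by blast
  have lower: "ereal (pairing \<Omega> v u - F_int u) \<le> ereal_integral ?M g" if "u \<in> L1 \<Omega>" for u
  proof -
    have "ereal_integral ?M g = ereal (pairing \<Omega> v u - F_int u) + enn2ereal (\<integral>\<^sup>+x. e2ennreal (g x - ereal (h x (u x))) \<partial>?M)"
      using ereal_integral_eq_integral_plus[OF _ hi[OF that] hg] by (simp add: hI[OF that])
    then show ?thesis by (simp add: add_increasing2)
  qed
  \<comment> \<open>Every \<open>q k\<close> recurs at arbitrarily late indices, so for each x it is
    also tried at an index n with norm x < n.\<close>
  define e where "e n = q (fst (prod_decode n))" for n
  define U where "U = rec_nat u0 (\<lambda>n u x. if norm x < real n \<and> h x (e n) > h x (u x) then e n else u x)"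
  have U_0: "U 0 = u0" by (simp add: U_def)
  have U_Suc: "U (Suc n) = (\<lambda>x. if norm x < real n \<and> h x (e n) > h x (U n x) then e n else U n x)" for n
    by (simp add: U_def cong: if_cong)
  have UL: "U n \<in> L1 \<Omega>" for n
  proof (induction n)
    case 0
    then show ?case using u0 by (simp add: U_0)
  next
    case (Suc n)
    then have Ui: "integrable ?M (U n)" by (simp add: L1_def)
    note [measurable] = borel_measurable_integrable[OF Ui] hm[OF borel_measurable_integrable[OF Ui]] hm[OF borel_measurable_const, of "e n"]
    have nm: "norm \<in> borel_measurable ?M" by (rule borel_measurable_lebesgue_onI) simp
    note [measurable] = nm
    have "integrable lborel (\<lambda>x. norm (e n) * indicator (ball (0::real^'d) (real n)) x)"
      by (intro integrable_mult_right integrable_real_indicator emeasure_bounded_finite) auto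
    then have "integrable lebesgue (\<lambda>x. norm (e n) * indicator (ball (0::real^'d) (real n)) x)"
      by (subst integrable_completion) auto
    then have "integrable lebesgue (\<lambda>x. indicator \<Omega> x *\<^sub>R (norm (e n) * indicator (ball (0::real^'d) (real n)) x))"
      by (rule integrable_mult_indicator[OF \<Omega>])
    then have bi: "integrable ?M (\<lambda>x. norm (e n) * indicator (ball (0::real^'d) (real n)) x)"
      by (subst integrable_restrict_space) auto
    have "integrable ?M (U (Suc n))"
    proof (rule Bochner_Integration.integrable_bound)
      show "integrable ?M (\<lambda>x. norm (U n x) + norm (e n) * indicator (ball (0::real^'d) (real n)) x)"
        using Ui bi by (intro Bochner_Integration.integrable_add integrable_norm)
      show "U (Suc n) \<in> borel_measurable ?M" unfolding U_Suc by measurable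
      show "AE x in ?M. norm (U (Suc n) x) \<le> norm (norm (U n x) + norm (e n) * indicator (ball (0::real^'d) (real n)) x)"
        unfolding U_Suc by (intro AE_I2) (auto simp: indicator_def)
    qed
    then show ?case by (simp add: L1_def)
  qed
  have hU_Suc: "h x (U n x) \<le> h x (U (Suc n) x)" for n x by (simp add: U_Suc)
  have hU_mono: "h x (U m x) \<le> h x (U n x)" if "m \<le> n" for m n x
    using that by (induction rule: dec_induct) (auto intro: order_trans hU_Suc)
  have hU_q: "\<exists>n. h x (q k) \<le> h x (U n x)" for x k
  proof -
    obtain j where j: "norm x < real j" using reals_Archimedean2 by blast
    define n where "n = prod_encode (k, j)"
    have "norm x < real n" using j le_prod_encode_2[of j k] unfolding n_def by linarith
    moreover have "e n = q k" by (simp add: e_def n_def)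
    ultimately have "h x (q k) \<le> h x (U (Suc n) x)" by (auto simp: U_Suc)
    then show ?thesis by blast
  qed
  \<comment> \<open>The starting field supplies an integrable minorant; relative to it the values
    along \<open>U\<close> are nonnegative and increasing.\<close>
  define g0 where "g0 x = h x (u0 x)" for x
  \<comment> \<open>At each x the sequence \<open>U\<close> eventually does at least as well as any
    given \<open>q k\<close>, and the \<open>q k\<close> determine the conjugate.\<close>
  have pt: "e2ennreal (g x - ereal (g0 x)) = (SUP n. ennreal (h x (U n x) - g0 x))" if x: "x \<in> \<Omega>" for x
  proof (rule antisym)
    have e: "e2ennreal (ereal c) = ennreal c" for c by (simp add: ennreal.rep_eq e2ennreal_def max_def ennreal_def)
    show "(SUP n. ennreal (h x (U n x) - g0 x)) \<le> e2ennreal (g x - ereal (g0 x))"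
    proof (rule SUP_least)
      fix n
      have "ereal (h x (U n x) - g0 x) \<le> g x - ereal (g0 x)"
        using hg[of x "U n x"] by (cases "g x") auto
      then have "e2ennreal (ereal (h x (U n x) - g0 x)) \<le> e2ennreal (g x - ereal (g0 x))" by (rule e2ennreal_mono)
      then show "ennreal (h x (U n x) - g0 x) \<le> e2ennreal (g x - ereal (g0 x))" by (simp add: e)
    qed
    show "e2ennreal (g x - ereal (g0 x)) \<le> (SUP n. ennreal (h x (U n x) - g0 x))"
    proof (cases "SUP n. ennreal (h x (U n x) - g0 x)")
      case (real s)
      have "h x (U n x) \<le> s + g0 x" for n
      proof -
        have "ennreal (h x (U n x) - g0 x) \<le> ennreal s"
          unfolding real(2)[symmetric] by (rule SUP_upper) simp
        then show ?thesis using real(1) by (simp add: ennreal_le_iff)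
      qed
      then have "h x (q k) \<le> s + g0 x" for k using hU_q[of x k] order_trans by blast
      then have "g x \<le> ereal (s + g0 x)" by (rule g_le[OF x])
      then have "g x - ereal (g0 x) \<le> ereal s" by (cases "g x") auto
      then have "e2ennreal (g x - ereal (g0 x)) \<le> e2ennreal (ereal s)" by (rule e2ennreal_mono)
      then show ?thesis by (simp add: e real(2))
    next
      case top
      then show ?thesis by (simp only: top_greatest)
    qed
  qed
  \<comment> \<open>The integrals produced by monotone convergence are values of <v, u> - F[u] at u
    = \<open>U n\<close>, less the value at \<open>u0\<close>, so the bound r applies to each of
    them.\<close>
  have upper: "ereal_integral ?M g \<le> ereal r" if r: "\<And>u. u \<in> L1 \<Omega> \<Longrightarrow> pairing \<Omega> v u - F_int u \<le> r" for r
  proof -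
    let ?c = "pairing \<Omega> v u0 - F_int u0"
    have "(\<integral>\<^sup>+x. e2ennreal (g x - ereal (g0 x)) \<partial>?M) = (\<integral>\<^sup>+x. (SUP n. ennreal (h x (U n x) - g0 x)) \<partial>?M)"
      by (intro nn_integral_cong pt) simp
    also have "\<dots> = (SUP n. \<integral>\<^sup>+x. ennreal (h x (U n x) - g0 x) \<partial>?M)"
    proof (rule nn_integral_monotone_convergence_SUP)
      show "incseq (\<lambda>n x. ennreal (h x (U n x) - g0 x))"
        by (intro monoI le_funI ennreal_leI diff_right_mono hU_mono)
      show "(\<lambda>x. ennreal (h x (U n x) - g0 x)) \<in> borel_measurable ?M" for n
        unfolding g0_def using borel_measurable_integrable[OF hi[OF UL]] borel_measurable_integrable[OF hi[OF u0]] by measurable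
    qed
    also have "\<dots> \<le> ennreal (r - ?c)"
    proof (rule SUP_least)
      fix n
      have "(\<integral>\<^sup>+x. ennreal (h x (U n x) - g0 x) \<partial>?M) = ennreal (LINT x|?M. h x (U n x) - g0 x)"
        using hi[OF UL[of n]] hi[OF u0] hU_mono[of 0 n]
        by (intro nn_integral_eq_integral) (auto simp: g0_def U_0 intro!: AE_I2)
      also have "(LINT x|?M. h x (U n x) - g0 x) = (pairing \<Omega> v (U n) - F_int (U n)) - ?c"
        unfolding g0_def using hi[OF UL[of n]] hi[OF u0] by (simp add: hI[OF UL] hI[OF u0])
      also have "ennreal \<dots> \<le> ennreal (r - ?c)" using r[OF UL[of n]] by (intro ennreal_leI) simp
      finally show "(\<integral>\<^sup>+x. ennreal (h x (U n x) - g0 x) \<partial>?M) \<le> ennreal (r - ?c)" .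
    qed
    finally have "enn2ereal (\<integral>\<^sup>+x. e2ennreal (g x - ereal (g0 x)) \<partial>?M) \<le> enn2ereal (ennreal (r - ?c))"
      by (simp add: less_eq_ennreal.rep_eq)
    also have "\<dots> = ereal (r - ?c)" using r[OF u0] by (simp add: enn2ereal_ennreal)
    finally have "ereal ?c + enn2ereal (\<integral>\<^sup>+x. e2ennreal (g x - ereal (g0 x)) \<partial>?M) \<le> ereal ?c + ereal (r - ?c)"
      by (rule add_left_mono)
    moreover have "ereal_integral ?M g = ereal ?c + enn2ereal (\<integral>\<^sup>+x. e2ennreal (g x - ereal (g0 x)) \<partial>?M)"
      using ereal_integral_eq_integral_plus[OF _ hi[OF u0] hg] by (simp add: hI[OF u0] g0_def)
    ultimately show ?thesis by simp
  qed
  have "ereal_integral ?M g = (SUP u\<in>L1 \<Omega>. ereal (pairing \<Omega> v u - F_int u))"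
  proof (rule antisym)
    show "(SUP u\<in>L1 \<Omega>. ereal (pairing \<Omega> v u - F_int u)) \<le> ereal_integral ?M g" by (intro SUP_least lower)
    show "ereal_integral ?M g \<le> (SUP u\<in>L1 \<Omega>. ereal (pairing \<Omega> v u - F_int u))"
    proof (cases "SUP u\<in>L1 \<Omega>. ereal (pairing \<Omega> v u - F_int u)")
      case (real r)
      have "pairing \<Omega> v u - F_int u \<le> r" if "u \<in> L1 \<Omega>" for u
        using SUP_upper[OF that, of "\<lambda>u. ereal (pairing \<Omega> v u - F_int u)"] by (simp add: real)
      then show ?thesis using upper real by simp
    next
      case MInf
      then show ?thesis using SUP_upper[OF u0, of "\<lambda>u. ereal (pairing \<Omega> v u - F_int u)"] by simp
    qed simp
  qed
  then show ?thesis by (simp add: g_def[abs_def])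
qed

end

section \<open>Duality\<close>

lemma seminorm_on_subset: "seminorm_on V N \<Longrightarrow> subspace W \<Longrightarrow> W \<subseteq> V \<Longrightarrow> seminorm_on W N"
  unfolding seminorm_on_def by blast

lemma seminorm_on_scale: "seminorm_on V N \<Longrightarrow> c \<ge> 0 \<Longrightarrow> seminorm_on V (\<lambda>x. c * N x)"
  unfolding seminorm_on_def by (auto simp: distrib_left[symmetric] mult_left_mono)

context diff_operator
begin

section \<open>Graph, bounded preimages and adjoint of the operator\<close>

lemma \<Omega>_lebesgue: "\<Omega> \<in> sets lebesgue"
  using open_\<Omega> by (rule open_in_lebesgue)

lemma op_graph_L1: "(u, p) \<in> op_graph \<Longrightarrow> u \<in> L1 \<Omega>" "(u, p) \<in> op_graph \<Longrightarrow> p \<in> L1 \<Omega>"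
  by (auto simp: op_graph_def)

lemma op_graph_add: "(u, p) \<in> op_graph \<Longrightarrow> (v, q) \<in> op_graph \<Longrightarrow> (u + v, p + q) \<in> op_graph"
  using subspace_add[OF subspace_op_graph, of "(u, p)" "(v, q)"] by simp

lemma op_graph_scaleR: "(u, p) \<in> op_graph \<Longrightarrow> (c *\<^sub>R u, c *\<^sub>R p) \<in> op_graph"
  using subspace_scale[OF subspace_op_graph, of "(u, p)" c] by simp

lemma op_graph_diff: "(u, p) \<in> op_graph \<Longrightarrow> (v, q) \<in> op_graph \<Longrightarrow> (u - v, p - q) \<in> op_graph"
  using subspace_diff[OF subspace_op_graph, of "(u, p)" "(v, q)"] by simp

lemma op_graph_unique:
  assumes "(u, p) \<in> op_graph" "(u, q) \<in> op_graph"
  shows "AE x in lebesgue_on \<Omega>. p x = q x"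
proof -
  have pq: "p \<in> L1 \<Omega>" "q \<in> L1 \<Omega>" using assms op_graph_L1 by blast+
  have "AE x in lebesgue_on \<Omega>. (p - q) x = 0"
  proof (rule test_functions_separate[OF open_\<Omega>])
    show "p - q \<in> L1 \<Omega>" using pq by (rule subspace_diff[OF subspace_L1])
    show "pairing \<Omega> \<phi> (p - q) = 0" if "\<phi> \<in> test_functions \<Omega>" for \<phi>
      using assms that pairing_diff[OF test_function_Linf[OF that] pq]
      by (simp add: op_graph_def has_distributional_image_def)
  qed
  then show ?thesis by (auto elim!: eventually_mono)
qed

lemma op_graph_cong_AE:
  assumes "(u, p) \<in> op_graph" "q \<in> L1 \<Omega>" "AE x in lebesgue_on \<Omega>. p x = q x"
  shows "(u, q) \<in> op_graph"
proof -
  have "pairing \<Omega> \<phi> p = pairing \<Omega> \<phi> q" if "\<phi> \<in> test_functions \<Omega>" for \<phi>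
    by (rule pairing_cong_AE[OF test_function_Linf[OF that] op_graph_L1(2)[OF assms(1)] assms(2,3)])
  then show ?thesis using assms by (auto simp: op_graph_def has_distributional_image_def)
qed

lemma WA1_iff: "u \<in> WA1 \<Omega> k A \<longleftrightarrow> (\<exists>p. (u, p) \<in> op_graph)"
  by (auto simp: WA1_def op_graph_def)

lemma apply_op_graph: "u \<in> WA1 \<Omega> k A \<Longrightarrow> (u, apply_op \<Omega> k A u) \<in> op_graph"
proof -
  assume u: "u \<in> WA1 \<Omega> k A"
  then have "\<exists>p. p \<in> L1 \<Omega> \<and> has_distributional_image \<Omega> k A u p" by (auto simp: WA1_def)
  then have "apply_op \<Omega> k A u \<in> L1 \<Omega> \<and> has_distributional_image \<Omega> k A u (apply_op \<Omega> k A u)"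
    unfolding apply_op_def by (rule someI_ex)
  then show ?thesis using u by (auto simp: op_graph_def WA1_def)
qed

lemma op_graph_iff:
  assumes "p \<in> L1 \<Omega>"
  shows "(u, p) \<in> op_graph \<longleftrightarrow> u \<in> WA1 \<Omega> k A \<and> (AE x in lebesgue_on \<Omega>. apply_op \<Omega> k A u x = p x)"
proof
  assume g: "(u, p) \<in> op_graph"
  then have u: "u \<in> WA1 \<Omega> k A" using WA1_iff by blast
  then show "u \<in> WA1 \<Omega> k A \<and> (AE x in lebesgue_on \<Omega>. apply_op \<Omega> k A u x = p x)"
    using op_graph_unique[OF apply_op_graph[OF u] g] by simp
next
  assume "u \<in> WA1 \<Omega> k A \<and> (AE x in lebesgue_on \<Omega>. apply_op \<Omega> k A u x = p x)"
  then show "(u, p) \<in> op_graph" using op_graph_cong_AE[OF apply_op_graph assms] by simp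
qed

lemma op_image_eq: "op_image \<Omega> k A = snd ` op_graph"
proof -
  have "p \<in> op_image \<Omega> k A \<longleftrightarrow> p \<in> snd ` op_graph" for p
  proof (cases "p \<in> L1 \<Omega>")
    case True
    then show ?thesis using op_graph_iff[OF True] by (force simp: op_image_def)
  next
    case False
    then show ?thesis using op_graph_L1(2) by (auto simp: op_image_def)
  qed
  then show ?thesis by blast
qed

lemma op_graph_sum:
  fixes n :: nat
  assumes "\<And>i. (u i, p i) \<in> op_graph"
  shows "((\<Sum>i<n. u i), (\<Sum>i<n. p i)) \<in> op_graph"
proof (induction n)
  case 0
  then show ?case using subspace_0[OF subspace_op_graph] by (simp add: zero_prod_def zero_fun_def)
next
  case (Suc n)
  show ?case using op_graph_add[OF Suc assms[of n]] by (simp only: sum.lessThan_Suc)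
qed

text \<open>Completeness of the range comes from (H1) and the completeness of L^1. The closedness
  requirement holds since summable preimages add up in L^1 and \<open>op_graph_closed\<close> keeps
  the limit in the graph.\<close>

lemma bounded_preimages:
  assumes H1: "strongly_closed \<Omega> (op_image \<Omega> k A)"
  obtains C where "C \<ge> 0" "\<And>q. q \<in> snd ` op_graph \<Longrightarrow> \<exists>u. (u, q) \<in> op_graph \<and> L1_norm \<Omega> u \<le> C * L1_norm \<Omega> q"
proof (rule seminorm_open_mapping[where G=op_graph and ?N1.0="L1_norm \<Omega>" and ?N2.0="L1_norm \<Omega>"])
  show "subspace op_graph" by (rule subspace_op_graph)
  show "seminorm_on (fst ` op_graph) (L1_norm \<Omega>)"
    by (rule seminorm_on_subset[OF seminorm_L1 linear_subspace_image[OF linear_fst subspace_op_graph]])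
      (auto simp: op_graph_def)
  show "seminorm_on (snd ` op_graph) (L1_norm \<Omega>)"
    by (rule seminorm_on_subset[OF seminorm_L1 linear_subspace_image[OF linear_snd subspace_op_graph]])
      (auto simp: op_graph_def)
next
  fix p :: "nat \<Rightarrow> real^'d \<Rightarrow> real^'n"
  assume p: "\<And>n. p n \<in> snd ` op_graph" and s: "summable (\<lambda>n. L1_norm \<Omega> (p n))"
  have pL: "p n \<in> L1 \<Omega>" for n using p[of n] op_graph_L1(2) by auto
  obtain q where q: "q \<in> L1 \<Omega>" "(\<lambda>n. L1_norm \<Omega> (q - (\<Sum>i<n. p i))) \<longlonglongrightarrow> 0"
    using L1_complete[OF pL s] by blast
  have "\<forall>n. \<exists>u. (u, p n) \<in> op_graph" using p by force
  then obtain u where u: "\<And>n. (u n, p n) \<in> op_graph" by metis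
  have "(\<Sum>i<n. p i) \<in> op_image \<Omega> k A" for n
    using op_graph_sum[of u p, OF u, of n] unfolding op_image_eq by force
  moreover have "(\<lambda>n. L1_norm \<Omega> (\<lambda>x. (\<Sum>i<n. p i) x - q x)) \<longlonglongrightarrow> 0"
    using q(2) by (simp add: L1_norm_def norm_minus_commute)
  ultimately have "q \<in> op_image \<Omega> k A"
    using H1[unfolded strongly_closed_def, THEN spec, of "\<lambda>n. \<Sum>i<n. p i", THEN bspec, OF q(1)] by simp
  then have "q \<in> snd ` op_graph" unfolding op_image_eq .
  with q show "\<exists>q\<in>snd ` op_graph. (\<lambda>n. L1_norm \<Omega> (q - (\<Sum>i<n. p i))) \<longlonglongrightarrow> 0" by blast
next
  fix u :: "nat \<Rightarrow> real^'d \<Rightarrow> real^'N" and p :: "nat \<Rightarrow> real^'d \<Rightarrow> real^'n" and q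
  assume up: "\<And>n. (u n, p n) \<in> op_graph" and s: "summable (\<lambda>n. L1_norm \<Omega> (u n))"
    and q: "q \<in> snd ` op_graph" "(\<lambda>n. L1_norm \<Omega> (q - (\<Sum>i<n. p i))) \<longlonglongrightarrow> 0"
  obtain v where v: "v \<in> L1 \<Omega>" "(\<lambda>n. L1_norm \<Omega> (v - (\<Sum>i<n. u i))) \<longlonglongrightarrow> 0"
    "L1_norm \<Omega> v \<le> (\<Sum>n. L1_norm \<Omega> (u n))"
    using L1_complete[of u \<Omega>, OF op_graph_L1(1)[OF up] s] by blast
  have "q \<in> L1 \<Omega>" using q(1) op_graph_L1(2) by auto
  then have "(v, q) \<in> op_graph" using op_graph_closed[OF op_graph_sum[OF up] v(1) _ v(2) q(2)] by blast
  with v show "\<exists>v. (v, q) \<in> op_graph \<and> L1_norm \<Omega> v \<le> (\<Sum>n. L1_norm \<Omega> (u n))" by blast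
qed (rule that)

text \<open>Membership in \<open>adjoint_domain\<close> bounds u |-> <w, A u> by the L^1 norm;
  Hahn-Banach extends it to L^1 and duality represents it by a bounded field. Hence the choice in
  the definition of \<open>adjoint_op\<close> has a witness.\<close>

lemma adjoint_op:
  assumes w: "w \<in> adjoint_domain \<Omega> k A"
  shows "adjoint_op \<Omega> k A w \<in> Linf \<Omega>"
    and "(u, p) \<in> op_graph \<Longrightarrow> pairing \<Omega> (adjoint_op \<Omega> k A w) u = pairing \<Omega> w p"
proof -
  obtain c where wL: "w \<in> Linf \<Omega>" and c: "c > 0"
    "\<And>u. u \<in> WA1 \<Omega> k A \<Longrightarrow> \<bar>pairing \<Omega> w (apply_op \<Omega> k A u)\<bar> \<le> c * L1_norm \<Omega> u"
    using w by (auto simp: adjoint_domain_def)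
  have pair: "pairing \<Omega> w (apply_op \<Omega> k A u) = pairing \<Omega> w p" if "(u, p) \<in> op_graph" for u p
  proof -
    have g: "(u, apply_op \<Omega> k A u) \<in> op_graph" using that WA1_iff apply_op_graph by blast
    show ?thesis
      by (rule pairing_cong_AE[OF wL op_graph_L1(2)[OF g] op_graph_L1(2)[OF that] op_graph_unique[OF g that]])
  qed
  define D where "D = {(u, pairing \<Omega> w p) | u p. (u, p) \<in> op_graph}"
  obtain l where l: "linear l" "\<And>u. u \<in> L1 \<Omega> \<Longrightarrow> l u \<le> c * L1_norm \<Omega> u" "\<And>u a. (u, a) \<in> D \<Longrightarrow> l u \<le> a"
  proof (rule Hahn_Banach_cone[where D=D and X="L1 \<Omega>" and N="\<lambda>u. c * L1_norm \<Omega> u"])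
    show "seminorm_on (L1 \<Omega>) (\<lambda>u. c * L1_norm \<Omega> u)"
      using c(1) by (intro seminorm_on_scale seminorm_L1) simp
    have "pairing \<Omega> w 0 = 0" by (simp add: pairing_def)
    then show "(0, 0) \<in> D" using subspace_0[OF subspace_op_graph] unfolding D_def by (force simp: zero_prod_def)
    show "u \<in> L1 \<Omega>" if "(u, a) \<in> D" for u a using that op_graph_L1(1) by (auto simp: D_def)
    show "(u + v, a + b) \<in> D" if D: "(u, a) \<in> D" "(v, b) \<in> D" for u a v b
    proof -
      obtain p q where pq: "(u, p) \<in> op_graph" "(v, q) \<in> op_graph" "a = pairing \<Omega> w p" "b = pairing \<Omega> w q"
        using D by (auto simp: D_def)
      then have "pairing \<Omega> w (p + q) = a + b" using pairing_add[OF wL] op_graph_L1(2) by metis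
      then show ?thesis using op_graph_add[OF pq(1,2)] unfolding D_def by force
    qed
    show "(t *\<^sub>R u, t * a) \<in> D" if D: "(u, a) \<in> D" for u a t
    proof -
      obtain p where p: "(u, p) \<in> op_graph" "a = pairing \<Omega> w p" using D by (auto simp: D_def)
      then have "pairing \<Omega> w (t *\<^sub>R p) = t * a" by (simp add: pairing_scaleR)
      then show ?thesis using op_graph_scaleR[OF p(1), of t] unfolding D_def by force
    qed
    show "0 \<le> a + c * L1_norm \<Omega> u" if D: "(u, a) \<in> D" for u a
    proof -
      obtain p where p: "(u, p) \<in> op_graph" "a = pairing \<Omega> w p" using D by (auto simp: D_def)
      then show ?thesis using c(2)[of u] pair[OF p(1)] WA1_iff by force
    qed
  qed blast
  \<comment> \<open>\<open>D\<close> is the graph of a linear functional, so the bounds at u and at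
    - u together give equality.\<close>
  have lp: "l u = pairing \<Omega> w p" if g: "(u, p) \<in> op_graph" for u p
  proof (rule antisym)
    show "l u \<le> pairing \<Omega> w p" using g by (intro l(3)) (auto simp: D_def)
    have "l ((-1) *\<^sub>R u) \<le> pairing \<Omega> w ((-1) *\<^sub>R p)" using op_graph_scaleR[OF g, of "-1"] by (intro l(3)) (auto simp: D_def)
    then show "pairing \<Omega> w p \<le> l u" unfolding linear_scale[OF l(1)] pairing_scaleR by simp
  qed
  obtain v where v: "v \<in> Linf \<Omega>" "\<And>u. u \<in> L1 \<Omega> \<Longrightarrow> l u = pairing \<Omega> v u"
    using L1_dual[OF \<Omega>_lebesgue l(1,2)] by blast
  have "\<exists>v. v \<in> Linf \<Omega> \<and> (\<forall>u\<in>WA1 \<Omega> k A. pairing \<Omega> v u = pairing \<Omega> w (apply_op \<Omega> k A u))"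
    using v lp apply_op_graph op_graph_L1(1) by metis
  note * = someI_ex[OF this, folded adjoint_op_def]
  show "adjoint_op \<Omega> k A w \<in> Linf \<Omega>" using * by (rule conjunct1)
  assume g: "(u, p) \<in> op_graph"
  then have "u \<in> WA1 \<Omega> k A" using WA1_iff by blast
  then show "pairing \<Omega> (adjoint_op \<Omega> k A w) u = pairing \<Omega> w p"
    using bspec[OF conjunct2[OF *]] pair[OF g] by simp
qed

end

section \<open>The conjugate of the perturbation and the dual problem\<close>

locale dual_problem = diff_operator \<Omega> k A + linear_growth_integrand \<Omega> f M
  for \<Omega> :: "(real^'d::finite) set" and k :: nat and A :: "('d::finite, 'N::finite, 'n::finite) coefficients"
    and f :: "real^'d \<Rightarrow> real^'N \<Rightarrow> real" and M :: real +
  fixes u0 :: "real^'d \<Rightarrow> real^'N" and \<tau> :: "real^'d \<Rightarrow> real^'n"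
  assumes closed_image: "strongly_closed \<Omega> (op_image \<Omega> k A)"
    and u0\<tau>: "(u0, \<tau>) \<in> op_graph"
begin

lemma \<tau>_L1: "\<tau> \<in> L1 \<Omega>"
  using u0\<tau> by (rule op_graph_L1)

lemma primal_feasible_iff: "u \<in> primal_feasible \<Omega> k A \<tau> \<longleftrightarrow> (u, \<tau>) \<in> op_graph"
  by (simp add: primal_feasible_def op_graph_iff[OF \<tau>_L1])

lemma perturbation_eq:
  assumes "p \<in> L1 \<Omega>"
  shows "perturbation \<Omega> k A f \<tau> u p = (if (u, \<tau> + p) \<in> op_graph then ereal (F_int u) else \<infinity>)"
proof -
  have "\<tau> + p \<in> L1 \<Omega>" using \<tau>_L1 assms by (rule subspace_add[OF subspace_L1])
  then have "(u, \<tau> + p) \<in> op_graph \<longleftrightarrow> u \<in> WA1 \<Omega> k A \<and> (AE x in lebesgue_on \<Omega>. apply_op \<Omega> k A u x - p x = \<tau> x)"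
    by (simp add: op_graph_iff diff_eq_eq)
  then show ?thesis
    using primal_functional_eq op_graph_L1(1) by (auto simp: perturbation_def)
qed

text \<open>The substitution r = \<tau> + p turns the constraint into membership in the graph; all
  other pairs contribute -\<infinity>.\<close>

lemma perturbation_conjugate_eq:
  assumes w: "w \<in> Linf \<Omega>"
  shows "perturbation_conjugate \<Omega> k A f \<tau> (\<lambda>x. 0) w =
    (SUP (u, r)\<in>op_graph. ereal (pairing \<Omega> w (r - \<tau>) - F_int u))"
  unfolding perturbation_conjugate_def
proof (rule antisym)
  have p0: "pairing \<Omega> (\<lambda>x. 0) u = 0" for u :: "real^'d \<Rightarrow> real^'N" by (simp add: pairing_def)
  show "(SUP (u, p)\<in>L1 \<Omega> \<times> L1 \<Omega>. ereal (pairing \<Omega> (\<lambda>x. 0) u + pairing \<Omega> w p) - perturbation \<Omega> k A f \<tau> u p)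
     \<le> (SUP (u, r)\<in>op_graph. ereal (pairing \<Omega> w (r - \<tau>) - F_int u))"
  proof (rule SUP_least, clarify)
    fix u :: "real^'d \<Rightarrow> real^'N" and p :: "real^'d \<Rightarrow> real^'n" assume "u \<in> L1 \<Omega>" and p: "p \<in> L1 \<Omega>"
    show "ereal (pairing \<Omega> (\<lambda>x. 0) u + pairing \<Omega> w p) - perturbation \<Omega> k A f \<tau> u p
       \<le> (SUP (u, r)\<in>op_graph. ereal (pairing \<Omega> w (r - \<tau>) - F_int u))"
    proof (cases "(u, \<tau> + p) \<in> op_graph")
      case True
      then have "ereal (pairing \<Omega> w ((\<tau> + p) - \<tau>) - F_int u) \<le> (SUP (u, r)\<in>op_graph. ereal (pairing \<Omega> w (r - \<tau>) - F_int u))"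
        by (rule SUP_upper2) simp
      then show ?thesis using True by (simp add: perturbation_eq[OF p] p0)
    qed (simp add: perturbation_eq[OF p])
  qed
  show "(SUP (u, r)\<in>op_graph. ereal (pairing \<Omega> w (r - \<tau>) - F_int u))
     \<le> (SUP (u, p)\<in>L1 \<Omega> \<times> L1 \<Omega>. ereal (pairing \<Omega> (\<lambda>x. 0) u + pairing \<Omega> w p) - perturbation \<Omega> k A f \<tau> u p)"
  proof (rule SUP_least, clarify)
    fix u r assume g: "(u, r) \<in> op_graph"
    have p: "r - \<tau> \<in> L1 \<Omega>" using op_graph_L1(2)[OF g] \<tau>_L1 by (rule subspace_diff[OF subspace_L1])
    show "ereal (pairing \<Omega> w (r - \<tau>) - F_int u)
       \<le> (SUP (u, p)\<in>L1 \<Omega> \<times> L1 \<Omega>. ereal (pairing \<Omega> (\<lambda>x. 0) u + pairing \<Omega> w p) - perturbation \<Omega> k A f \<tau> u p)"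
      using op_graph_L1(1)[OF g] p g by (intro SUP_upper2[of "(u, r - \<tau>)"]) (auto simp: perturbation_eq[OF p] p0)
  qed
qed

text \<open>A finite supremum bounds <w, A u> by an affine function of the norm of u, since F
  exceeds F[0] by at most M times that norm. Multiples of (u, r) stay in the graph, and large ones
  remove the additive constant, leaving the bound with M.\<close>

lemma conjugate_finite_imp_adjoint_domain:
  assumes w: "w \<in> Linf \<Omega>" and b: "\<And>u r. (u, r) \<in> op_graph \<Longrightarrow> pairing \<Omega> w (r - \<tau>) - F_int u \<le> b"
  shows "w \<in> adjoint_domain \<Omega> k A"
proof -
  define c where "c = b + pairing \<Omega> w \<tau> + F_int 0"
  have L0: "(0 :: real^'d \<Rightarrow> real^'N) \<in> L1 \<Omega>" by (rule subspace_0[OF subspace_L1])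
  have affine: "pairing \<Omega> w r \<le> c + M * L1_norm \<Omega> u" if g: "(u, r) \<in> op_graph" for u r
    using b[OF g] F_int_lipschitz[OF op_graph_L1(1)[OF g] L0] pairing_diff[OF w op_graph_L1(2)[OF g] \<tau>_L1]
    by (simp add: c_def)
  have le: "pairing \<Omega> w r \<le> M * L1_norm \<Omega> u" if g: "(u, r) \<in> op_graph" for u r
  proof (rule ccontr)
    define d where "d = pairing \<Omega> w r - M * L1_norm \<Omega> u"
    assume "\<not> ?thesis"
    then have d: "d > 0" by (simp add: d_def)
    \<comment> \<open>At this multiple the surplus t d equals |c| + 1 and exceeds the additive
      constant c.\<close>
    define t where "t = (\<bar>c\<bar> + 1) / d"
    have t: "t > 0" using d by (simp add: t_def)
    have "t * pairing \<Omega> w r \<le> c + M * (t * L1_norm \<Omega> u)"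
      using affine[OF op_graph_scaleR[OF g, of t]] seminorm_onD(4)[OF seminorm_L1 op_graph_L1(1)[OF g], of t] t
      by (simp add: pairing_scaleR)
    then have "t * d \<le> c" by (simp add: d_def algebra_simps)
    then show False using d by (simp add: t_def)
  qed
  have "\<bar>pairing \<Omega> w (apply_op \<Omega> k A u)\<bar> \<le> M * L1_norm \<Omega> u" if "u \<in> WA1 \<Omega> k A" for u
  proof -
    note g = apply_op_graph[OF that]
    have "- pairing \<Omega> w (apply_op \<Omega> k A u) \<le> M * L1_norm \<Omega> u"
      using le[OF op_graph_scaleR[OF g, of "-1"]] seminorm_onD(4)[OF seminorm_L1 op_graph_L1(1)[OF g], of "-1"]
      unfolding pairing_scaleR by simp
    then show ?thesis using le[OF g] by (simp add: abs_le_iff)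
  qed
  then show ?thesis using w M unfolding adjoint_domain_def by blast
qed

text \<open>The functional u |-> <v, u> - F[u] is Lipschitz on L^1 with constant C + M, so a test
  function within e / (C + M) of u loses at most e.\<close>

lemma SUP_op_graph_eq_SUP_L1:
  assumes v: "v \<in> Linf \<Omega>"
  shows "(SUP (u, r)\<in>op_graph. ereal (pairing \<Omega> v u - F_int u)) = (SUP u\<in>L1 \<Omega>. ereal (pairing \<Omega> v u - F_int u))"
proof (rule antisym)
  show "(SUP (u, r)\<in>op_graph. ereal (pairing \<Omega> v u - F_int u)) \<le> (SUP u\<in>L1 \<Omega>. ereal (pairing \<Omega> v u - F_int u))"
    using op_graph_L1(1) by (intro SUP_least) (auto intro: SUP_upper2)
  obtain C where C: "C \<ge> 0" "\<And>u. u \<in> L1 \<Omega> \<Longrightarrow> \<bar>pairing \<Omega> v u\<bar> \<le> C * L1_norm \<Omega> u" using pairing_bound[OF v] by blast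
  show "(SUP u\<in>L1 \<Omega>. ereal (pairing \<Omega> v u - F_int u)) \<le> (SUP (u, r)\<in>op_graph. ereal (pairing \<Omega> v u - F_int u))"
  proof (rule SUP_least, rule ereal_le_epsilon2)
    fix u :: "real^'d \<Rightarrow> real^'N" and e :: real assume u: "u \<in> L1 \<Omega>" and e: "e > 0"
    have CM: "C + M > 0" using C(1) M by simp
    obtain \<phi> where \<phi>: "\<phi> \<in> test_functions \<Omega>" "L1_norm \<Omega> (u - \<phi>) < e / (C + M)"
      using test_functions_dense_L1[OF open_\<Omega> u, of "e / (C + M)"] e CM by auto
    obtain p where p: "(\<phi>, p) \<in> op_graph" using test_function_in_op_graph[OF \<phi>(1)] by blast
    have \<phi>L: "\<phi> \<in> L1 \<Omega>" using op_graph_L1(1)[OF p] .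
    have "(pairing \<Omega> v u - F_int u) - (pairing \<Omega> v \<phi> - F_int \<phi>) \<le> C * L1_norm \<Omega> (u - \<phi>) + M * L1_norm \<Omega> (u - \<phi>)"
      using C(2)[OF subspace_diff[OF subspace_L1 u \<phi>L]] F_int_lipschitz[OF u \<phi>L] pairing_diff[OF v u \<phi>L] by linarith
    also have "\<dots> = (C + M) * L1_norm \<Omega> (u - \<phi>)" by (simp add: algebra_simps)
    also have "\<dots> \<le> e" using \<phi>(2) CM by (simp add: field_simps)
    finally have "ereal (pairing \<Omega> v u - F_int u) \<le> ereal (pairing \<Omega> v \<phi> - F_int \<phi>) + ereal e" by simp
    also have "ereal (pairing \<Omega> v \<phi> - F_int \<phi>) \<le> (SUP (u, r)\<in>op_graph. ereal (pairing \<Omega> v u - F_int u))"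
      using p by (rule SUP_upper2) simp
    finally show "ereal (pairing \<Omega> v u - F_int u) \<le> (SUP (u, r)\<in>op_graph. ereal (pairing \<Omega> v u - F_int u)) + ereal e"
      by (simp add: add_right_mono)
  qed
qed

text \<open>On the domain of the adjoint <w, A u> = <v, u> with v =
  \<open>adjoint_op \<Omega> k A w\<close>, so the conjugate is that of F at v minus <w, \<tau>>.
  Off it, a finite value is excluded by \<open>conjugate_finite_imp_adjoint_domain\<close> and
  -\<infinity> by the competitor u0.\<close>

theorem minus_perturbation_conjugate:
  assumes w: "w \<in> Linf \<Omega>"
  shows "- perturbation_conjugate \<Omega> k A f \<tau> (\<lambda>x. 0) w =
    (if w \<in> adjoint_domain \<Omega> k A then dual_functional \<Omega> k A f \<tau> w else - \<infinity>)"
proof (cases "w \<in> adjoint_domain \<Omega> k A")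
  case True
  define v where "v = adjoint_op \<Omega> k A w"
  have v: "v \<in> Linf \<Omega>" "\<And>u p. (u, p) \<in> op_graph \<Longrightarrow> pairing \<Omega> v u = pairing \<Omega> w p"
    unfolding v_def using adjoint_op[OF True] by blast+
  define S where "S = (SUP u\<in>L1 \<Omega>. ereal (pairing \<Omega> v u - F_int u))"
  have "(SUP (u, r)\<in>op_graph. ereal (pairing \<Omega> w (r - \<tau>) - F_int u)) =
      (SUP (u, r)\<in>op_graph. ereal (pairing \<Omega> v u - F_int u) + ereal (- pairing \<Omega> w \<tau>))"
  proof (rule SUP_cong[OF refl])
    fix x assume "x \<in> op_graph"
    then obtain u r where x: "x = (u, r)" "(u, r) \<in> op_graph" by (cases x) auto
    then show "(case x of (u, r) \<Rightarrow> ereal (pairing \<Omega> w (r - \<tau>) - F_int u)) =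
       (case x of (u, r) \<Rightarrow> ereal (pairing \<Omega> v u - F_int u) + ereal (- pairing \<Omega> w \<tau>))"
      using pairing_diff[OF w op_graph_L1(2)[OF x(2)] \<tau>_L1] v(2)[OF x(2)] by simp
  qed
  also have "\<dots> = (SUP x\<in>op_graph. (case x of (u, r) \<Rightarrow> ereal (pairing \<Omega> v u - F_int u)) + ereal (- pairing \<Omega> w \<tau>))"
    by (simp add: case_prod_unfold)
  also have "\<dots> = S + ereal (- pairing \<Omega> w \<tau>)"
    unfolding S_def SUP_op_graph_eq_SUP_L1[OF v(1), symmetric] using u0\<tau> by (intro SUP_ereal_add_left) auto
  finally have "perturbation_conjugate \<Omega> k A f \<tau> (\<lambda>x. 0) w = S + ereal (- pairing \<Omega> w \<tau>)"
    unfolding perturbation_conjugate_eq[OF w] .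
  moreover have "dual_functional \<Omega> k A f \<tau> w = ereal (pairing \<Omega> w \<tau>) - S"
    unfolding dual_functional_def S_def v_def[symmetric] integral_fenchel_conjugate[OF v(1)] by (rule refl)
  ultimately show ?thesis using True by (cases S) auto
next
  case False
  define S where "S = (SUP (u, r)\<in>op_graph. ereal (pairing \<Omega> w (r - \<tau>) - F_int u))"
  have S: "ereal (pairing \<Omega> w (r - \<tau>) - F_int u) \<le> S" if "(u, r) \<in> op_graph" for u r
    unfolding S_def using that by (rule SUP_upper2) simp
  have "S = \<infinity>"
  proof (cases S)
    case (real b)
    then have "w \<in> adjoint_domain \<Omega> k A"
      using S by (intro conjugate_finite_imp_adjoint_domain[OF w, of b]) auto
    then show ?thesis using False by simp
  next
    case MInf
    then show ?thesis using S[OF u0\<tau>] by simp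
  qed
  then show ?thesis using False by (simp add: perturbation_conjugate_eq[OF w] S_def)
qed

lemma weak_duality:
  assumes w: "w \<in> Linf \<Omega>" and u: "u \<in> primal_feasible \<Omega> k A \<tau>"
  shows "- perturbation_conjugate \<Omega> k A f \<tau> (\<lambda>x. 0) w \<le> primal_functional \<Omega> f u"
proof -
  have g: "(u, \<tau>) \<in> op_graph" using u by (simp add: primal_feasible_iff)
  have "ereal (pairing \<Omega> w (\<tau> - \<tau>) - F_int u) \<le> perturbation_conjugate \<Omega> k A f \<tau> (\<lambda>x. 0) w"
    unfolding perturbation_conjugate_eq[OF w] using g by (rule SUP_upper2) simp
  then have "ereal (- F_int u) \<le> perturbation_conjugate \<Omega> k A f \<tau> (\<lambda>x. 0) w" by (simp add: pairing_def)
  then show ?thesis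
    unfolding primal_functional_eq[OF op_graph_L1(1)[OF g]] by (simp add: ereal_uminus_le_reorder)
qed

text \<open>A bounded functional l with l (r - \<tau>) \<le> F[u] - m on the graph is a subgradient
  at 0 of the value function restricted to the image. The field representing it has conjugate at
  most - m, which is the bound sought.\<close>

theorem dual_attained:
  obtains w where "w \<in> Linf \<Omega>"
    "(INF u\<in>primal_feasible \<Omega> k A \<tau>. primal_functional \<Omega> f u) \<le> - perturbation_conjugate \<Omega> k A f \<tau> (\<lambda>x. 0) w"
proof -
  define X where "X = (INF u\<in>primal_feasible \<Omega> k A \<tau>. primal_functional \<Omega> f u)"
  have XF: "X \<le> ereal (F_int u)" if "(u, \<tau>) \<in> op_graph" for u
    unfolding X_def primal_functional_eq[OF op_graph_L1(1)[OF that], symmetric]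
    using that by (intro INF_lower) (simp add: primal_feasible_iff)
  have "0 \<le> X" unfolding X_def
    using F_int_nonneg primal_functional_eq op_graph_L1(1) by (intro INF_greatest) (auto simp: primal_feasible_iff)
  \<comment> \<open>The feasible field \<open>u0\<close> bounds the value from above and
    nonnegativity from below, so it is a real number.\<close>
  then obtain m where Xm: "X = ereal m" using XF[OF u0\<tau>] by (cases X) auto
  obtain C where C: "C \<ge> 0" "\<And>q. q \<in> snd ` op_graph \<Longrightarrow> \<exists>u. (u, q) \<in> op_graph \<and> L1_norm \<Omega> u \<le> C * L1_norm \<Omega> q"
    using bounded_preimages[OF closed_image] by blast
  define K where "K = M * C"
  have K: "K \<ge> 0" using C(1) M by (simp add: K_def)
  \<comment> \<open>A preimage v of \<tau> - r with norm at most C ||r - \<tau>|| corrects u to the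
    feasible field u + v, and F changes by at most M times the norm of v.\<close>
  have key: "m \<le> F_int u + K * L1_norm \<Omega> (r - \<tau>)" if g: "(u, r) \<in> op_graph" for u r
  proof -
    have "(u0 - u, \<tau> - r) \<in> op_graph" by (rule op_graph_diff[OF u0\<tau> g])
    then have "\<tau> - r \<in> snd ` op_graph" by force
    then obtain v where v: "(v, \<tau> - r) \<in> op_graph" "L1_norm \<Omega> v \<le> C * L1_norm \<Omega> (\<tau> - r)" using C(2) by blast
    have "(u + v, \<tau>) \<in> op_graph" using op_graph_add[OF g v(1)] by simp
    then have "m \<le> F_int (u + v)" using XF by (simp add: Xm)
    also have "\<dots> \<le> F_int u + M * L1_norm \<Omega> v"
      using F_int_lipschitz[OF subspace_add[OF subspace_L1 op_graph_L1(1)[OF g] op_graph_L1(1)[OF v(1)]] op_graph_L1(1)[OF g]]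
      by simp
    also have "M * L1_norm \<Omega> v \<le> M * (C * L1_norm \<Omega> (\<tau> - r))" using v(2) M by (intro mult_left_mono) auto
    also have "L1_norm \<Omega> (\<tau> - r) = L1_norm \<Omega> (r - \<tau>)"
      by (rule seminorm_onD(8)[OF seminorm_L1 \<tau>_L1 op_graph_L1(2)[OF g]])
    finally show ?thesis by (simp add: K_def mult.assoc)
  qed
  \<comment> \<open>The convex cone generated by the pairs (r - \<tau>, a) with a \<ge> F[u] - m;
    \<open>key\<close> is the compatibility with the seminorm that \<open>Hahn_Banach_cone\<close>
    asks for.\<close>
  define D where "D = {(t *\<^sub>R (r - \<tau>), a) | t u r a. t \<ge> 0 \<and> (u, r) \<in> op_graph \<and> t * (F_int u - m) \<le> a}"
  have DI: "(t *\<^sub>R (r - \<tau>), a) \<in> D" if "t \<ge> 0" "(u, r) \<in> op_graph" "t * (F_int u - m) \<le> a" for t u r a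
    using that unfolding D_def by blast
  obtain l where l: "linear l" "\<And>p. p \<in> L1 \<Omega> \<Longrightarrow> l p \<le> K * L1_norm \<Omega> p" "\<And>p a. (p, a) \<in> D \<Longrightarrow> l p \<le> a"
  proof (rule Hahn_Banach_cone[where D=D and X="L1 \<Omega>" and N="\<lambda>u. K * L1_norm \<Omega> u"])
    show "seminorm_on (L1 \<Omega>) (\<lambda>u. K * L1_norm \<Omega> u)"
      using K by (intro seminorm_on_scale seminorm_L1)
    show "(0, 0) \<in> D" using DI[OF _ u0\<tau>, of 0 0] by simp
    show "p \<in> L1 \<Omega>" if pa: "(p, a) \<in> D" for p a
    proof -
      obtain t u r where "p = t *\<^sub>R (r - \<tau>)" "(u, r) \<in> op_graph" using pa by (auto simp: D_def)
      then show ?thesis using \<tau>_L1 op_graph_L1(2) subspace_scale[OF subspace_L1] subspace_diff[OF subspace_L1] by metis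
    qed
    show "(p + q, a + b) \<in> D" if D: "(p, a) \<in> D" "(q, b) \<in> D" for p a q b
    proof -
      obtain t u r where 1: "p = t *\<^sub>R (r - \<tau>)" "t \<ge> 0" "(u, r) \<in> op_graph" "t * (F_int u - m) \<le> a"
        using D(1) by (auto simp: D_def)
      obtain t' u' r' where 2: "q = t' *\<^sub>R (r' - \<tau>)" "t' \<ge> 0" "(u', r') \<in> op_graph" "t' * (F_int u' - m) \<le> b"
        using D(2) by (auto simp: D_def)
      show ?thesis
      proof (cases "t + t' = 0")
        case True
        then have "t = 0" "t' = 0" using 1(2) 2(2) by auto
        then show ?thesis using 1 2 DI[OF _ u0\<tau>, of 0 "a + b"] by simp
      next
        case False
        \<comment> \<open>Division by the total weight turns the sum into a convex combination, to
          which convexity of F applies.\<close>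
        define s where "s = t + t'"
        have s: "s > 0" using False 1(2) 2(2) by (simp add: s_def)
        define \<alpha> where "\<alpha> = t / s"
        define \<beta> where "\<beta> = t' / s"
        have ab: "\<alpha> \<ge> 0" "\<beta> \<ge> 0" "\<alpha> + \<beta> = 1" "s * \<alpha> = t" "s * \<beta> = t'"
          using s 1(2) 2(2) by (auto simp: \<alpha>_def \<beta>_def add_divide_distrib[symmetric] s_def)
        have "s * (F_int (\<alpha> *\<^sub>R u + \<beta> *\<^sub>R u') - m) \<le> s * (\<alpha> * F_int u + \<beta> * F_int u' - m)"
          using F_int_convex[OF op_graph_L1(1)[OF 1(3)] op_graph_L1(1)[OF 2(3)] ab(1-3)] s by (intro mult_left_mono) auto
        also have "\<dots> = (s * \<alpha>) * F_int u + (s * \<beta>) * F_int u' - s * m" by (simp add: algebra_simps)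
        also have "\<dots> = t * (F_int u - m) + t' * (F_int u' - m)" unfolding ab by (simp add: s_def algebra_simps)
        also have "\<dots> \<le> a + b" using 1 2 by simp
        finally have "(s *\<^sub>R ((\<alpha> *\<^sub>R r + \<beta> *\<^sub>R r') - \<tau>), a + b) \<in> D"
          using s op_graph_add[OF op_graph_scaleR[OF 1(3), of \<alpha>] op_graph_scaleR[OF 2(3), of \<beta>]] by (intro DI) auto
        also have "s *\<^sub>R ((\<alpha> *\<^sub>R r + \<beta> *\<^sub>R r') - \<tau>) = (s * \<alpha>) *\<^sub>R r + (s * \<beta>) *\<^sub>R r' - s *\<^sub>R \<tau>"
          by (simp add: scaleR_add_right scaleR_diff_right)
        also have "\<dots> = p + q" unfolding ab 1(1) 2(1) by (simp add: s_def scaleR_add_left scaleR_diff_right)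
        finally show ?thesis .
      qed
    qed
    show "(c *\<^sub>R p, c * a) \<in> D" if pa: "(p, a) \<in> D" and c: "c > 0" for p a c
    proof -
      obtain t u r where 1: "p = t *\<^sub>R (r - \<tau>)" "t \<ge> 0" "(u, r) \<in> op_graph" "t * (F_int u - m) \<le> a"
        using pa by (auto simp: D_def)
      have "c * t * (F_int u - m) \<le> c * a" using 1(4) c by (simp add: mult.assoc)
      then have "((c * t) *\<^sub>R (r - \<tau>), c * a) \<in> D" using 1 c by (intro DI) auto
      then show ?thesis by (simp add: 1(1))
    qed
    show "0 \<le> a + K * L1_norm \<Omega> p" if pa: "(p, a) \<in> D" for p a
    proof -
      obtain t u r where 1: "p = t *\<^sub>R (r - \<tau>)" "t \<ge> 0" "(u, r) \<in> op_graph" "t * (F_int u - m) \<le> a"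
        using pa by (auto simp: D_def)
      have "L1_norm \<Omega> p = t * L1_norm \<Omega> (r - \<tau>)"
        using seminorm_onD(4)[OF seminorm_L1 subspace_diff[OF subspace_L1 op_graph_L1(2)[OF 1(3)] \<tau>_L1], of t] 1(1,2) by simp
      moreover have "0 \<le> t * (F_int u + K * L1_norm \<Omega> (r - \<tau>) - m)" using key[OF 1(3)] 1(2) by simp
      ultimately show ?thesis using 1(4) by (simp add: algebra_simps)
    qed
  qed blast
  obtain w where w: "w \<in> Linf \<Omega>" "\<And>p. p \<in> L1 \<Omega> \<Longrightarrow> l p = pairing \<Omega> w p"
    using L1_dual[OF \<Omega>_lebesgue l(1,2)] by blast
  have "perturbation_conjugate \<Omega> k A f \<tau> (\<lambda>x. 0) w \<le> ereal (- m)"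
    unfolding perturbation_conjugate_eq[OF w(1)]
  proof (rule SUP_least, clarify)
    fix u r assume g: "(u, r) \<in> op_graph"
    have "l (r - \<tau>) \<le> F_int u - m" using DI[OF _ g, of 1 "F_int u - m"] by (intro l(3)) simp
    then show "ereal (pairing \<Omega> w (r - \<tau>) - F_int u) \<le> ereal (- m)"
      using w(2)[OF subspace_diff[OF subspace_L1 op_graph_L1(2)[OF g] \<tau>_L1]] by simp
  qed
  then have "X \<le> - perturbation_conjugate \<Omega> k A f \<tau> (\<lambda>x. 0) w"
    unfolding Xm by (cases "perturbation_conjugate \<Omega> k A f \<tau> (\<lambda>x. 0) w") auto
  then show ?thesis using that w(1) unfolding X_def by blast
qed

end

text \<open>The first two conjuncts express duality with respect to the perturbation: its slice at p
  = 0 is the constrained primal functional, and minus its conjugate is the dual functional, extended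
  by -\<infinity>. Finiteness at one field excludes an identically infinite primal functional, in
  which case the two values can differ.\<close>

theorem theorem1p1:
  fixes \<Omega> :: "(real^'d::finite) set"
    and k :: nat
    and A :: "('d::finite, 'N::finite, 'n::finite) coefficients"
    and u0 :: "real^'d \<Rightarrow> real^'N"
    and \<tau> :: "real^'d \<Rightarrow> real^'n"
    and f :: "real^'d \<Rightarrow> real^'N \<Rightarrow> real"
    and M :: real
  assumes "open \<Omega>"
    and "frontier \<Omega> \<in> null_sets lebesgue"
    and "admissible_coefficients \<Omega> k A"
    and H1: "strongly_closed \<Omega> (op_image \<Omega> k A)"
    and H2: "\<And>\<mu>. \<mu> \<in> vector_measures \<Omega> \<Longrightarrow> annihilated_measure \<Omega> k A \<mu> \<Longrightarrow>
               \<exists>u. (\<forall>j. u j \<in> op_kernel \<Omega> k A) \<and>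
                   area_strictly_converges \<Omega> (\<lambda>j. abs_cont_measure (u j)) \<mu>"
    and "u0 \<in> WA1 \<Omega> k A"
    and \<tau>: "\<tau> = apply_op \<Omega> k A u0"
    and "continuous_on (\<Omega> \<times> UNIV) (\<lambda>(x, z). f x z)"
    and "\<And>x z. x \<in> \<Omega> \<Longrightarrow> 0 \<le> f x z"
    and "\<And>x. x \<in> \<Omega> \<Longrightarrow> convex_on UNIV (f x)"
    and "M > 0"
    and "\<And>x z. x \<in> \<Omega> \<Longrightarrow> 1 / M * (norm z - 1) \<le> \<bar>f x z\<bar> \<and> \<bar>f x z\<bar> \<le> M * (1 + norm z)"
    and finite_somewhere: "\<exists>u\<in>L1 \<Omega>. primal_functional \<Omega> f u < \<infinity>"
  shows "(\<forall>u\<in>L1 \<Omega>. perturbation \<Omega> k A f \<tau> u (\<lambda>x. 0) =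
            (if u \<in> primal_feasible \<Omega> k A \<tau> then primal_functional \<Omega> f u else \<infinity>)) \<and>
         (\<forall>w\<in>Linf \<Omega>. - perturbation_conjugate \<Omega> k A f \<tau> (\<lambda>x. 0) w =
            (if w \<in> adjoint_domain \<Omega> k A then dual_functional \<Omega> k A f \<tau> w else - \<infinity>)) \<and>
         (INF u\<in>primal_feasible \<Omega> k A \<tau>. primal_functional \<Omega> f u) =
            (SUP w\<in>adjoint_domain \<Omega> k A. dual_functional \<Omega> k A f \<tau> w) \<and>
         (\<exists>w\<in>adjoint_domain \<Omega> k A. dual_functional \<Omega> k A f \<tau> w =
            (SUP w'\<in>adjoint_domain \<Omega> k A. dual_functional \<Omega> k A f \<tau> w'))"
proof -
  interpret op: diff_operator \<Omega> k A using assms(1,3) by unfold_locales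
  have growth: "f x z \<le> M * (1 + norm z)" if "x \<in> \<Omega>" for x z
    using assms(12)[OF that, of z] by linarith
  interpret dual_problem \<Omega> k A f M u0 \<tau>
    using assms growth op.apply_op_graph by unfold_locales auto
  let ?R = "dual_functional \<Omega> k A f \<tau>" and ?D = "adjoint_domain \<Omega> k A"
  let ?P = "INF u\<in>primal_feasible \<Omega> k A \<tau>. primal_functional \<Omega> f u"
  have DL: "?D \<subseteq> Linf \<Omega>" by (auto simp: adjoint_domain_def)
  have primal: "\<forall>u\<in>L1 \<Omega>. perturbation \<Omega> k A f \<tau> u (\<lambda>x. 0) =
      (if u \<in> primal_feasible \<Omega> k A \<tau> then primal_functional \<Omega> f u else \<infinity>)"
    by (simp add: perturbation_def primal_feasible_def)
  have weak: "?R w \<le> ?P" if w: "w \<in> ?D" for w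
  proof (rule INF_greatest)
    fix u assume "u \<in> primal_feasible \<Omega> k A \<tau>"
    then show "?R w \<le> primal_functional \<Omega> f u"
      using weak_duality[of w u] minus_perturbation_conjugate[of w] w DL by auto
  qed
  obtain w where w: "w \<in> Linf \<Omega>" "?P \<le> - perturbation_conjugate \<Omega> k A f \<tau> (\<lambda>x. 0) w"
    by (rule dual_attained)
  \<comment> \<open>A nonnegative primal value rules out -\<infinity> on the dual side, so the
    maximiser lies in the domain of the adjoint.\<close>
  have "0 \<le> ?P" by (intro INF_greatest) (simp add: primal_functional_def)
  then have wD: "w \<in> ?D" using w minus_perturbation_conjugate[OF w(1)] by (auto split: if_splits)
  then have "?R w = ?P" using w weak[OF wD] minus_perturbation_conjugate[OF w(1)] by (intro antisym) auto
  moreover from this have "?P = (SUP w\<in>?D. ?R w)"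
    using wD weak by (intro antisym SUP_least) (auto intro: SUP_upper2)
  ultimately show ?thesis using primal minus_perturbation_conjugate wD by auto
qed

end
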